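(* Let $(\mathfrak Q,\phi,\mathsf Q)$ be a local map. Then there exists a filtration $\mathscr F=(\mathcal F_{\mathfrak q})_{\mathfrak q\in\mathcal Q_H}$ such that $(\mathfrak Q,\phi)$ is an $\mathscr F$-Boltzmann decorated map and $\mathsf Q$ is an $\mathscr F$-stopping map for $(\mathfrak Q,\phi)$.
   Context: Maps. A planar map is a finite connected graph properly embedded in the sphere with a distinguished oriented edge (the root edge). Each edge consists of two semi-edges, one per side. The root (exterior) face is the face to the right of the root edge; its degree is the perimeter. A quadrangulation with boundary is a planar map in which all faces, except possibly the root face, are surrounded by 4 semi-edges; $\mathcal Q^\ell$ denotes those of perimeter $2\ell$. A quadrangulation with holes is a planar map with boundary which has distinguished faces, called holes, which need not be squares, each one with a marked oriented edge, all non-distinguished interior faces being surrounded by 4 semi-edges. $H(\mathfrak q)$: set of holes of $\mathfrak q$; $\mathcal Q_H$: set of quadrangulations with holes; $F_i(\mathfrak q)$: interior faces (not holes). Gluing $\mathfrak q\odot(\mathfrak u_h)_{h\in H(\mathfrak q)}$ ($\mathfrak u_h$, possibly with holes, of perimeter $\deg h$): identify the root edge of $\mathfrak u_h$ with the marked edge of $h$ and, following the orientation, the boundary edges of $\mathfrak u_h$ with the edges of $h$; the root and boundary of $\mathfrak q$ are kept. $\mathfrak q\subset\mathfrak p$ means $\mathfrak p=\mathfrak q\odot(\mathfrak u_h)_h$ for some (then uniquely defined) $(\mathfrak u_h)_h=:(\mathfrak p_h^{\mathfrak q})_h$. There is a minimal element, the empty map $\dagger$ (cemetery), with $\dagger\subset\mathfrak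 q$ for all $\mathfrak q\in\mathcal Q_H$. Decorations. Fix $\beta>0$ and a measure $\mu$ on $\mathbb R^n$. Each of the $2\ell$ sides of edges incident to the exterior face gives a phantom face; these are identified with $\{0,\dots,2\ell-1\}$ by following the direction of the root edge. A decoration assigns a value in $\mathbb R^n$ to each face of $F_i(\mathfrak q)$ and each phantom face; it has boundary condition $b$ if it equals $b$ on phantom faces. $\mathcal H^b(\mathfrak q,\sigma)=\frac\beta2\sum\|\sigma_i-\sigma_j\|^2$, summed once over all edges of $\mathfrak q$, $i,j$ being the (interior or phantom) faces on its two sides. A ($q$-)Boltzmann decorated map with semi-perimeter $\ell$ and boundary condition $b:\{0,\dots,2\ell-1\}\to\operatorname{supp}\mu$ is a random $(\mathfrak Q,\phi)$ with $\mathbb P^{\ell,b}(\mathfrak Q=\mathfrak q,\phi\in d\sigma)=\frac1{W_q^{\ell,b}}q^{|F_i(\mathfrak q)|}e^{-\mathcal H^b(\mathfrak q,\sigma)}\prod_{f\in F_i(\mathfrak q)}\mu(d\sigma_f)$, $\mathfrak q\in\mathcal Q^\ell$, where $q$ is such that $W_q^{\ell,b}<\infty$. For $\mathfrak q\subset\mathfrak Q$: $\phi|_{\mathfrak q}$ is the restriction of $\phi$ to faces of $\mathfrak q$, $\phi^{\mathfrak q}_h$ the restriction to faces inside the hole $h$. $\phi|_h$ is the boundary condition of $h$: the faces of $\mathfrak q$ adjacent to $h$ keep their spins and become phantom faces seen from $h$. Local map: a triplet $(\mathfrak Q,\phi,\mathsf Q)$ such that $(\mathfrak Q,\phi)$ is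 a (decorated) Boltzmann map; almost surely $\mathsf Q\subset\mathfrak Q$ ($\mathsf Q$ a random element of $\mathcal Q_H$); and conditionally on $\mathsf Q$ and $\phi|_{\mathsf Q}$, $(\mathfrak Q_h^{\mathsf Q},\phi_h^{\mathsf Q})_{h\in H(\mathsf Q)}$ is a collection of independent Boltzmann decorated maps with perimeter $|h|=\deg h$ and boundary condition $\phi|_h$ for every $h\in H(\mathsf Q)$. A filtration is a collection of $\mathbb P$-complete $\sigma$-algebras $(\mathcal F_{\mathfrak q})_{\mathfrak q\in\mathcal Q_H}$ with $\mathcal F_{\mathfrak q_1}\subseteq\mathcal F_{\mathfrak q_2}$ if $\mathfrak q_1\subset\mathfrak q_2$. $(\mathfrak Q,\phi)$ is an $\mathscr F$-Boltzmann decorated map if it is a Boltzmann decorated map and for every $\mathfrak q\in\mathcal Q_H$: $\{\mathfrak q\subset\mathfrak Q\}$ and $\phi|_{\mathfrak q}\mathbf 1_{\{\mathfrak q\subset\mathfrak Q\}}$ are $\mathcal F_{\mathfrak q}$-measurable; and conditionally on $\mathcal F_{\mathfrak q}$ and the event $\{\mathfrak q\subset\mathfrak Q\}$, $(\mathfrak Q_h^{\mathfrak q},\phi_h^{\mathfrak q})_{h\in H(\mathfrak q)}$ is a collection of independent $q$-Boltzmann decorated maps with boundary $h$ (perimeter $\deg h$) and boundary condition $\phi|_h$. $\mathsf Q$ is an $\mathscr F$-stopping map if almost surely $\mathsf Q\subset\mathfrak Q$ and $\{\mathsf Q\subset\mathfrak q\}\in\mathcal F_{\mathfrak q}$ for any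 $\mathfrak q\in\mathcal Q_H$.
   Formalization: Quadrangulations with holes are restricted to those where no edge has holes on both sides and the non-hole faces (with the exterior) are connected through edges, so gluing is always defined; otherwise φ|_h or the contents are ill-defined. The measure μ is taken σ-finite. *)

theory Defs
  imports "HOL-Probability.Probability" "HOL-Combinatorics.Orbits"
begin

section \<open>Rooted planar maps with holes\<close>

text \<open>
  Planar maps are encoded as combinatorial maps.  A dart is an oriented edge; it also stands for the
  semi-edge on its right side.  \<open>opp\<close> reverses a dart, and \<open>nxt\<close> gives the next dart along the face
  lying to the right, so that the faces are the orbits of \<open>nxt\<close>, the edges are the pairs
  \<open>{x, opp x}\<close>, and the vertices are the orbits of \<open>nxt \<circ> opp\<close> (the darts leaving the vertex).

  A hole is recorded by one dart in \<open>marks\<close> lying on it.  The marked oriented edge of the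
  hole \<open>h\<close> is \<open>opp h\<close>, which has the hole on its left: a filling has its root edge on this
  oriented edge and its exterior face on the right of its root edge.  Holes are indexed by their
  marks.
\<close>

record 'd hmap =
  darts :: "'d set"
  opp :: "'d \<Rightarrow> 'd"
  nxt :: "'d \<Rightarrow> 'd"
  root :: 'd
  marks :: "'d set"

definition face :: "'d hmap \<Rightarrow> 'd \<Rightarrow> 'd set" where
  "face m x = orbit (nxt m) x"

definition faces :: "'d hmap \<Rightarrow> 'd set set" where
  "faces m = face m ` darts m"

definition edges :: "'d hmap \<Rightarrow> 'd set set" where
  "edges m = (\<lambda>x. {x, opp m x}) ` darts m"

definition vertices :: "'d hmap \<Rightarrow> 'd set set" where
  "vertices m = orbit (nxt m \<circ> opp m) ` darts m"

definition ext_face :: "'d hmap \<Rightarrow> 'd set" where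
  "ext_face m = face m (root m)"

definition perimeter :: "'d hmap \<Rightarrow> nat" where
  "perimeter m = card (ext_face m)"

definition hole_darts :: "'d hmap \<Rightarrow> 'd set" where
  "hole_darts m = (\<Union>h\<in>marks m. face m h)"

definition inner_faces :: "'d hmap \<Rightarrow> 'd set set" where
  "inner_faces m = face m ` (darts m - ext_face m - hole_darts m)"

text \<open>Embedding in the sphere is expressed by connectedness and Euler's formula.\<close>

definition planar_map :: "'d hmap \<Rightarrow> bool" where
  "planar_map m \<longleftrightarrow>
     finite (darts m) \<and> root m \<in> darts m \<and>
     opp m permutes darts m \<and> (\<forall>x\<in>darts m. opp m x \<noteq> x \<and> opp m (opp m x) = x) \<and>
     nxt m permutes darts m \<and>
     (\<forall>x\<in>darts m. (root m, x) \<in> ((\<lambda>z. (z, opp m z)) ` darts m \<union> (\<lambda>z. (z, nxt m z)) ` darts m)\<^sup>*) \<and>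
     card (vertices m) + card (faces m) = card (edges m) + 2"

text \<open>
  The \<open>i\<close>-th boundary dart, following the root; and the \<open>i\<close>-th dart of a hole, counted so that the
  oriented edges \<open>opp m (hole_dart m h i)\<close>, \<open>i = 0, 1, \<dots>\<close> follow the direction of the marked edge
  \<open>opp m h\<close>.
\<close>

definition bdry_dart :: "'d hmap \<Rightarrow> nat \<Rightarrow> 'd" where
  "bdry_dart m i = (nxt m ^^ i) (root m)"

definition bdry_pos :: "'d hmap \<Rightarrow> 'd \<Rightarrow> nat" where
  "bdry_pos m x = funpow_dist (nxt m) (root m) x"

definition hole_dart :: "'d hmap \<Rightarrow> 'd \<Rightarrow> nat \<Rightarrow> 'd" where
  "hole_dart m h i = (inv (nxt m) ^^ i) h"

definition hole_pos :: "'d hmap \<Rightarrow> 'd \<Rightarrow> 'd \<Rightarrow> nat" where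
  "hole_pos m h x = funpow_dist (inv (nxt m)) h x"

definition mark_of :: "'d hmap \<Rightarrow> 'd \<Rightarrow> 'd" where
  "mark_of m x = (THE h. h \<in> marks m \<and> x \<in> face m h)"


section \<open>Gluing\<close>

text \<open>
  \<open>glue m u\<close> fills every hole \<open>h\<close> of \<open>m\<close> with \<open>u h\<close>.  The oriented boundary edge \<open>bdry_dart (u h) i\<close>
  is identified with \<open>opp m (hole_dart m h i)\<close>; the semi-edges facing the hole in \<open>m\<close> and those
  facing the exterior face in \<open>u h\<close> disappear.  The boundary of \<open>u h\<close> need not be simple: if both
  sides of an edge of \<open>u h\<close> face its exterior, the two corresponding edges of the hole
  get identified with each other.
\<close>

definition glue_darts :: "'d hmap \<Rightarrow> ('d \<Rightarrow> 'e hmap) \<Rightarrow> ('d + 'd \<times> 'e) set" where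
  "glue_darts m u = Inl ` (darts m - hole_darts m)
     \<union> Inr ` (SIGMA h:marks m. darts (u h) - ext_face (u h))"

definition glue_opp :: "'d hmap \<Rightarrow> ('d \<Rightarrow> 'e hmap) \<Rightarrow> 'd + 'd \<times> 'e \<Rightarrow> 'd + 'd \<times> 'e" where
  "glue_opp m u z =
     (let into_filling = (\<lambda>h y. if y \<in> ext_face (u h)
            then Inl (opp m (hole_dart m h (bdry_pos (u h) y))) else Inr (h, y))
      in case z of
           Inl x \<Rightarrow>
             (if opp m x \<notin> hole_darts m then Inl (opp m x)
              else let h = mark_of m (opp m x)
                   in into_filling h (opp (u h) (bdry_dart (u h) (hole_pos m h (opp m x)))))
         | Inr (h, y) \<Rightarrow> into_filling h (opp (u h) y))"

definition glue_nxt :: "'d hmap \<Rightarrow> ('d \<Rightarrow> 'e hmap) \<Rightarrow> 'd + 'd \<times> 'e \<Rightarrow> 'd + 'd \<times> 'e" where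
  "glue_nxt m u z = (case z of Inl x \<Rightarrow> Inl (nxt m x) | Inr (h, y) \<Rightarrow> Inr (h, nxt (u h) y))"

definition glue :: "'d hmap \<Rightarrow> ('d \<Rightarrow> 'e hmap) \<Rightarrow> ('d + 'd \<times> 'e) hmap" where
  "glue m u = \<lparr>darts = glue_darts m u,
     opp = (\<lambda>z. if z \<in> glue_darts m u then glue_opp m u z else z),
     nxt = (\<lambda>z. if z \<in> glue_darts m u then glue_nxt m u z else z),
     root = Inl (root m),
     marks = Inr ` (SIGMA h:marks m. marks (u h))\<rparr>"


section \<open>Quadrangulations with holes\<close>

text \<open>
  For the gluing, the boundary condition of a hole and the contents of the holes to make sense, the
  holes cannot be completely arbitrary.
  \<^item> No edge has holes on both sides; otherwise a hole would have sides without a spin across them.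
  \<^item> The faces other than the holes (including the exterior one) are connected through edges.
    This is what makes the contents of the holes uniquely determined.  It excludes for instance a
    hole with a pinched boundary, for which a filling pinched at the same place would disconnect the
    map.
  \<^item> Filling the holes with planar maps of the right perimeters always yields a planar map, that is,
    gluing is defined for all such families.  (This follows from the two previous conditions: closing
    up edges pairwise never lowers the Euler characteristic, and the result is connected.)
\<close>

definition good_holes :: "'d hmap \<Rightarrow> bool" where
  "good_holes m \<longleftrightarrow>
     (let D = darts m - hole_darts m in
       (\<forall>x\<in>hole_darts m. opp m x \<in> D) \<and>
       (\<forall>x\<in>D. (root m, x) \<in> ({(z, opp m z) | z. z \<in> D \<and> opp m z \<in> D} \<union> (\<lambda>z. (z, nxt m z)) ` D)\<^sup>*) \<and>
       (\<forall>u :: 'd \<Rightarrow> nat hmap.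
          (\<forall>h\<in>marks m. planar_map (u h) \<and> perimeter (u h) = card (face m h)) \<longrightarrow> planar_map (glue m u)))"

definition quad_with_holes :: "'d hmap \<Rightarrow> bool" where
  "quad_with_holes m \<longleftrightarrow> planar_map m \<and> marks m \<subseteq> darts m \<and>
     (\<forall>h\<in>marks m. face m h \<noteq> ext_face m) \<and> inj_on (face m) (marks m) \<and>
     (\<forall>f\<in>inner_faces m. card f = 4) \<and> good_holes m"

definition map_iso :: "('d \<Rightarrow> 'e) \<Rightarrow> 'd hmap \<Rightarrow> 'e hmap \<Rightarrow> bool" where
  "map_iso f m m' \<longleftrightarrow> bij_betw f (darts m) (darts m') \<and> f (root m) = root m' \<and>
     (\<forall>x\<in>darts m. f (opp m x) = opp m' (f x) \<and> f (nxt m x) = nxt m' (f x)) \<and>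
     f ` marks m = marks m'"

text \<open>
  Maps are considered up to isomorphism; we work with one chosen representative of each class.
\<close>

definition chosen :: "nat hmap \<Rightarrow> bool" where
  "chosen m \<longleftrightarrow> m = (SOME m'. \<exists>f. map_iso f m m' \<and> planar_map m')"

definition QH0 :: "nat hmap set" where
  "QH0 = {m. quad_with_holes m \<and> chosen m}"

definition QB :: "nat hmap set" where
  "QB = {m \<in> QH0. marks m = {}}"

text \<open>\<open>QB_per d\<close> is \<open>\<Q>\<^sup>l\<close> for \<open>d = 2 l\<close>.\<close>

definition QB_per :: "nat \<Rightarrow> nat hmap set" where
  "QB_per d = {m \<in> QB. perimeter m = d}"

text \<open>The set of all quadrangulations with holes; \<open>None\<close> is the empty map (cemetery).\<close>

definition QH :: "nat hmap option set" where
  "QH = insert None (Some ` QH0)"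

definition filled_by ::
  "nat hmap \<Rightarrow> (nat \<Rightarrow> nat hmap) \<Rightarrow> (nat + nat \<times> nat \<Rightarrow> nat) \<Rightarrow> nat hmap \<Rightarrow> bool" where
  "filled_by m u f p \<longleftrightarrow>
     (\<forall>h\<in>marks m. u h \<in> QH0 \<and> perimeter (u h) = card (face m h)) \<and> map_iso f (glue m u) p"

fun submap :: "nat hmap option \<Rightarrow> nat hmap option \<Rightarrow> bool"  (infix \<open>\<sqsubseteq>\<^sub>H\<close> 50) where
  "None \<sqsubseteq>\<^sub>H p \<longleftrightarrow> True"
| "Some m \<sqsubseteq>\<^sub>H None \<longleftrightarrow> False"
| "Some m \<sqsubseteq>\<^sub>H Some p \<longleftrightarrow> (\<exists>u f. filled_by m u f p)"

definition filling :: "nat hmap \<Rightarrow> nat hmap \<Rightarrow> (nat \<Rightarrow> nat hmap) \<times> (nat + nat \<times> nat \<Rightarrow> nat)" where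
  "filling m p = (SOME (u, f). filled_by m u f p)"

text \<open>
  The empty map has a single hole (with index \<open>0\<close>), whose content is the whole map; this is what
  \<open>\<dagger> \<subset> p\<close> means in terms of gluing.
\<close>

fun holes :: "nat hmap option \<Rightarrow> nat set" where
  "holes None = {0}"
| "holes (Some m) = marks m"

fun inner_faces_H :: "nat hmap option \<Rightarrow> nat set set" where
  "inner_faces_H None = {}"
| "inner_faces_H (Some m) = inner_faces m"

fun content :: "nat hmap option \<Rightarrow> nat hmap \<Rightarrow> nat \<Rightarrow> nat hmap" where
  "content None p h = p"
| "content (Some m) p h = fst (filling m p) h"


section \<open>Decorations\<close>

type_synonym 'v deco = "nat set \<Rightarrow> 'v"

text \<open>
  A decoration \<open>\<sigma>\<close> of \<open>m\<close> with boundary condition \<open>b\<close> is given by its values on the interior faces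
  (and is \<open>undefined\<close> on other sets of darts).  \<open>spin m b \<sigma> x\<close> is the spin of the
  interior or phantom face to the right of \<open>x\<close>.
\<close>

definition spin :: "nat hmap \<Rightarrow> (nat \<Rightarrow> 'v) \<Rightarrow> 'v deco \<Rightarrow> nat \<Rightarrow> 'v" where
  "spin m b \<sigma> x = (if x \<in> ext_face m then b (bdry_pos m x) else \<sigma> (face m x))"

text \<open>The additional factor \<open>1/2\<close> is there because each edge consists of two darts.\<close>

definition energy :: "real \<Rightarrow> nat hmap \<Rightarrow> (nat \<Rightarrow> 'v::real_normed_vector) \<Rightarrow> 'v deco \<Rightarrow> real" where
  "energy \<beta> m b \<sigma> =
     \<beta> / 2 * ((\<Sum>x\<in>darts m. (norm (spin m b \<sigma> x - spin m b \<sigma> (opp m x)))\<^sup>2) / 2)"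

text \<open>\<open>\<phi>|\<^sub>m 1\<^bsub>{m \<subset> p}\<^esub>\<close>, for a decoration \<open>\<sigma>\<close> of \<open>p\<close>\<close>

fun restr :: "nat hmap option \<Rightarrow> nat hmap \<Rightarrow> 'v::zero deco \<Rightarrow> 'v deco" where
  "restr None p \<sigma> = (\<lambda>f. undefined)"
| "restr (Some m) p \<sigma> =
     (\<lambda>f\<in>inner_faces m. if Some m \<sqsubseteq>\<^sub>H Some p then \<sigma> (snd (filling m p) ` Inl ` f) else 0)"

fun content_deco :: "nat hmap option \<Rightarrow> nat hmap \<Rightarrow> 'v deco \<Rightarrow> nat \<Rightarrow> 'v deco" where
  "content_deco None p \<sigma> h = \<sigma>"
| "content_deco (Some m) p \<sigma> h =
     (\<lambda>f\<in>inner_faces (content (Some m) p h). \<sigma> (snd (filling m p) ` (\<lambda>y. Inr (h, y)) ` f))"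

text \<open>
  Perimeter and boundary condition of a hole, when the perimeter and the boundary condition
  of the whole map are \<open>d\<close> and \<open>b\<close> and the submap is decorated by \<open>\<tau>\<close>
\<close>

fun hole_per :: "nat \<Rightarrow> nat hmap option \<Rightarrow> nat \<Rightarrow> nat" where
  "hole_per d None h = d"
| "hole_per d (Some m) h = card (face m h)"

fun hole_bc :: "(nat \<Rightarrow> 'v) \<Rightarrow> nat hmap option \<Rightarrow> 'v deco \<Rightarrow> nat \<Rightarrow> nat \<Rightarrow> 'v" where
  "hole_bc b None \<tau> h = b"
| "hole_bc b (Some m) \<tau> h = (\<lambda>i. spin m b \<tau> (opp m (hole_dart m h i)))"


section \<open>Boltzmann decorated maps\<close>

text \<open>Faces are finite sets of natural numbers, so that countably many coordinates suffice.\<close>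

definition deco_alg :: "'v::topological_space deco measure" where
  "deco_alg = PiM (Collect finite) (\<lambda>_. borel)"

definition deco_maps :: "(nat hmap \<times> 'v::topological_space deco) measure" where
  "deco_maps = count_space QB \<Otimes>\<^sub>M deco_alg"

definition msupport :: "'v::topological_space measure \<Rightarrow> 'v set" where
  "msupport \<mu> = {x. \<forall>U. open U \<longrightarrow> x \<in> U \<longrightarrow> emeasure \<mu> U > 0}"

definition boltzmann_weight ::
  "real \<Rightarrow> real \<Rightarrow> 'v::real_normed_vector measure \<Rightarrow> nat \<Rightarrow> (nat \<Rightarrow> 'v) \<Rightarrow> (nat hmap \<times> 'v deco) set \<Rightarrow> ennreal" where
  "boltzmann_weight \<beta> q \<mu> d b A =
     (\<integral>\<^sup>+ m. ennreal (q ^ card (inner_faces m)) *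
        (\<integral>\<^sup>+ \<sigma>. ennreal (exp (- energy \<beta> m b \<sigma>)) * indicator A (m, \<sigma>)
           \<partial>PiM (inner_faces m) (\<lambda>_. \<mu>))
      \<partial>count_space (QB_per d))"

definition partition_function ::
  "real \<Rightarrow> real \<Rightarrow> 'v::real_normed_vector measure \<Rightarrow> nat \<Rightarrow> (nat \<Rightarrow> 'v) \<Rightarrow> ennreal" where
  "partition_function \<beta> q \<mu> d b = boltzmann_weight \<beta> q \<mu> d b UNIV"

definition boltzmann_law ::
  "real \<Rightarrow> real \<Rightarrow> 'v::real_normed_vector measure \<Rightarrow> nat \<Rightarrow> (nat \<Rightarrow> 'v) \<Rightarrow> (nat hmap \<times> 'v deco) measure" where
  "boltzmann_law \<beta> q \<mu> d b = measure_of (space deco_maps) (sets deco_maps)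
     (\<lambda>A. boltzmann_weight \<beta> q \<mu> d b A / partition_function \<beta> q \<mu> d b)"

definition boltzmann_map ::
  "real \<Rightarrow> real \<Rightarrow> 'v::real_normed_vector measure \<Rightarrow> nat \<Rightarrow> (nat \<Rightarrow> 'v) \<Rightarrow>
   'w measure \<Rightarrow> ('w \<Rightarrow> nat hmap) \<Rightarrow> ('w \<Rightarrow> 'v deco) \<Rightarrow> bool" where
  "boltzmann_map \<beta> q \<mu> l b P X \<phi> \<longleftrightarrow>
     (\<forall>i<2 * l. b i \<in> msupport \<mu>) \<and> partition_function \<beta> q \<mu> (2 * l) b < \<infinity> \<and>
     X \<in> measurable P (count_space QB) \<and> \<phi> \<in> measurable P deco_alg \<and>
     distr P deco_maps (\<lambda>\<omega>. (X \<omega>, \<phi> \<omega>)) = boltzmann_law \<beta> q \<mu> (2 * l) b"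

text \<open>
  Given the \<open>\<sigma>\<close>-algebra \<open>G\<close> and on the event \<open>E\<close> (of \<open>G\<close>), on which \<open>m\<close> is a submap of
  \<open>X\<close>, the decorated maps filling the holes of \<open>m\<close> are independent Boltzmann decorated maps whose
  perimeters are the hole degrees and whose boundary conditions are read off from \<open>\<phi>|\<^sub>m\<close>.
\<close>

definition holes_indep_boltzmann ::
  "real \<Rightarrow> real \<Rightarrow> 'v::real_normed_vector measure \<Rightarrow> nat \<Rightarrow> (nat \<Rightarrow> 'v) \<Rightarrow>
   'w measure \<Rightarrow> ('w \<Rightarrow> nat hmap) \<Rightarrow> ('w \<Rightarrow> 'v deco) \<Rightarrow>
   'w measure \<Rightarrow> 'w set \<Rightarrow> nat hmap option \<Rightarrow> bool" where
  "holes_indep_boltzmann \<beta> q \<mu> l b P X \<phi> G E m \<longleftrightarrow>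
     (\<forall>B. (\<forall>h\<in>holes m. B h \<in> sets deco_maps) \<longrightarrow>
       (AE \<omega> in P. \<omega> \<in> E \<longrightarrow>
          nn_cond_exp P G
            (indicator {\<omega>' \<in> E. m \<sqsubseteq>\<^sub>H Some (X \<omega>') \<and>
               (\<forall>h\<in>holes m. (content m (X \<omega>') h, content_deco m (X \<omega>') (\<phi> \<omega>') h) \<in> B h)}) \<omega>
          = (\<Prod>h\<in>holes m. emeasure (boltzmann_law \<beta> q \<mu> (hole_per (2 * l) m h)
                (hole_bc b m (restr m (X \<omega>) (\<phi> \<omega>)) h)) (B h))))"


section \<open>Local maps, filtrations and stopping maps\<close>

definition sigma_sub ::
  "'w measure \<Rightarrow> ('w \<Rightarrow> nat hmap) \<Rightarrow> ('w \<Rightarrow> 'v::real_normed_vector deco) \<Rightarrow> ('w \<Rightarrow> nat hmap option) \<Rightarrow> 'w measure" where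
  "sigma_sub P X \<phi> S = vimage_algebra (space P) (\<lambda>\<omega>. (S \<omega>, restr (S \<omega>) (X \<omega>) (\<phi> \<omega>)))
     (count_space QH \<Otimes>\<^sub>M deco_alg)"

definition local_map ::
  "real \<Rightarrow> real \<Rightarrow> 'v::real_normed_vector measure \<Rightarrow> nat \<Rightarrow> (nat \<Rightarrow> 'v) \<Rightarrow>
   'w measure \<Rightarrow> ('w \<Rightarrow> nat hmap) \<Rightarrow> ('w \<Rightarrow> 'v deco) \<Rightarrow> ('w \<Rightarrow> nat hmap option) \<Rightarrow> bool" where
  "local_map \<beta> q \<mu> l b P X \<phi> S \<longleftrightarrow>
     boltzmann_map \<beta> q \<mu> l b P X \<phi> \<and>
     S \<in> measurable P (count_space QH) \<and> (AE \<omega> in P. S \<omega> \<sqsubseteq>\<^sub>H Some (X \<omega>)) \<and>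
     (\<forall>m\<in>QH. holes_indep_boltzmann \<beta> q \<mu> l b P X \<phi> (sigma_sub P X \<phi> S) {\<omega> \<in> space P. S \<omega> = m} m)"

definition map_filtration :: "'w measure \<Rightarrow> (nat hmap option \<Rightarrow> 'w measure) \<Rightarrow> bool" where
  "map_filtration P F \<longleftrightarrow>
     (\<forall>m\<in>QH. subalgebra P (F m) \<and> (\<forall>N\<in>null_sets P. \<forall>A\<subseteq>N. A \<in> sets (F m))) \<and>
     (\<forall>m\<in>QH. \<forall>m'\<in>QH. m \<sqsubseteq>\<^sub>H m' \<longrightarrow> sets (F m) \<subseteq> sets (F m'))"

definition filtered_boltzmann_map ::
  "real \<Rightarrow> real \<Rightarrow> 'v::real_normed_vector measure \<Rightarrow> nat \<Rightarrow> (nat \<Rightarrow> 'v) \<Rightarrow>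
   'w measure \<Rightarrow> (nat hmap option \<Rightarrow> 'w measure) \<Rightarrow> ('w \<Rightarrow> nat hmap) \<Rightarrow> ('w \<Rightarrow> 'v deco) \<Rightarrow> bool" where
  "filtered_boltzmann_map \<beta> q \<mu> l b P F X \<phi> \<longleftrightarrow>
     boltzmann_map \<beta> q \<mu> l b P X \<phi> \<and>
     (\<forall>m\<in>QH. {\<omega> \<in> space P. m \<sqsubseteq>\<^sub>H Some (X \<omega>)} \<in> sets (F m) \<and>
        (\<lambda>\<omega>. restr m (X \<omega>) (\<phi> \<omega>)) \<in> measurable (F m) (PiM (inner_faces_H m) (\<lambda>_. borel)) \<and>
        holes_indep_boltzmann \<beta> q \<mu> l b P X \<phi> (F m) {\<omega> \<in> space P. m \<sqsubseteq>\<^sub>H Some (X \<omega>)} m)"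

definition stopping_map ::
  "'w measure \<Rightarrow> (nat hmap option \<Rightarrow> 'w measure) \<Rightarrow> ('w \<Rightarrow> nat hmap) \<Rightarrow> ('w \<Rightarrow> nat hmap option) \<Rightarrow> bool" where
  "stopping_map P F X S \<longleftrightarrow>
     S \<in> measurable P (count_space QH) \<and> (AE \<omega> in P. S \<omega> \<sqsubseteq>\<^sub>H Some (X \<omega>)) \<and>
     (\<forall>m\<in>QH. {\<omega> \<in> space P. S \<omega> \<sqsubseteq>\<^sub>H m} \<in> sets (F m))"

end

theory Submission
  imports Defs
begin

text \<open>
  By the spatial Markov property of the Boltzmann law and the uniqueness of fillings, the property
  defining a local map holds on \<open>{S = r}\<close> if and only if, where \<open>r\<close> is a submap of \<open>X\<close>, the
  conditional probability of \<open>{S = r}\<close> given \<open>(X, \<phi>)\<close> is a function of the decoration of \<open>r\<close>.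
  If \<open>r\<close> is a submap of \<open>m\<close>, the decoration of \<open>r\<close> is a function of that of \<open>m\<close>, so the
  same conditional probability is also a function of the decoration of \<open>m\<close>: on \<open>{S = r}\<close> and
  where \<open>m\<close> is a submap of \<open>X\<close>, the holes of \<open>m\<close> are again filled by independent Boltzmann maps.

  The \<open>\<sigma>\<close>-algebra at \<open>m\<close> is generated by the null sets and, for all \<open>r\<close> below \<open>m\<close>, by the
  events \<open>{S = r}\<close> and \<open>{r \<subset> X}\<close> and by the decoration of \<open>r\<close>.  Where \<open>m\<close> is a submap of \<open>X\<close>,
  it only contains the decoration of \<open>m\<close> and the countable partition into the events
  \<open>{S = r}\<close> and the complement of their union, and the Markov property passes from the
  events \<open>{S = r}\<close> and the whole space to that complement by subtraction.
\<close>

section \<open>Combinatorial maps\<close>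

text \<open>The defining property of a local map concerns the holes of the value of \<open>S\<close>
  itself, whereas the filtration needs it for the holes of every larger \<open>m\<close>. A direct
  passage would have to condition the content of each hole of \<open>r\<close> on containing a given
  piece of \<open>m\<close>. The conditional probability of \<open>S = r\<close> given the whole
  decorated map avoids this: it is formulated without holes, so enlarging \<open>r\<close> costs
  only a change of variable on decorations.

  Three facts carry the argument. Rooted connected maps have no automorphisms, so a submap sits in a
  map in one way only, its darts and the contents of its holes being forced by the root. No edge has
  holes on both sides, so the energy is a term for the submap plus one term per hole, and a hole
  sees the submap only through its boundary condition. There are countably many maps, so integrals
  over decorated maps are countable sums of finite-dimensional ones.\<close>

lemma card_orbit_eq_funpow_dist1:
  assumes "x \<in> orbit f x"
  shows "card (orbit f x) = funpow_dist1 f x x"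
  by (subst orbit_conv_funpow_dist1[OF assms]) (simp add: card_image inj_on_funpow_dist1[OF assms])

lemma funpow_mod_card_orbit:
  assumes "x \<in> orbit f x"
  shows "(f ^^ (i mod card (orbit f x))) x = (f ^^ i) x"
  unfolding card_orbit_eq_funpow_dist1[OF assms]
  by (rule funpow_mod_eq) (rule funpow_dist1_prop[OF assms])

text \<open>Index and element determine each other modulo the length of the orbit. This serves both
  numberings in use, \<open>bdry_pos\<close> along the boundary and \<open>hole_pos\<close> around a
  hole.\<close>

lemma funpow_dist_funpow:
  assumes "x \<in> orbit f x"
  shows "funpow_dist f x ((f ^^ i) x) = i mod card (orbit f x)"
proof -
  let ?n = "card (orbit f x)"
  have n: "?n = funpow_dist1 f x x" by (rule card_orbit_eq_funpow_dist1[OF assms])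
  then have n0: "?n > 0" by simp
  have "funpow_dist f x ((f ^^ (i mod ?n)) x) = i mod ?n"
  proof (rule ccontr)
    let ?k = "funpow_dist f x ((f ^^ (i mod ?n)) x)"
    assume ne: "?k \<noteq> i mod ?n"
    have le: "?k \<le> i mod ?n" unfolding funpow_dist_def by (rule Least_le) simp
    have "(f ^^ ?k) x = (f ^^ (i mod ?n)) x"
      by (rule funpow_dist_prop[OF funpow_in_orbit[OF assms]])
    moreover have "i mod ?n < ?n" using n0 by simp
    ultimately show False
      using funpow_neq_less_funpow_dist1[OF assms, of ?k "i mod ?n"] ne le n by linarith
  qed
  then show ?thesis by (simp add: funpow_mod_card_orbit[OF assms])
qed

text \<open>The commutation is required only on the orbit, because an isomorphism or the inclusion
  into a glued map respects \<open>nxt\<close> only on the darts concerned.\<close>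

lemma funpow_dist_image:
  assumes "x \<in> orbit f x" and "\<And>y. y \<in> orbit f x \<Longrightarrow> h (f y) = g (h y)" and "inj_on h (orbit f x)"
    and "y \<in> orbit f x"
  shows "funpow_dist g (h x) (h y) = funpow_dist f x y"
proof -
  have "(g ^^ n) (h x) = h ((f ^^ n) x) \<and> (f ^^ n) x \<in> orbit f x" for n
    by (induction n) (auto simp: assms(1) assms(2)[symmetric] intro: orbit.step)
  then show ?thesis
    unfolding funpow_dist_def by (metis (no_types, lifting) assms(3,4) inj_onD)
qed

section \<open>Darts and faces of a planar map, and induction along its edges\<close>

lemma planar_map_permutation:
  assumes "planar_map m"
  shows "finite (darts m)" "root m \<in> darts m" "opp m permutes darts m" "nxt m permutes darts m"
    "permutation (nxt m)" "permutation (opp m)"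
    "\<And>x. x \<in> darts m \<Longrightarrow> opp m x \<in> darts m" "\<And>x. x \<in> darts m \<Longrightarrow> nxt m x \<in> darts m"
    "\<And>x. x \<in> darts m \<Longrightarrow> opp m (opp m x) = x"
    "\<And>x. x \<in> face m x" "\<And>x. x \<in> darts m \<Longrightarrow> face m x \<subseteq> darts m"
  using assms unfolding planar_map_def face_def
  by (auto simp: permutation_permutes permutes_in_image
      intro!: permutation_self_in_orbit[unfolded permutation_permutes] dest: permutes_orbit_subset)

text \<open>Connectedness in the form of an induction: a property of darts, such as the agreement of
  two morphisms, is carried from the root to all darts along \<open>opp\<close> and
  \<open>nxt\<close>.\<close>

lemma planar_map_induct [consumes 2, case_names root opp nxt]:
  assumes "planar_map m" "x \<in> darts m"
    and "P (root m)"
    and "\<And>x. x \<in> darts m \<Longrightarrow> P x \<Longrightarrow> P (opp m x)"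
    and "\<And>x. x \<in> darts m \<Longrightarrow> P x \<Longrightarrow> P (nxt m x)"
  shows "P x"
proof -
  have "(root m, x) \<in> ((\<lambda>z. (z, opp m z)) ` darts m \<union> (\<lambda>z. (z, nxt m z)) ` darts m)\<^sup>*"
    using assms(1,2) by (auto simp: planar_map_def)
  then show ?thesis by induction (use assms in auto)
qed

lemma face_eqI:
  assumes "planar_map m" "y \<in> face m x"
  shows "face m y = face m x"
  using orbit_cyclic_eq3[OF cyclic_on_orbit' assms(2)[unfolded face_def]] planar_map_permutation(5)[OF assms(1)]
  by (simp add: face_def)

lemma nxt_in_face_iff:
  assumes "planar_map m"
  shows "nxt m y \<in> face m x \<longleftrightarrow> y \<in> face m x"
proof
  assume "nxt m y \<in> face m x"
  moreover have "nxt m y \<in> face m y" by (simp add: face_def orbit.base)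
  ultimately show "y \<in> face m x"
    using face_eqI[OF assms] planar_map_permutation(10)[OF assms] by metis
qed (auto simp: face_def intro: orbit.step)

lemma nxt_in_ext_face_iff:
  "planar_map m \<Longrightarrow> nxt m y \<in> ext_face m \<longleftrightarrow> y \<in> ext_face m"
  unfolding ext_face_def by (rule nxt_in_face_iff)

lemma nxt_in_hole_darts_iff:
  "planar_map m \<Longrightarrow> nxt m y \<in> hole_darts m \<longleftrightarrow> y \<in> hole_darts m"
  unfolding hole_darts_def by (simp add: nxt_in_face_iff)

lemma finite_inner_faces:
  "planar_map m \<Longrightarrow> finite (inner_faces m)"
  by (simp add: inner_faces_def planar_map_permutation(1))

lemma inner_face_subset_darts:
  "planar_map m \<Longrightarrow> f \<in> inner_faces m \<Longrightarrow> f \<subseteq> darts m"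
  using planar_map_permutation(11)[of m] by (auto simp: inner_faces_def)

lemma inner_faces_finite:
  "planar_map m \<Longrightarrow> f \<in> inner_faces m \<Longrightarrow> finite f"
  by (meson finite_subset inner_face_subset_darts planar_map_permutation(1))

subsection \<open>Isomorphisms\<close>

lemma map_iso_image_darts: "map_iso f m m' \<Longrightarrow> f ` darts m = darts m'"
  by (auto simp: map_iso_def bij_betw_def)

lemma map_iso_inj_on: "map_iso f m m' \<Longrightarrow> inj_on f (darts m)"
  by (auto simp: map_iso_def bij_betw_def)

lemma map_isoD:
  assumes "map_iso f m m'"
  shows "f (root m) = root m'" "x \<in> darts m \<Longrightarrow> f (opp m x) = opp m' (f x)"
    "x \<in> darts m \<Longrightarrow> f (nxt m x) = nxt m' (f x)" "x \<in> darts m \<Longrightarrow> f x \<in> darts m'"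
    "f ` marks m = marks m'"
  using assms by (auto simp: map_iso_def bij_betw_def)

lemma map_iso_refl: "map_iso (\<lambda>x. x) m m"
  by (simp add: map_iso_def bij_betw_def)

lemma map_iso_trans:
  assumes "map_iso f m m'" "map_iso g m' m''"
  shows "map_iso (g \<circ> f) m m''"
  unfolding map_iso_def
proof (intro conjI ballI)
  show "bij_betw (g \<circ> f) (darts m) (darts m'')"
    using assms by (auto simp: map_iso_def intro: bij_betw_trans)
  show "(g \<circ> f) ` marks m = marks m''"
    by (simp only: image_comp[symmetric] map_isoD(5)[OF assms(1)] map_isoD(5)[OF assms(2)])
qed (use assms in \<open>simp_all add: map_isoD\<close>)

lemma map_iso_sym:
  assumes f: "map_iso f m m'" and m: "planar_map m" "marks m \<subseteq> darts m"
  shows "map_iso (inv_into (darts m) f) m' m"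
proof -
  let ?g = "inv_into (darts m) f"
  have inv: "?g (f x) = x" if "x \<in> darts m" for x
    using that map_iso_inj_on[OF f] by simp
  have "?g ` marks m' = marks m"
    unfolding map_isoD(5)[OF f, symmetric] using m(2) inv by (force simp: image_image)
  moreover have "bij_betw ?g (darts m') (darts m)"
    using f by (auto simp: map_iso_def intro: bij_betw_inv_into)
  moreover have "?g (opp m' y) = opp m (?g y)" "?g (nxt m' y) = nxt m (?g y)" if "y \<in> darts m'" for y
  proof -
    obtain x where x: "x \<in> darts m" "y = f x" using \<open>y \<in> _\<close> map_iso_image_darts[OF f] by blast
    show "?g (opp m' y) = opp m (?g y)" "?g (nxt m' y) = nxt m (?g y)"
      using x inv planar_map_permutation(7,8)[OF m(1)] map_isoD(2,3)[OF f x(1), symmetric] by simp_all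
  qed
  moreover have "?g (root m') = root m"
    using inv[OF planar_map_permutation(2)[OF m(1)]] map_isoD(1)[OF f] by simp
  ultimately show ?thesis unfolding map_iso_def by blast
qed

lemma map_iso_face:
  assumes f: "map_iso f m m'" and m: "planar_map m" and x: "x \<in> darts m"
  shows "face m' (f x) = f ` face m x"
  unfolding face_def
  by (rule orbit_inverse[symmetric])
    (use permutation_self_in_orbit[OF planar_map_permutation(5)[OF m]]
      planar_map_permutation(11)[OF m x] map_isoD(3)[OF f] in \<open>auto simp: face_def\<close>)

lemma map_iso_ext_face:
  "map_iso f m m' \<Longrightarrow> planar_map m \<Longrightarrow> ext_face m' = f ` ext_face m"
  unfolding ext_face_def using map_iso_face[of f m m' "root m"]
  by (simp add: map_isoD(1) planar_map_permutation(2))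

lemma map_iso_hole_darts:
  "map_iso f m m' \<Longrightarrow> planar_map m \<Longrightarrow> marks m \<subseteq> darts m \<Longrightarrow> hole_darts m' = f ` hole_darts m"
  unfolding hole_darts_def map_isoD(5)[of f m m', symmetric]
  by (simp add: image_UN subset_iff map_iso_face)

lemma ext_face_subset: "planar_map m \<Longrightarrow> ext_face m \<subseteq> darts m"
  by (simp add: ext_face_def planar_map_permutation)

lemma hole_darts_subset: "planar_map m \<Longrightarrow> marks m \<subseteq> darts m \<Longrightarrow> hole_darts m \<subseteq> darts m"
  using planar_map_permutation(11)[of m] by (fastforce simp: hole_darts_def)

lemma map_iso_inner_faces:
  assumes f: "map_iso f m m'" and m: "planar_map m" "marks m \<subseteq> darts m"
  shows "inner_faces m' = (`) f ` inner_faces m"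
proof -
  have "darts m' - ext_face m' - hole_darts m' = f ` (darts m - ext_face m - hole_darts m)"
    using map_iso_inj_on[OF f] ext_face_subset[OF m(1)] hole_darts_subset[OF m]
      map_iso_ext_face[OF f m(1)] map_iso_hole_darts[OF f m] map_iso_image_darts[OF f, symmetric]
    by (auto simp: inj_on_def subset_iff)
  then show ?thesis
    unfolding inner_faces_def by (auto simp: image_image map_iso_face[OF f m(1)])
qed

lemma map_iso_perimeter:
  assumes f: "map_iso f m m'" and m: "planar_map m"
  shows "perimeter m' = perimeter m"
  unfolding perimeter_def map_iso_ext_face[OF assms]
  by (rule card_image) (meson ext_face_subset inj_on_subset m map_iso_inj_on[OF f])

lemma map_iso_bdry_pos:
  assumes f: "map_iso f m m'" and m: "planar_map m" and x: "x \<in> ext_face m"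
  shows "bdry_pos m' (f x) = bdry_pos m x"
  unfolding bdry_pos_def map_isoD(1)[OF f, symmetric]
  by (rule funpow_dist_image)
    (use x ext_face_subset[OF m] permutation_self_in_orbit[OF planar_map_permutation(5)[OF m]]
      in \<open>auto simp: map_isoD[OF f] ext_face_def face_def subset_iff intro: inj_on_subset[OF map_iso_inj_on[OF f]]\<close>)

text \<open>\<open>map_iso\<close> is silent outside the darts, while \<open>permutes\<close> asks
  for the identity there; \<open>out\<close> supplies it. Vertices, edges and faces are images of
  their counterparts, so Euler's formula is carried over by counting.\<close>

lemma planar_map_iso:
  assumes f: "map_iso f m m'" and m: "planar_map m"
    and out: "\<And>x. x \<notin> darts m' \<Longrightarrow> opp m' x = x \<and> nxt m' x = x"
  shows "planar_map m'"
proof -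
  note P = planar_map_permutation[OF m] and D = map_iso_image_darts[OF f]
  have bij: "bij_betw g' (darts m') (darts m')"
    if "g permutes darts m" "\<And>x. x \<in> darts m \<Longrightarrow> f (g x) = g' (f x)" for g g'
  proof -
    have "inj_on g' (darts m')"
      unfolding D[symmetric]
      by (auto intro!: inj_onI simp: that(2)[symmetric])
        (metis map_iso_inj_on[OF f] inj_onD permutes_in_image permutes_inj injD that(1))
    moreover have "g' ` darts m' = darts m'"
    proof -
      have "g' ` f ` darts m = f ` g ` darts m"
        unfolding image_image by (rule image_cong) (simp_all add: that(2))
      then show ?thesis by (simp add: D permutes_image[OF that(1)])
    qed
    ultimately show ?thesis by (simp add: bij_betw_def)
  qed
  have opp: "opp m' permutes darts m'"
    by (rule bij_imp_permutes[OF bij[OF P(3)]]) (auto simp: map_isoD[OF f] out)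
  have nxt: "nxt m' permutes darts m'"
    by (rule bij_imp_permutes[OF bij[OF P(4)]]) (auto simp: map_isoD[OF f] out)
  have opp2: "opp m' x \<noteq> x \<and> opp m' (opp m' x) = x" if "x \<in> darts m'" for x
  proof -
    obtain y where y: "y \<in> darts m" "x = f y" using \<open>x \<in> _\<close> D by blast
    moreover have "opp m y \<noteq> y" using m y(1) by (auto simp: planar_map_def)
    ultimately show ?thesis
      using P(7,9) map_isoD(2)[OF f, symmetric] inj_onD[OF map_iso_inj_on[OF f]] by metis
  qed
  have conn: "(root m', x) \<in> ((\<lambda>z. (z, opp m' z)) ` darts m' \<union> (\<lambda>z. (z, nxt m' z)) ` darts m')\<^sup>*"
    (is "_ \<in> ?R\<^sup>*") if "x \<in> darts m'" for x
  proof -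
    obtain y where y: "y \<in> darts m" "x = f y" using \<open>x \<in> _\<close> D by blast
    have "(root m', f y) \<in> ?R\<^sup>*" using m y(1)
    proof (induction rule: planar_map_induct)
      case (opp x) then show ?case
        by (auto simp: map_isoD[OF f] intro!: rtrancl_into_rtrancl[of "root m'" "f x"])
    next
      case (nxt x) then show ?case
        by (auto simp: map_isoD[OF f] intro!: rtrancl_into_rtrancl[of "root m'" "f x"])
    qed (simp add: map_isoD[OF f])
    then show ?thesis using y by simp
  qed
  \<comment> \<open>Vertices, edges and faces are all sets of darts, so injectivity on the power set
    preserves the three cardinalities at once.\<close>
  have inj: "inj_on ((`) f) (Pow (darts m))"
    by (intro inj_on_image_Pow map_iso_inj_on[OF f])
  have faces: "faces m' = (`) f ` faces m"
    unfolding faces_def D[symmetric] image_image by (intro image_cong) (simp_all add: map_iso_face[OF f m])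
  have edges: "edges m' = (`) f ` edges m"
    unfolding edges_def D[symmetric] by (auto simp: image_image map_isoD(2)[OF f])
  have perm: "nxt m \<circ> opp m permutes darts m" using P(3,4) by (rule permutes_compose)
  have orb: "orbit (nxt m' \<circ> opp m') (f x) = f ` orbit (nxt m \<circ> opp m) x" if "x \<in> darts m" for x
  proof (rule orbit_inverse[symmetric])
    show "x \<in> orbit (nxt m \<circ> opp m) x"
      using P(1) perm by (auto intro!: permutation_self_in_orbit simp only: permutation_permutes)
    show "(nxt m' \<circ> opp m') (f y) = f ((nxt m \<circ> opp m) y)" if "y \<in> orbit (nxt m \<circ> opp m) x" for y
      using that permutes_orbit_subset[OF perm \<open>x \<in> darts m\<close>] P(7) by (auto simp: map_isoD[OF f])
  qed
  have vertices: "vertices m' = (`) f ` vertices m"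
    unfolding vertices_def D[symmetric] image_image by (intro image_cong) (simp_all add: orb)
  have "vertices m \<subseteq> Pow (darts m)" "faces m \<subseteq> Pow (darts m)" "edges m \<subseteq> Pow (darts m)"
    unfolding vertices_def faces_def edges_def
    using permutes_orbit_subset[OF perm] P(7) P(11) by (intro image_subsetI PowI; blast)+
  then have "card (vertices m') = card (vertices m)" "card (faces m') = card (faces m)"
    "card (edges m') = card (edges m)"
    unfolding vertices faces edges by (meson card_image inj inj_on_subset)+
  then show ?thesis
    using m opp nxt opp2 conn D[symmetric] map_isoD(1)[OF f, symmetric]
    unfolding planar_map_def by auto
qed

section \<open>Gluing\<close>

text \<open>The function local to \<open>glue_opp\<close>, given a name. It extends the inclusion of
  a filling into the glued map to the exterior darts of the filling, which have disappeared: such a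
  dart goes to the dart of \<open>m\<close> with which its oriented edge is identified. The
  extension respects \<open>opp\<close> everywhere, and \<open>nxt\<close> off the exterior
  face.\<close>

definition into_filling :: "'d hmap \<Rightarrow> ('d \<Rightarrow> 'e hmap) \<Rightarrow> 'd \<Rightarrow> 'e \<Rightarrow> 'd + 'd \<times> 'e" where
  "into_filling m u h y = (if y \<in> ext_face (u h)
     then Inl (opp m (hole_dart m h (bdry_pos (u h) y))) else Inr (h, y))"

lemma glue_simps [simp]:
  "darts (glue m u) = glue_darts m u"
  "root (glue m u) = Inl (root m)"
  "marks (glue m u) = Inr ` (SIGMA h:marks m. marks (u h))"
  by (simp_all add: glue_def)

lemma glue_darts_simps [simp]:
  "Inl x \<in> glue_darts m u \<longleftrightarrow> x \<in> darts m - hole_darts m"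
  "Inr (h, y) \<in> glue_darts m u \<longleftrightarrow> h \<in> marks m \<and> y \<in> darts (u h) - ext_face (u h)"
  by (auto simp: glue_darts_def)

locale gluing =
  fixes m :: "'d hmap" and u :: "'d \<Rightarrow> 'e hmap"
  assumes planar: "planar_map m"
    and marks: "marks m \<subseteq> darts m"
    and marks_ext: "\<And>h. h \<in> marks m \<Longrightarrow> face m h \<noteq> ext_face m"
    and inj_face: "inj_on (face m) (marks m)"
    and opp_hole: "\<And>x. x \<in> hole_darts m \<Longrightarrow> opp m x \<notin> hole_darts m"
    and planar_filling: "\<And>h. h \<in> marks m \<Longrightarrow> planar_map (u h)"
    and per: "\<And>h. h \<in> marks m \<Longrightarrow> perimeter (u h) = card (face m h)"
begin

abbreviation "D \<equiv> darts m - hole_darts m"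

abbreviation "into \<equiv> into_filling m u"

lemmas P = planar_map_permutation[OF planar]

lemmas PU = planar_map_permutation[OF planar_filling]

lemma face_subset_hole_darts: "h \<in> marks m \<Longrightarrow> face m h \<subseteq> hole_darts m"
  by (auto simp: hole_darts_def)

lemma self_in_orbit_inv: "h \<in> orbit (inv (nxt m)) h"
  by (simp add: P(5) permutation_inverse permutation_self_in_orbit)

lemma hole_dart_in_face: "hole_dart m h i \<in> face m h"
  unfolding hole_dart_def face_def orbit_inv_eq[OF P(5), symmetric]
  by (rule funpow_in_orbit[OF self_in_orbit_inv])

lemma hole_dart_in_hole_darts: "h \<in> marks m \<Longrightarrow> hole_dart m h i \<in> hole_darts m"
  using hole_dart_in_face face_subset_hole_darts by blast

lemma opp_in_D: "x \<in> hole_darts m \<Longrightarrow> opp m x \<in> D"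
  using opp_hole hole_darts_subset[OF planar marks] P(7) by blast

lemma opp_hole_dart_in_D: "h \<in> marks m \<Longrightarrow> opp m (hole_dart m h i) \<in> D"
  by (rule opp_in_D) (rule hole_dart_in_hole_darts)

lemma opp_opp_hole: "x \<in> hole_darts m \<Longrightarrow> opp m (opp m x) = x"
  using hole_darts_subset[OF planar marks] P(9) by blast

lemma nxt_in_D: "x \<in> D \<Longrightarrow> nxt m x \<in> D"
  using nxt_in_hole_darts_iff[OF planar] P(8) by auto

lemma hole_dart_mod: "hole_dart m h (i mod card (face m h)) = hole_dart m h i"
  unfolding hole_dart_def face_def orbit_inv_eq[OF P(5), symmetric]
  by (rule funpow_mod_card_orbit[OF self_in_orbit_inv])

lemma hole_pos_hole_dart: "hole_pos m h (hole_dart m h i) = i mod card (face m h)"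
  unfolding hole_dart_def hole_pos_def face_def orbit_inv_eq[OF P(5), symmetric]
  by (rule funpow_dist_funpow[OF self_in_orbit_inv])

lemma hole_dart_hole_pos: "x \<in> face m h \<Longrightarrow> hole_dart m h (hole_pos m h x) = x"
  unfolding hole_dart_def hole_pos_def face_def orbit_inv_eq[OF P(5), symmetric]
  by (rule funpow_dist_prop)

lemma mark_of_eq:
  assumes "h \<in> marks m" "x \<in> face m h"
  shows "mark_of m x = h"
  unfolding mark_of_def
proof (rule the_equality)
  fix h' assume "h' \<in> marks m \<and> x \<in> face m h'"
  then show "h' = h"
    using assms inj_face face_eqI[OF planar] by (metis inj_onD)
qed (use assms in simp)

lemma ext_face_subset_D: "ext_face m \<subseteq> D"
proof -
  have "x \<notin> hole_darts m" if "x \<in> ext_face m" for x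
    using that marks_ext face_eqI[OF planar] unfolding hole_darts_def ext_face_def by blast
  then show ?thesis using ext_face_subset[OF planar] by auto
qed

lemma root_in_D: "root m \<in> D"
  using ext_face_subset_D P(10)[of "root m"] by (auto simp: ext_face_def)

lemma face_subset_D:
  assumes "x \<in> D"
  shows "face m x \<subseteq> D"
proof -
  have "y \<in> D" if "y \<in> orbit (nxt m) x" for y
    using that by induction (use nxt_in_D assms in blast)+
  then show ?thesis by (auto simp: face_def)
qed

lemma card_hole: "h \<in> marks m \<Longrightarrow> card (face m h) = card (orbit (nxt (u h)) (root (u h)))"
  using per by (simp add: perimeter_def ext_face_def face_def)

lemma bdry_dart_mod: "h \<in> marks m \<Longrightarrow> bdry_dart (u h) (i mod card (face m h)) = bdry_dart (u h) i"
  unfolding bdry_dart_def card_hole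
  by (rule funpow_mod_card_orbit[OF permutation_self_in_orbit[OF PU(5)]])

lemma bdry_pos_bdry_dart: "h \<in> marks m \<Longrightarrow> bdry_pos (u h) (bdry_dart (u h) i) = i mod card (face m h)"
  unfolding bdry_dart_def bdry_pos_def card_hole
  by (rule funpow_dist_funpow[OF permutation_self_in_orbit[OF PU(5)]])

lemma bdry_dart_bdry_pos: "y \<in> ext_face (u h) \<Longrightarrow> bdry_dart (u h) (bdry_pos (u h) y) = y"
  unfolding bdry_dart_def bdry_pos_def ext_face_def face_def by (rule funpow_dist_prop)

lemma bdry_dart_in_ext_face: "h \<in> marks m \<Longrightarrow> bdry_dart (u h) i \<in> ext_face (u h)"
  unfolding bdry_dart_def ext_face_def face_def
  by (rule funpow_in_orbit[OF permutation_self_in_orbit[OF PU(5)]])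

lemma ext_face_filling_subset: "h \<in> marks m \<Longrightarrow> ext_face (u h) \<subseteq> darts (u h)"
  by (rule ext_face_subset[OF planar_filling])

lemma into_ext: "y \<in> ext_face (u h) \<Longrightarrow> into h y = Inl (opp m (hole_dart m h (bdry_pos (u h) y)))"
  and into_inner: "y \<notin> ext_face (u h) \<Longrightarrow> into h y = Inr (h, y)"
  by (simp_all add: into_filling_def)

lemma into_bdry_dart:
  "h \<in> marks m \<Longrightarrow> into h (bdry_dart (u h) i) = Inl (opp m (hole_dart m h i))"
  by (simp add: into_ext bdry_dart_in_ext_face bdry_pos_bdry_dart hole_dart_mod)

lemma into_in_darts:
  "h \<in> marks m \<Longrightarrow> y \<in> darts (u h) \<Longrightarrow> into h y \<in> glue_darts m u"
  using opp_hole_dart_in_D by (auto simp: into_filling_def)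

lemma glue_opp_Inl:
  "x \<in> D \<Longrightarrow> opp m x \<in> D \<Longrightarrow> opp (glue m u) (Inl x) = Inl (opp m x)"
  by (simp add: glue_def glue_opp_def)

text \<open>For exterior \<open>y\<close> the image is the dart \<open>opp m x\<close> facing a hole
  dart \<open>x\<close>, and \<open>glue_opp\<close> recovers from \<open>x\<close> the hole and the
  position, hence \<open>y\<close>. Since \<open>into\<close> also absorbs the case that
  \<open>opp (u h) y\<close> is exterior, edges of the filling with both sides exterior are
  covered.\<close>

lemma glue_opp_into:
  assumes h: "h \<in> marks m" and y: "y \<in> darts (u h)"
  shows "opp (glue m u) (into h y) = into h (opp (u h) y)"
proof (cases "y \<in> ext_face (u h)")
  case True
  define x where "x = hole_dart m h (bdry_pos (u h) y)"
  have x: "x \<in> face m h" "x \<in> hole_darts m" "opp m x \<in> D" "opp m (opp m x) = x"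
    unfolding x_def using h
    by (auto simp: hole_dart_in_face hole_dart_in_hole_darts opp_hole_dart_in_D opp_opp_hole
        simp del: Diff_iff)
  have "bdry_dart (u h) (hole_pos m h x) = y"
    unfolding x_def using h True by (simp add: hole_pos_hole_dart bdry_dart_mod bdry_dart_bdry_pos)
  moreover have "mark_of m x = h" by (rule mark_of_eq[OF h x(1)])
  moreover have "into h y = Inl (opp m x)" by (simp add: into_ext[OF True] x_def)
  ultimately show ?thesis
    using x by (simp add: glue_def glue_opp_def into_filling_def Let_def)
next
  case False
  then have "into h y = Inr (h, y)" by (rule into_inner)
  then show ?thesis using h y False
    by (simp add: glue_def glue_opp_def into_filling_def Let_def)
qed

text \<open>An exterior dart can be read back from its image: crossing the edge gives a dart of the
  hole, which determines the mark and, up to the degree, the position.\<close>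

lemma into_inj:
  assumes "h \<in> marks m" "h' \<in> marks m" "y \<in> darts (u h)" "y' \<in> darts (u h')" "into h y = into h' y'"
  shows "h = h' \<and> y = y'"
proof (cases "y \<in> ext_face (u h)")
  case True
  then have y': "y' \<in> ext_face (u h')" using assms(5) by (auto simp: into_filling_def split: if_splits)
  let ?x = "hole_dart m h (bdry_pos (u h) y)" and ?x' = "hole_dart m h' (bdry_pos (u h') y')"
  have "opp m ?x = opp m ?x'" using assms(5) by (simp add: into_ext True y')
  then have x: "?x = ?x'" using hole_dart_in_hole_darts opp_opp_hole assms(1,2) by metis
  then have "mark_of m ?x = h" "mark_of m ?x = h'"
    using mark_of_eq[OF assms(1) hole_dart_in_face] mark_of_eq[OF assms(2) hole_dart_in_face] by metis+
  then have [simp]: "h' = h" by simp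
  have "bdry_pos (u h) y mod card (face m h) = bdry_pos (u h) y' mod card (face m h)"
    using x hole_pos_hole_dart[of h "bdry_pos (u h) y"] hole_pos_hole_dart[of h "bdry_pos (u h) y'"] by simp
  then have "bdry_dart (u h) (bdry_pos (u h) y) = bdry_dart (u h) (bdry_pos (u h) y')"
    using bdry_dart_mod[OF assms(1)] by metis
  then show ?thesis using True y' by (simp add: bdry_dart_bdry_pos)
next
  case False
  then show ?thesis using assms(5) by (auto simp: into_filling_def split: if_splits)
qed

text \<open>Supplies the dichotomy for edges of a glued map: either both darts of the edge lie in
  \<open>D\<close>, or the edge comes from a filling and is handled through
  \<open>into\<close>.\<close>

lemma Inl_eq_into:
  assumes "x \<in> D" "opp m x \<in> hole_darts m"
  obtains h y where "h \<in> marks m" "y \<in> ext_face (u h)" "Inl x = into h y" "opp m x \<in> face m h"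
    "y = bdry_dart (u h) (hole_pos m h (opp m x))"
proof -
  obtain h where h: "h \<in> marks m" "opp m x \<in> face m h" using assms(2) by (auto simp: hole_darts_def)
  let ?y = "bdry_dart (u h) (hole_pos m h (opp m x))"
  have "into h ?y = Inl x"
    using assms(1) by (simp add: into_bdry_dart[OF h(1)] hole_dart_hole_pos[OF h(2)] P(9))
  then show ?thesis using that h bdry_dart_in_ext_face by metis
qed

lemma glue_nxt_Inl: "x \<in> D \<Longrightarrow> nxt (glue m u) (Inl x) = Inl (nxt m x)"
  by (simp add: glue_def glue_nxt_def)

lemma glue_nxt_Inr:
  "h \<in> marks m \<Longrightarrow> y \<in> darts (u h) - ext_face (u h) \<Longrightarrow> nxt (glue m u) (Inr (h, y)) = Inr (h, nxt (u h) y)"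
  by (simp add: glue_def glue_nxt_def)

text \<open>Gluing alters \<open>opp\<close> only; \<open>nxt\<close> never leaves its summand, so
  the faces of a glued map are faces of its pieces.\<close>

lemma glue_face_Inl:
  assumes "x \<in> D"
  shows "face (glue m u) (Inl x) = Inl ` face m x"
  unfolding face_def
proof (rule orbit_inverse[symmetric])
  show "x \<in> orbit (nxt m) x" by (rule permutation_self_in_orbit[OF P(5)])
  show "nxt (glue m u) (Inl y) = Inl (nxt m y)" if "y \<in> orbit (nxt m) x" for y
    using that face_subset_D[OF assms] by (intro glue_nxt_Inl) (auto simp: face_def)
qed

lemma face_filling_inner:
  assumes "h \<in> marks m" "y \<in> darts (u h) - ext_face (u h)"
  shows "face (u h) y \<subseteq> darts (u h) - ext_face (u h)"
proof -
  have "z \<in> darts (u h) - ext_face (u h)" if "z \<in> orbit (nxt (u h)) y" for z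
    using that
    by induction (use assms PU(8) nxt_in_ext_face_iff[OF planar_filling] in auto)
  then show ?thesis by (auto simp: face_def)
qed

lemma glue_face_Inr:
  assumes "h \<in> marks m" "y \<in> darts (u h) - ext_face (u h)"
  shows "face (glue m u) (Inr (h, y)) = (\<lambda>y. Inr (h, y)) ` face (u h) y"
  unfolding face_def
proof (rule orbit_inverse[symmetric])
  show "y \<in> orbit (nxt (u h)) y" by (rule permutation_self_in_orbit[OF PU(5)[OF assms(1)]])
  show "nxt (glue m u) (Inr (h, z)) = Inr (h, nxt (u h) z)" if "z \<in> orbit (nxt (u h)) y" for z
    using that face_filling_inner[OF assms] by (intro glue_nxt_Inr assms) (auto simp: face_def)
qed

lemma ext_face_glue: "ext_face (glue m u) = Inl ` ext_face m"
  unfolding ext_face_def by (simp add: glue_face_Inl[OF root_in_D])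

lemma perimeter_glue: "perimeter (glue m u) = perimeter m"
  unfolding perimeter_def ext_face_glue by (rule card_image) simp

lemma bdry_pos_glue:
  assumes "x \<in> ext_face m"
  shows "bdry_pos (glue m u) (Inl x) = bdry_pos m x"
  unfolding bdry_pos_def glue_simps
  by (rule funpow_dist_image)
    (use assms permutation_self_in_orbit[OF P(5)] ext_face_subset_D in
      \<open>auto simp: ext_face_def face_def glue_nxt_Inl subset_iff\<close>)

lemma hole_darts_glue:
  assumes "\<And>h. h \<in> marks m \<Longrightarrow> marks (u h) \<subseteq> darts (u h) - ext_face (u h)"
  shows "hole_darts (glue m u) = Inr ` (SIGMA h:marks m. hole_darts (u h))"
proof -
  have "face (glue m u) (Inr (h, k)) = (\<lambda>y. Inr (h, y)) ` face (u h) k"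
    if "h \<in> marks m" "k \<in> marks (u h)" for h k
    using that assms by (intro glue_face_Inr) auto
  then show ?thesis
    unfolding hole_darts_def by (auto simp: image_iff Bex_def)+
qed

lemma inner_faces_glue:
  assumes "\<And>h. h \<in> marks m \<Longrightarrow> marks (u h) \<subseteq> darts (u h) - ext_face (u h)"
  shows "inner_faces (glue m u) =
    (`) Inl ` inner_faces m \<union> (\<Union>h\<in>marks m. (`) (\<lambda>y. Inr (h, y)) ` inner_faces (u h))"
proof -
  have hd: "hole_darts (glue m u) = Inr ` (SIGMA h:marks m. hole_darts (u h))"
    by (rule hole_darts_glue) (rule assms)
  have "darts (glue m u) - ext_face (glue m u) - hole_darts (glue m u) =
    Inl ` (darts m - ext_face m - hole_darts m) \<union>
    Inr ` (SIGMA h:marks m. darts (u h) - ext_face (u h) - hole_darts (u h))"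
    unfolding ext_face_glue hd glue_simps(1) glue_darts_def by auto
  also have "face (glue m u) ` \<dots> = (`) Inl ` inner_faces m \<union>
      (\<lambda>(h, y). (\<lambda>y. Inr (h, y)) ` face (u h) y) ` (SIGMA h:marks m. darts (u h) - ext_face (u h) - hole_darts (u h))"
    unfolding image_Un image_image inner_faces_def
    by (intro arg_cong2[where f="(\<union>)"] image_cong) (auto simp: glue_face_Inl glue_face_Inr)
  also have "(\<lambda>(h, y). (\<lambda>y. Inr (h, y)) ` face (u h) y) ` (SIGMA h:marks m. darts (u h) - ext_face (u h) - hole_darts (u h))
    = (\<Union>h\<in>marks m. (`) (\<lambda>y. Inr (h, y)) ` inner_faces (u h))"
    by (auto simp: inner_faces_def image_iff Bex_def)+
  finally show ?thesis by (simp add: inner_faces_def)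
qed

end

section \<open>Uniqueness of fillings\<close>

lemma QH0D:
  assumes "m \<in> QH0"
  shows "planar_map m" "marks m \<subseteq> darts m" "\<And>h. h \<in> marks m \<Longrightarrow> face m h \<noteq> ext_face m"
    "inj_on (face m) (marks m)" "\<And>f. f \<in> inner_faces m \<Longrightarrow> card f = 4" "chosen m"
    "\<And>x. x \<in> hole_darts m \<Longrightarrow> opp m x \<in> darts m - hole_darts m"
    "\<And>u :: nat \<Rightarrow> nat hmap. (\<And>h. h \<in> marks m \<Longrightarrow> planar_map (u h)) \<Longrightarrow>
      (\<And>h. h \<in> marks m \<Longrightarrow> perimeter (u h) = card (face m h)) \<Longrightarrow> planar_map (glue m u)"
  using assms unfolding QH0_def quad_with_holes_def good_holes_def Let_def by blast+

lemma QH0_marks_not_ext: "m \<in> QH0 \<Longrightarrow> marks m \<subseteq> darts m - ext_face m"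
  using face_eqI[of m _ "root m"] QH0D(1-3)[of m] by (fastforce simp: ext_face_def)

text \<open>Only edges with no hole on either side are crossed, as the second condition of
  \<open>good_holes\<close> permits. The induction reaches all surviving darts without looking into
  a filling.\<close>

lemma QH0_induct [consumes 2, case_names root opp nxt]:
  assumes m: "m \<in> QH0" "x \<in> darts m - hole_darts m"
    and "P (root m)"
    and "\<And>x. x \<in> darts m - hole_darts m \<Longrightarrow> opp m x \<in> darts m - hole_darts m \<Longrightarrow> P x \<Longrightarrow> P (opp m x)"
    and "\<And>x. x \<in> darts m - hole_darts m \<Longrightarrow> P x \<Longrightarrow> P (nxt m x)"
  shows "P x"
proof -
  let ?D = "darts m - hole_darts m"
  have "(root m, x) \<in> ({(z, opp m z) | z. z \<in> ?D \<and> opp m z \<in> ?D} \<union> (\<lambda>z. (z, nxt m z)) ` ?D)\<^sup>*"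
    using m unfolding QH0_def quad_with_holes_def good_holes_def Let_def by blast
  then show ?thesis
    by induction (use assms(3-5) in blast)+
qed

lemma QB_iff: "m \<in> QB \<longleftrightarrow> m \<in> QH0 \<and> marks m = {}"
  by (simp add: QB_def)

lemma filled_by_gluing:
  assumes "m \<in> QH0" "filled_by m u f p"
  shows "gluing m u"
  using assms QH0D(1-4,7)[OF assms(1)] by unfold_locales (auto simp: filled_by_def dest: QH0D(1))

lemma filled_byD:
  assumes "filled_by m u f p"
  shows "\<And>h. h \<in> marks m \<Longrightarrow> u h \<in> QH0" "\<And>h. h \<in> marks m \<Longrightarrow> perimeter (u h) = card (face m h)"
    "map_iso f (glue m u) p"
  using assms by (auto simp: filled_by_def)

lemma filled_by_planar_glue:
  assumes "m \<in> QH0" "filled_by m u f p"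
  shows "planar_map (glue m u)"
  using QH0D(8)[OF assms(1)] filled_byD[OF assms(2)] QH0D(1) by blast

lemma filled_by_marks_glue:
  assumes "filled_by m u f p"
  shows "marks (glue m u) \<subseteq> darts (glue m u)"
  using filled_byD(1)[OF assms] QH0_marks_not_ext by fastforce

text \<open>Both isomorphisms send the root to the root of \<open>p\<close>, and a walk that avoids
  the holes involves only \<open>opp\<close> and \<open>nxt\<close> of \<open>m\<close>.\<close>

lemma filled_by_agree_Inl:
  assumes m: "m \<in> QH0" and F: "filled_by m u f p" "filled_by m u' f' p"
    and x: "x \<in> darts m - hole_darts m"
  shows "f (Inl x) = f' (Inl x)"
  using m x
proof (induction rule: QH0_induct)
  case root
  then show ?case using map_isoD(1)[OF filled_byD(3)[OF F(1)]] map_isoD(1)[OF filled_byD(3)[OF F(2)]]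
    by simp
next
  case (opp x)
  then show ?case
    using map_isoD(2)[OF filled_byD(3)[OF F(1)], of "Inl x"] map_isoD(2)[OF filled_byD(3)[OF F(2)], of "Inl x"]
      gluing.glue_opp_Inl[OF filled_by_gluing[OF m F(1)]] gluing.glue_opp_Inl[OF filled_by_gluing[OF m F(2)]]
    by simp
next
  case (nxt x)
  then show ?case
    using map_isoD(3)[OF filled_byD(3)[OF F(1)], of "Inl x"] map_isoD(3)[OF filled_byD(3)[OF F(2)], of "Inl x"]
      gluing.glue_nxt_Inl[OF filled_by_gluing[OF m F(1)]] gluing.glue_nxt_Inl[OF filled_by_gluing[OF m F(2)]]
    by simp
qed

lemma filled_by_agree_bdry:
  assumes m: "m \<in> QH0" and F: "filled_by m u f p" "filled_by m u' f' p" and h: "h \<in> marks m"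
  shows "f (into_filling m u h (bdry_dart (u h) i)) = f' (into_filling m u' h (bdry_dart (u' h) i))"
  by (simp only: gluing.into_bdry_dart[OF filled_by_gluing[OF m F(1)] h]
      gluing.into_bdry_dart[OF filled_by_gluing[OF m F(2)] h])
    (intro filled_by_agree_Inl[OF m F] gluing.opp_hole_dart_in_D[OF filled_by_gluing[OF m F(1)] h])

lemma filled_by_opp_into:
  assumes m: "m \<in> QH0" and F: "filled_by m u f p" and h: "h \<in> marks m" "y \<in> darts (u h)"
  shows "f (into_filling m u h (opp (u h) y)) = opp p (f (into_filling m u h y))"
proof -
  interpret gluing m u by (rule filled_by_gluing[OF m F])
  show ?thesis using map_isoD(2)[OF filled_byD(3)[OF F], of "into h y"] h
    by (simp add: glue_opp_into into_in_darts)
qed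

text \<open>The walk now runs inside the filling \<open>u h\<close>, from its root, where the
  isomorphisms agree because boundary darts are identified with darts of \<open>m\<close>. Following
  \<open>nxt\<close> needs one rule along the boundary and another off it, so the partner of
  \<open>y\<close> has to be exterior exactly when \<open>y\<close> is.\<close>

lemma filled_by_agree_into:
  assumes m: "m \<in> QH0" and F: "filled_by m u f p" "filled_by m u' f' p"
    and h: "h \<in> marks m" and y: "y \<in> darts (u h)"
  shows "\<exists>y'\<in>darts (u' h). f (into_filling m u h y) = f' (into_filling m u' h y') \<and>
    (y \<in> ext_face (u h) \<longleftrightarrow> y' \<in> ext_face (u' h))"
proof -
  interpret G: gluing m u by (rule filled_by_gluing[OF m F(1)])
  interpret G': gluing m u' by (rule filled_by_gluing[OF m F(2)])
  note I = filled_byD(3)[OF F(1)] and I' = filled_byD(3)[OF F(2)]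
  \<comment> \<open>Exterior darts are those that \<open>into_filling\<close> sends to darts of
    \<open>m\<close>, on which the two isomorphisms agree; by injectivity such a dart cannot share
    its image with an interior dart of a filling.\<close>
  have ext: "y \<in> ext_face (u h) \<longleftrightarrow> y' \<in> ext_face (u' h)"
    if "y \<in> darts (u h)" "y' \<in> darts (u' h)" "f (into_filling m u h y) = f' (into_filling m u' h y')" for y y'
  proof -
    have 1: "into_filling m u h y \<in> glue_darts m u" "into_filling m u' h y' \<in> glue_darts m u'"
      using that h G.into_in_darts G'.into_in_darts by blast+
    show ?thesis
    proof (cases "into_filling m u h y")
      case (Inl x)
      then have "f' (Inl x) = f' (into_filling m u' h y')"
        using that(3) 1 filled_by_agree_Inl[OF m F, of x] by simp
      then have "Inl x = into_filling m u' h y'"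
        using 1 Inl inj_onD[OF map_iso_inj_on[OF I'], of "Inl x"] by simp
      then show ?thesis using Inl by (auto simp: into_filling_def split: if_splits)
    next
      case (Inr z)
      have "into_filling m u' h y' \<noteq> Inl x" for x
      proof
        assume *: "into_filling m u' h y' = Inl x"
        then have "f (Inl x) = f (into_filling m u h y)"
          using that(3) 1 filled_by_agree_Inl[OF m F, of x] by simp
        then have "Inl x = into_filling m u h y"
          using 1 * inj_onD[OF map_iso_inj_on[OF I], of "Inl x"] by simp
        then show False using Inr by simp
      qed
      then have "y' \<notin> ext_face (u' h)" by (metis into_filling_def)
      then show ?thesis using Inr by (auto simp: into_filling_def split: if_splits)
    qed
  qed
  have "\<exists>y'\<in>darts (u' h). f (into_filling m u h y) = f' (into_filling m u' h y')"
    using G.planar_filling[OF h] y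
  proof (induction rule: planar_map_induct)
    case root
    then show ?case using filled_by_agree_bdry[OF m F h, of 0] G'.PU(2)[OF h]
      by (auto simp: bdry_dart_def)
  next
    case (opp y)
    then show ?case
      using filled_by_opp_into[OF m F(1) h] filled_by_opp_into[OF m F(2) h] G'.PU(7)[OF h] by metis
  next
    case (nxt y)
    then obtain y' where y': "y' \<in> darts (u' h)" "f (into_filling m u h y) = f' (into_filling m u' h y')"
      by blast
    show ?case
    proof (cases "y \<in> ext_face (u h)")
      case True
      \<comment> \<open>The step of \<open>nxt\<close> along the exterior face has no counterpart in
        the glued map; the next boundary dart is identified by its index instead.\<close>
      then have "nxt (u h) y = bdry_dart (u h) (Suc (bdry_pos (u h) y))"
        using G.bdry_dart_bdry_pos[OF True] by (simp add: bdry_dart_def)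
      then show ?thesis
        using filled_by_agree_bdry[OF m F h] G'.bdry_dart_in_ext_face[OF h] G'.ext_face_filling_subset[OF h]
        by fastforce
    next
      case False
      then have "y' \<notin> ext_face (u' h)" using ext[OF nxt(1) y'] by simp
      then have "f (Inr (h, nxt (u h) y)) = f' (Inr (h, nxt (u' h) y'))"
        using map_isoD(3)[OF I, of "Inr (h, y)"] map_isoD(3)[OF I', of "Inr (h, y')"] h nxt(1) y' False
        by (simp add: G.glue_nxt_Inr G'.glue_nxt_Inr into_filling_def)
      then show ?thesis
        using nxt_in_ext_face_iff[OF G.planar_filling[OF h], of y] False \<open>y' \<notin> _\<close> y'(1) G'.PU(8)[OF h]
          nxt_in_ext_face_iff[OF G'.planar_filling[OF h], of y']
        by (intro bexI[of _ "nxt (u' h) y'"]) (auto simp: into_filling_def)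
    qed
  qed
  then show ?thesis using ext y by blast
qed

text \<open>The partner of a dart is unique by injectivity, so it defines a map \<open>g\<close>.
  Each property of \<open>g\<close> is obtained by checking that the proposed value is a partner as
  well.\<close>

lemma filled_by_content_iso:
  assumes m: "m \<in> QH0" and F: "filled_by m u f p" "filled_by m u' f' p" and h: "h \<in> marks m"
  obtains g where "map_iso g (u h) (u' h)"
    "\<And>y. y \<in> darts (u h) \<Longrightarrow> f (into_filling m u h y) = f' (into_filling m u' h (g y))"
proof -
  interpret G: gluing m u by (rule filled_by_gluing[OF m F(1)])
  interpret G': gluing m u' by (rule filled_by_gluing[OF m F(2)])
  note I = filled_byD(3)[OF F(1)] and I' = filled_byD(3)[OF F(2)]
  obtain g where g: "\<And>y. y \<in> darts (u h) \<Longrightarrow> g y \<in> darts (u' h)"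
    "\<And>y. y \<in> darts (u h) \<Longrightarrow> f (G.into h y) = f' (G'.into h (g y))"
    "\<And>y. y \<in> darts (u h) \<Longrightarrow> y \<in> ext_face (u h) \<longleftrightarrow> g y \<in> ext_face (u' h)"
    using filled_by_agree_into[OF m F h] by metis
  have uniq: "y = g x" if "x \<in> darts (u h)" "y \<in> darts (u' h)" "f (G.into h x) = f' (G'.into h y)" for x y
  proof -
    have "G'.into h y = G'.into h (g x)"
      by (rule inj_onD[OF map_iso_inj_on[OF I']]) (use that g(1,2) h G'.into_in_darts in auto)
    then show ?thesis using G'.into_inj[OF h h] that g(1) by blast
  qed
  have "inj_on g (darts (u h))"
  proof (rule inj_onI)
    fix x y assume xy: "x \<in> darts (u h)" "y \<in> darts (u h)" "g x = g y"
    then have "G.into h x = G.into h y"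
      using g(2) h G.into_in_darts by (intro inj_onD[OF map_iso_inj_on[OF I]]) auto
    then show "x = y" using G.into_inj[OF h h] xy by blast
  qed
  moreover have "g ` darts (u h) = darts (u' h)"
  proof (intro equalityI subsetI)
    fix y assume y: "y \<in> darts (u' h)"
    then obtain x where "x \<in> darts (u h)" "f' (G'.into h y) = f (G.into h x)"
      using filled_by_agree_into[OF m F(2,1) h] by blast
    then show "y \<in> g ` darts (u h)" using uniq[of x y] y by auto
  qed (use g(1) in auto)
  ultimately have bij: "bij_betw g (darts (u h)) (darts (u' h))" by (simp add: bij_betw_def)
  have root: "g (root (u h)) = root (u' h)"
    by (rule uniq[symmetric])
      (use G.PU(2)[OF h] G'.PU(2)[OF h] filled_by_agree_bdry[OF m F h, of 0] in \<open>auto simp: bdry_dart_def\<close>)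
  have opp: "g (opp (u h) y) = opp (u' h) (g y)" if y: "y \<in> darts (u h)" for y
  proof (rule uniq[symmetric])
    show "f (G.into h (opp (u h) y)) = f' (G'.into h (opp (u' h) (g y)))"
      using filled_by_opp_into[OF m F(1) h y] filled_by_opp_into[OF m F(2) h g(1)[OF y]] g(2)[OF y] by simp
  qed (use y g(1) G.PU(7)[OF h] G'.PU(7)[OF h] in auto)
  have nxt: "g (nxt (u h) y) = nxt (u' h) (g y)" if y: "y \<in> darts (u h)" for y
  proof (cases "y \<in> ext_face (u h)")
    case True
    have "g y = bdry_dart (u' h) (bdry_pos (u h) y)"
      by (rule uniq[symmetric])
        (use y G.bdry_dart_bdry_pos[OF True] filled_by_agree_bdry[OF m F h, of "bdry_pos (u h) y"]
          G'.bdry_dart_in_ext_face[OF h] G'.ext_face_filling_subset[OF h] in auto)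
    then have "nxt (u' h) (g y) = bdry_dart (u' h) (Suc (bdry_pos (u h) y))"
      by (simp add: bdry_dart_def)
    moreover have "nxt (u h) y = bdry_dart (u h) (Suc (bdry_pos (u h) y))"
      using G.bdry_dart_bdry_pos[OF True] by (simp add: bdry_dart_def)
    ultimately show ?thesis
      by (metis uniq G.PU(8)[OF h] G'.PU(8)[OF h] g(1) y filled_by_agree_bdry[OF m F h])
  next
    case False
    show ?thesis
    proof (rule uniq[symmetric])
      show "f (G.into h (nxt (u h) y)) = f' (G'.into h (nxt (u' h) (g y)))"
        using map_isoD(3)[OF I, of "Inr (h, y)"] map_isoD(3)[OF I', of "Inr (h, g y)"] h y g(1,2)[OF y] g(3)[OF y] False
          nxt_in_ext_face_iff[OF G.planar_filling[OF h], of y]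
          nxt_in_ext_face_iff[OF G'.planar_filling[OF h], of "g y"]
        by (simp add: G.glue_nxt_Inr G'.glue_nxt_Inr into_filling_def)
    qed (use y g(1) G.PU(8)[OF h] G'.PU(8)[OF h] in auto)
  qed
  \<comment> \<open>A mark of \<open>p\<close> could come from different holes of \<open>m\<close>
    in the two fillings; injectivity of the isomorphism forces the same hole.\<close>
  have sub: "k' \<in> g ` marks (u h)" if k: "k' \<in> marks (u' h)" for k'
  proof -
    have k': "k' \<in> darts (u' h) - ext_face (u' h)"
      using k QH0_marks_not_ext[OF filled_byD(1)[OF F(2) h]] by blast
    have "f' (Inr (h, k')) \<in> f ` marks (glue m u)"
      using map_isoD(5)[OF I] map_isoD(5)[OF I'] h k by force
    then obtain h1 k1 where k1: "h1 \<in> marks m" "k1 \<in> marks (u h1)" "f (Inr (h1, k1)) = f' (Inr (h, k'))"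
      by auto
    have k2: "k1 \<in> darts (u h1) - ext_face (u h1)"
      using k1 QH0_marks_not_ext[OF filled_byD(1)[OF F(1) k1(1)]] by blast
    obtain x where x: "x \<in> darts (u h)" "f (G.into h x) = f' (G'.into h k')"
      using filled_by_agree_into[OF m F(2,1) h, of k'] k' by auto
    have "G'.into h k' = Inr (h, k')" "G.into h1 k1 = Inr (h1, k1)"
      using k' k2 by (auto simp: into_filling_def)
    then have "G.into h1 k1 = G.into h x"
      using x k1 h k2 G.into_in_darts by (intro inj_onD[OF map_iso_inj_on[OF I]]) auto
    then have "h1 = h" "k1 = x" using G.into_inj[OF k1(1) h] k2 x(1) by blast+
    then show ?thesis using uniq[of x k'] x k' k1 by auto
  qed
  have sup: "g k \<in> marks (u' h)" if k: "k \<in> marks (u h)" for k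
  proof -
    have k0: "k \<in> darts (u h) - ext_face (u h)"
      using k QH0_marks_not_ext[OF filled_byD(1)[OF F(1) h]] by blast
    have "f (Inr (h, k)) \<in> f' ` marks (glue m u')"
      using map_isoD(5)[OF I] map_isoD(5)[OF I'] h k by force
    then obtain h1 k1 where k1: "h1 \<in> marks m" "k1 \<in> marks (u' h1)" "f' (Inr (h1, k1)) = f (Inr (h, k))"
      by auto
    have k2: "k1 \<in> darts (u' h1) - ext_face (u' h1)"
      using k1 QH0_marks_not_ext[OF filled_byD(1)[OF F(2) k1(1)]] by blast
    have "G.into h k = Inr (h, k)" "G'.into h1 k1 = Inr (h1, k1)"
      using k0 k2 by (auto simp: into_filling_def)
    then have "G'.into h1 k1 = G'.into h (g k)"
      using k1 h k0 k2 G'.into_in_darts g(1,2)[of k] by (intro inj_onD[OF map_iso_inj_on[OF I']]) auto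
    then show ?thesis using G'.into_inj[OF k1(1) h, of k1 "g k"] k0 k2 k1 g(1) by auto
  qed
  have "g ` marks (u h) = marks (u' h)" using sub sup by blast
  then have "map_iso g (u h) (u' h)"
    using bij root opp nxt by (simp add: map_iso_def)
  then show thesis using g(2) that by blast
qed

text \<open>Isomorphic maps have the same isomorphic copies, and \<open>SOME\<close> gives equal
  values on equal predicates.\<close>

lemma chosen_unique:
  assumes "chosen c" "chosen c'" "planar_map c" "marks c \<subseteq> darts c" "map_iso g c c'"
  shows "c = c'"
proof -
  have "(\<exists>f. map_iso f c n \<and> planar_map n) \<longleftrightarrow> (\<exists>f. map_iso f c' n \<and> planar_map n)" for n
  proof
    assume "\<exists>f. map_iso f c n \<and> planar_map n"
    then show "\<exists>f. map_iso f c' n \<and> planar_map n"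
      using map_iso_trans[OF map_iso_sym[OF assms(5,3,4)]] by fast
  next
    assume "\<exists>f. map_iso f c' n \<and> planar_map n"
    then show "\<exists>f. map_iso f c n \<and> planar_map n"
      using map_iso_trans[OF assms(5)] by fast
  qed
  then have eq: "(\<lambda>n. \<exists>f. map_iso f c n \<and> planar_map n) = (\<lambda>n. \<exists>f. map_iso f c' n \<and> planar_map n)"
    by (rule ext)
  have "c = (SOME n. \<exists>f. map_iso f c n \<and> planar_map n)"
    by (rule assms(1)[unfolded chosen_def])
  also have "\<dots> = (SOME n. \<exists>f. map_iso f c' n \<and> planar_map n)"
    by (rule arg_cong[OF eq])
  also have "\<dots> = c'"
    by (rule assms(2)[unfolded chosen_def, symmetric])
  finally show ?thesis .
qed

text \<open>Rigidity of rooted connected maps: the root is fixed and everything else is reached from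
  it.\<close>

lemma map_iso_self:
  assumes "planar_map c" "map_iso g c c" "x \<in> darts c"
  shows "g x = x"
  using assms(1,3) by (induction rule: planar_map_induct) (simp_all add: map_isoD[OF assms(2)])

text \<open>The contents are isomorphic representatives, hence equal; the isomorphism between them
  is then an automorphism, hence the identity, so that even the placement of the darts in
  \<open>p\<close> is forced.\<close>

lemma filled_by_unique:
  assumes m: "m \<in> QH0" and F: "filled_by m u f p" "filled_by m u' f' p"
  shows "\<And>h. h \<in> marks m \<Longrightarrow> u h = u' h" "\<And>z. z \<in> glue_darts m u \<Longrightarrow> f z = f' z"
proof -
  interpret G: gluing m u by (rule filled_by_gluing[OF m F(1)])
  show eq: "u h = u' h" if h: "h \<in> marks m" for h
  proof -
    obtain g where "map_iso g (u h) (u' h)" by (rule filled_by_content_iso[OF m F h])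
    then show ?thesis
      using QH0D[OF filled_byD(1)[OF F(1) h]] QH0D[OF filled_byD(1)[OF F(2) h]] chosen_unique by blast
  qed
  show "f z = f' z" if z: "z \<in> glue_darts m u" for z
  proof (cases z)
    case (Inl x)
    then show ?thesis using filled_by_agree_Inl[OF m F] z by auto
  next
    case (Inr w)
    obtain h y where w: "w = (h, y)" by force
    then have h: "h \<in> marks m" and y: "y \<in> darts (u h)" "y \<notin> ext_face (u h)" using z Inr by auto
    obtain g where g: "map_iso g (u h) (u' h)"
      "\<And>y. y \<in> darts (u h) \<Longrightarrow> f (into_filling m u h y) = f' (into_filling m u' h (g y))"
      using filled_by_content_iso[OF m F h] by blast
    then have "g y = y" using map_iso_self[OF G.planar_filling[OF h] _ y(1)] eq[OF h] by simp
    then show ?thesis using g(2)[OF y(1)] y(2) eq[OF h] Inr w by (simp add: into_filling_def)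
  qed
qed

lemma filled_by_filling:
  "Some m \<sqsubseteq>\<^sub>H Some p \<Longrightarrow> filled_by m (fst (filling m p)) (snd (filling m p)) p"
  using someI_ex[of "\<lambda>z. filled_by m (fst z) (snd z) p"] by (auto simp: filling_def case_prod_unfold)

text \<open>Lets any filling at hand stand in for the arbitrary choice made by
  \<open>filling\<close>.\<close>

lemma filling_eq:
  assumes "m \<in> QH0" "filled_by m u f p"
  shows "\<And>h. h \<in> marks m \<Longrightarrow> fst (filling m p) h = u h"
    "\<And>z. z \<in> glue_darts m u \<Longrightarrow> snd (filling m p) z = f z"
proof -
  have F: "filled_by m (fst (filling m p)) (snd (filling m p)) p"
    by (rule filled_by_filling) (use assms(2) in auto)
  show "\<And>h. h \<in> marks m \<Longrightarrow> fst (filling m p) h = u h" "\<And>z. z \<in> glue_darts m u \<Longrightarrow> snd (filling m p) z = f z"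
    using filled_by_unique[OF assms F] by simp_all
qed

section \<open>Existence and transitivity of fillings\<close>

lemma glue_outside:
  "x \<notin> glue_darts m u \<Longrightarrow> opp (glue m u) x = x \<and> nxt (glue m u) x = x"
  by (simp add: glue_def)

text \<open>A glued map has darts in a sum type, whereas representatives have natural numbers as
  darts; the dart set being finite, it can be relabelled.\<close>

lemma planar_map_nat_copy:
  fixes p :: "'e hmap"
  assumes p: "planar_map p"
  obtains g and p' :: "nat hmap" where "map_iso g p p'" "planar_map p'"
proof -
  obtain g :: "'e \<Rightarrow> nat" where g: "inj_on g (darts p)"
    using finite_imp_inj_to_nat_seg[OF planar_map_permutation(1)[OF p]] by blast
  define c where "c k n = (if n \<in> g ` darts p then g (k (inv_into (darts p) g n)) else n)" for k n
  define p' where "p' = \<lparr>darts = g ` darts p, opp = c (opp p), nxt = c (nxt p), root = g (root p),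
    marks = g ` marks p\<rparr>"
  have "map_iso g p p'"
    using g by (simp add: map_iso_def p'_def bij_betw_def c_def)
  moreover have "planar_map p'"
    by (rule planar_map_iso[OF calculation p]) (simp add: p'_def c_def)
  ultimately show thesis by (rule that)
qed

lemma ex_chosen:
  fixes p :: "'e hmap"
  assumes p: "planar_map p" "marks p \<subseteq> darts p"
  obtains c f where "chosen c" "planar_map c" "map_iso f p c"
proof -
  obtain g and p' :: "nat hmap" where g: "map_iso g p p'" "planar_map p'"
    by (rule planar_map_nat_copy[OF p(1)])
  define c :: "nat hmap" where "c = (SOME n. \<exists>f. map_iso f p' n \<and> planar_map n)"
  have "\<exists>(n :: nat hmap) f. map_iso f p' n \<and> planar_map n"
    using g(2) map_iso_refl[of p'] by blast
  then have "\<exists>f. map_iso f p' c \<and> planar_map c"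
    unfolding c_def by (rule someI_ex)
  then obtain f where f: "map_iso f p' c" "planar_map c" by blast
  have p': "marks p' \<subseteq> darts p'"
    using p(2) map_isoD(5)[OF g(1)] map_iso_image_darts[OF g(1)] by blast
  have "(\<exists>h. map_iso h c n \<and> planar_map n) \<longleftrightarrow> (\<exists>h. map_iso h p' n \<and> planar_map n)" for n
  proof
    assume "\<exists>h. map_iso h c n \<and> planar_map n"
    then show "\<exists>h. map_iso h p' n \<and> planar_map n" using map_iso_trans[OF f(1)] by fast
  next
    assume "\<exists>h. map_iso h p' n \<and> planar_map n"
    then show "\<exists>h. map_iso h c n \<and> planar_map n"
      using map_iso_trans[OF map_iso_sym[OF f(1) g(2) p']] by fast
  qed
  then have eq: "(\<lambda>n. \<exists>h. map_iso h c n \<and> planar_map n) = (\<lambda>n. \<exists>h. map_iso h p' n \<and> planar_map n)"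
    by (rule ext)
  have "c = (SOME n. \<exists>h. map_iso h c n \<and> planar_map n)"
    unfolding eq by (fact c_def)
  then have "chosen c" unfolding chosen_def .
  then show thesis using f(2) map_iso_trans[OF g(1) f(1)] by (rule that)
qed

text \<open>The third condition of \<open>good_holes\<close> for a map without holes: nothing is
  glued in, and \<open>Inl\<close> is an isomorphism.\<close>

lemma planar_map_glue_no_holes:
  assumes c: "planar_map c" "marks c = {}"
  shows "planar_map (glue c u)"
proof -
  have h: "hole_darts c = {}" by (simp add: hole_darts_def c(2))
  interpret gluing c u using c h by unfold_locales auto
  have d: "glue_darts c u = Inl ` darts c" by (auto simp: glue_darts_def h c(2))
  have "map_iso Inl c (glue c u)"
    unfolding map_iso_def glue_simps d using P(7) glue_opp_Inl glue_nxt_Inl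
    by (auto simp: h c(2) bij_betw_def)
  then show ?thesis
    by (rule planar_map_iso[OF _ c(1)]) (simp add: glue_outside)
qed

lemma QB_I:
  assumes c: "planar_map c" "chosen c" "marks c = {}" and f: "\<And>f. f \<in> inner_faces c \<Longrightarrow> card f = 4"
  shows "c \<in> QB"
proof -
  have h: "hole_darts c = {}" by (simp add: hole_darts_def c(3))
  have R: "({(z, opp c z) | z. z \<in> darts c \<and> opp c z \<in> darts c} \<union> (\<lambda>z. (z, nxt c z)) ` darts c)
    = ((\<lambda>z. (z, opp c z)) ` darts c \<union> (\<lambda>z. (z, nxt c z)) ` darts c)"
    using planar_map_permutation(7)[OF c(1)] by auto
  have "good_holes c"
    unfolding good_holes_def Let_def h Diff_empty R
    using c(1) planar_map_glue_no_holes[OF c(1,3)] by (auto simp: planar_map_def)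
  then show ?thesis using c f by (auto simp: QB_def QH0_def quad_with_holes_def)
qed

text \<open>The contents have no holes, so neither has the result, and its representative is
  recognised as a member of \<open>QB\<close> through \<open>QB_I\<close> from planarity and the
  face degrees.\<close>

lemma filled_by_QB:
  assumes m: "m \<in> QH0" and w: "\<And>h. h \<in> marks m \<Longrightarrow> w h \<in> QB"
    "\<And>h. h \<in> marks m \<Longrightarrow> perimeter (w h) = card (face m h)"
  obtains c f where "c \<in> QB" "filled_by m w f c" "perimeter c = perimeter m"
proof -
  have w0: "w h \<in> QH0" "marks (w h) = {}" if "h \<in> marks m" for h
    using w(1)[OF that] by (auto simp: QB_iff)
  interpret gluing m w
    using QH0D(1-4,7)[OF m] w(2) QH0D(1)[OF w0(1)] by unfold_locales auto
  have pl: "planar_map (glue m w)" using QH0D(8)[OF m planar_filling per] by blast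
  have nm: "marks (glue m w) = {}" using w0(2) by auto
  obtain c f where c: "chosen c" "planar_map c" "map_iso f (glue m w) c"
    using ex_chosen[OF pl] nm by auto
  have inn: "card g = 4" if "g \<in> inner_faces (glue m w)" for g
  proof -
    have "g \<in> (`) Inl ` inner_faces m \<union> (\<Union>h\<in>marks m. (`) (\<lambda>y. Inr (h, y)) ` inner_faces (w h))"
      using that inner_faces_glue w0(2) by auto
    then show ?thesis
      using QH0D(5)[OF m] QH0D(5)[OF w0(1)] by (auto simp: card_image inj_on_def)
  qed
  have "card g = 4" if g: "g \<in> inner_faces c" for g
  proof -
    obtain g0 where g0: "g0 \<in> inner_faces (glue m w)" "g = f ` g0"
      using g map_iso_inner_faces[OF c(3) pl] nm by auto
    have "inj_on f g0"
      using inner_face_subset_darts[OF pl g0(1)] map_iso_inj_on[OF c(3)] inj_on_subset by blast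
    then show ?thesis using inn[OF g0(1)] g0(2) by (simp add: card_image)
  qed
  moreover have "marks c = {}" using map_isoD(5)[OF c(3)] nm by simp
  ultimately have "c \<in> QB" using c by (intro QB_I) auto
  moreover have "filled_by m w f c" using c(3) w(2) w0(1) by (simp add: filled_by_def)
  moreover have "perimeter c = perimeter m"
    using map_iso_perimeter[OF c(3) pl] by (simp add: perimeter_glue)
  ultimately show thesis by (rule that)
qed

lemma filled_by_perimeter:
  assumes "m \<in> QH0" "filled_by m u f p"
  shows "perimeter p = perimeter m"
  using map_iso_perimeter[OF filled_byD(3)[OF assms(2)] filled_by_planar_glue[OF assms]]
    gluing.perimeter_glue[OF filled_by_gluing[OF assms]] by simp

lemma filled_by_QB_content:
  assumes "filled_by m u f p" "p \<in> QB" "h \<in> marks m"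
  shows "u h \<in> QB"
  using filled_byD(1)[OF assms(1,3)] map_isoD(5)[OF filled_byD(3)[OF assms(1)]] assms(2,3)
  by (auto simp: QB_iff)

lemma filled_by_hole_darts:
  assumes m: "m \<in> QH0" and F: "filled_by m u f p" and z: "z \<in> glue_darts m u"
  shows "f z \<in> hole_darts p \<longleftrightarrow> z \<in> Inr ` (SIGMA h:marks m. hole_darts (u h))"
proof -
  interpret gluing m u by (rule filled_by_gluing[OF m F])
  have hd: "hole_darts (glue m u) = Inr ` (SIGMA h:marks m. hole_darts (u h))"
    by (rule hole_darts_glue) (rule QH0_marks_not_ext[OF filled_byD(1)[OF F]])
  have "hole_darts p = f ` hole_darts (glue m u)"
    by (rule map_iso_hole_darts[OF filled_byD(3)[OF F] filled_by_planar_glue[OF m F] filled_by_marks_glue[OF F]])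
  moreover have "hole_darts (glue m u) \<subseteq> glue_darts m u"
    using hole_darts_subset[OF filled_by_planar_glue[OF m F] filled_by_marks_glue[OF F]] by simp
  ultimately show ?thesis
    unfolding hd using inj_on_image_mem_iff[OF map_iso_inj_on[OF filled_byD(3)[OF F], simplified] z] by blast
qed

text \<open>Hole darts are numbered against \<open>nxt\<close>. The hole lies off the exterior face
  of \<open>u h\<close>, where \<open>f\<close> respects \<open>nxt\<close> and hence its inverse,
  so the two numberings correspond.\<close>

lemma filled_by_hole_dart:
  assumes m: "m \<in> QH0" and F: "filled_by m u f p" and h: "h \<in> marks m" and k: "k \<in> marks (u h)"
    and p: "planar_map p"
  shows "f (Inr (h, hole_dart (u h) k i)) = hole_dart p (f (Inr (h, k))) i"
    and "hole_dart (u h) k i \<in> darts (u h) - ext_face (u h)"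
proof -
  interpret gluing m u by (rule filled_by_gluing[OF m F])
  have k': "k \<in> darts (u h) - ext_face (u h)"
    using k QH0_marks_not_ext[OF filled_byD(1)[OF F h]] by blast
  have step: "f (Inr (h, inv (nxt (u h)) y)) = inv (nxt p) (f (Inr (h, y))) \<and>
      inv (nxt (u h)) y \<in> darts (u h) - ext_face (u h)" if y: "y \<in> darts (u h) - ext_face (u h)" for y
  proof -
    let ?x = "inv (nxt (u h)) y"
    have nx: "nxt (u h) ?x = y" using permutes_inverses(1)[OF PU(4)[OF h]] .
    then have x: "?x \<in> darts (u h) - ext_face (u h)"
      using y nxt_in_ext_face_iff[OF planar_filling[OF h], of ?x] permutes_in_image[OF PU(4)[OF h], of ?x] by auto
    then have "f (Inr (h, y)) = nxt p (f (Inr (h, ?x)))"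
      using map_isoD(3)[OF filled_byD(3)[OF F], of "Inr (h, ?x)"] h by (simp add: glue_nxt_Inr nx)
    then show ?thesis using x permutes_inverses(2)[OF planar_map_permutation(4)[OF p]] by simp
  qed
  have "f (Inr (h, hole_dart (u h) k i)) = hole_dart p (f (Inr (h, k))) i \<and>
    hole_dart (u h) k i \<in> darts (u h) - ext_face (u h)"
    by (induction i) (use k' step in \<open>auto simp: hole_dart_def\<close>)
  then show "f (Inr (h, hole_dart (u h) k i)) = hole_dart p (f (Inr (h, k))) i"
    "hole_dart (u h) k i \<in> darts (u h) - ext_face (u h)" by blast+
qed

text \<open>Hole \<open>h\<close> of \<open>r\<close> must receive \<open>u h\<close> after the
  holes of \<open>u h\<close> have received the pieces of \<open>x\<close> prescribed by
  \<open>m\<close>. As \<open>x\<close> has no holes, these pieces lie in \<open>QB\<close>, and the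
  nested gluing is available from \<open>filled_by_QB\<close>. The formula for \<open>f'\<close> on
  darts of \<open>r\<close> is what later relates the decorations.\<close>

lemma filled_by_trans:
  assumes r: "r \<in> QH0" and m: "m \<in> QH0" and x: "x \<in> QB"
    and F: "filled_by r u f m" and G: "filled_by m w g x"
  shows "\<exists>u' f'. filled_by r u' f' x \<and> (\<forall>z\<in>darts r - hole_darts r. f' (Inl z) = g (Inl (f (Inl z))))"
proof -
  interpret R: gluing r u by (rule filled_by_gluing[OF r F])
  interpret M: gluing m w by (rule filled_by_gluing[OF m G])
  note If = filled_byD(3)[OF F] and Ig = filled_byD(3)[OF G]
  have uQ: "u h \<in> QH0" if "h \<in> marks r" for h using filled_byD(1)[OF F that] .
  define v where "v h k = w (f (Inr (h, k)))" for h k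
  have mk: "f (Inr (h, k)) \<in> marks m" if "h \<in> marks r" "k \<in> marks (u h)" for h k
    using that map_isoD(5)[OF If] by force
  have vQB: "v h k \<in> QB" if "h \<in> marks r" "k \<in> marks (u h)" for h k
    unfolding v_def by (rule filled_by_QB_content[OF G x mk[OF that]])
  have vper: "perimeter (v h k) = card (face (u h) k)" if "h \<in> marks r" "k \<in> marks (u h)" for h k
  proof -
    have k: "k \<in> darts (u h) - ext_face (u h)" using that QH0_marks_not_ext[OF uQ] by blast
    have "face m (f (Inr (h, k))) = f ` face (glue r u) (Inr (h, k))"
      using that k by (intro map_iso_face[OF If filled_by_planar_glue[OF r F]]) auto
    also have "\<dots> = (\<lambda>y. f (Inr (h, y))) ` face (u h) k"
      using R.glue_face_Inr[OF that(1) k] by (simp add: image_image)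
    finally have "card (face m (f (Inr (h, k)))) = card ((\<lambda>y. f (Inr (h, y))) ` face (u h) k)" by simp
    also have "\<dots> = card (face (u h) k)"
    proof (rule card_image, rule inj_onI)
      fix a b assume "a \<in> face (u h) k" "b \<in> face (u h) k" "f (Inr (h, a)) = f (Inr (h, b))"
      then show "a = b" using R.face_filling_inner[OF that(1) k] that(1)
          inj_onD[OF map_iso_inj_on[OF If], of "Inr (h, a)" "Inr (h, b)"] by auto
    qed
    finally show ?thesis unfolding v_def using M.per[OF mk[OF that]] by simp
  qed
  have "\<exists>c \<kappa>. c \<in> QB \<and> filled_by (u h) (v h) \<kappa> c \<and> perimeter c = perimeter (u h)" if "h \<in> marks r" for h
    by (rule filled_by_QB[OF uQ[OF that] vQB[OF that] vper[OF that]]) blast+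
  then obtain c \<kappa> where c: "\<And>h. h \<in> marks r \<Longrightarrow> c h \<in> QB"
    "\<And>h. h \<in> marks r \<Longrightarrow> filled_by (u h) (v h) (\<kappa> h) (c h)"
    "\<And>h. h \<in> marks r \<Longrightarrow> perimeter (c h) = perimeter (u h)" by metis
  note Ik = filled_byD(3)[OF c(2)]
  \<comment> \<open>\<open>J h\<close> is the intended image in \<open>x\<close> of the darts of
    \<open>glue (u h) (v h)\<close>, before these are renamed by \<open>\<kappa> h\<close>. It is
    defined on the exterior darts of \<open>u h\<close> as well, so that edges on the boundary of
    the hole follow the same rule as the others.\<close>
  define J where "J h \<zeta> = (case \<zeta> of Inl y \<Rightarrow> g (Inl (f (into_filling r u h y)))
     | Inr (k, z) \<Rightarrow> g (Inr (f (Inr (h, k)), z)))" for h \<zeta>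
  define f' where "f' z = (case z of Inl y \<Rightarrow> g (Inl (f (Inl y)))
     | Inr (h, y) \<Rightarrow> J h (inv_into (glue_darts (u h) (v h)) (\<kappa> h) y))" for z
  interpret C: gluing r c
    using R.planar R.marks R.marks_ext R.inj_face R.opp_hole R.per c(1,3) QH0D(1)
    by unfold_locales (auto simp: QB_iff)
  have ginv: "inv_into (glue_darts (u h) (v h)) (\<kappa> h) (\<kappa> h \<zeta>) = \<zeta>"
    if "h \<in> marks r" "\<zeta> \<in> glue_darts (u h) (v h)" for h \<zeta>
    using that map_iso_inj_on[OF Ik[OF that(1)]] by simp
  have Kin: "\<kappa> h \<zeta> \<in> darts (c h)" if "h \<in> marks r" "\<zeta> \<in> glue_darts (u h) (v h)" for h \<zeta>
    using that map_isoD(4)[OF Ik[OF that(1)]] by simp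
  have Ksur: "\<exists>\<zeta>\<in>glue_darts (u h) (v h). y = \<kappa> h \<zeta>" if "h \<in> marks r" "y \<in> darts (c h)" for h y
    using that map_iso_image_darts[OF Ik[OF that(1)]] by auto
  have GU: "gluing (u h) (v h)" if "h \<in> marks r" for h
    by (rule filled_by_gluing[OF uQ[OF that] c(2)[OF that]])
  have Kext: "\<kappa> h \<zeta> \<in> ext_face (c h) \<longleftrightarrow> \<zeta> \<in> Inl ` ext_face (u h)"
    if h: "h \<in> marks r" and z: "\<zeta> \<in> glue_darts (u h) (v h)" for h \<zeta>
  proof -
    interpret gluing "u h" "v h" by (rule GU[OF h])
    have "ext_face (c h) = \<kappa> h ` Inl ` ext_face (u h)"
      using map_iso_ext_face[OF Ik[OF h] filled_by_planar_glue[OF uQ[OF h] c(2)[OF h]]] by (simp add: ext_face_glue)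
    moreover have "Inl ` ext_face (u h) \<subseteq> glue_darts (u h) (v h)" using ext_face_subset_D by auto
    ultimately show ?thesis
      using inj_on_image_mem_iff[OF map_iso_inj_on[OF Ik[OF h], simplified] z] by blast
  qed
  \<comment> \<open>\<open>f'\<close> agrees with \<open>J\<close> on the entire content; at the
    boundary this holds because \<open>\<kappa> h\<close> preserves the index of a dart.\<close>
  have key: "f' (C.into h (\<kappa> h \<zeta>)) = J h \<zeta>"
    if h: "h \<in> marks r" and z: "\<zeta> \<in> glue_darts (u h) (v h)" for h \<zeta>
  proof (cases "\<zeta> \<in> Inl ` ext_face (u h)")
    case True
    interpret U: gluing "u h" "v h" by (rule GU[OF h])
    obtain y where y: "\<zeta> = Inl y" "y \<in> ext_face (u h)" using True by auto
    have "bdry_pos (c h) (\<kappa> h \<zeta>) = bdry_pos (u h) y"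
      using map_iso_bdry_pos[OF Ik[OF h] filled_by_planar_glue[OF uQ[OF h] c(2)[OF h]], of \<zeta>] y
      by (simp add: U.bdry_pos_glue U.ext_face_glue)
    then show ?thesis using True y Kext[OF h z] by (simp add: into_filling_def f'_def J_def)
  next
    case False
    then show ?thesis using Kext[OF h z] ginv[OF h z] by (simp add: into_filling_def f'_def)
  qed
  have fD: "f (Inl z) \<in> darts m - hole_darts m" if "z \<in> R.D" for z
    using that filled_by_hole_darts[OF r F, of "Inl z"] map_isoD(4)[OF If, of "Inl z"] by auto
  have intoD: "f (R.into h y) \<in> darts m - hole_darts m"
    if "h \<in> marks r" "y \<in> darts (u h) - hole_darts (u h)" for h y
  proof -
    have "R.into h y \<notin> Inr ` (SIGMA h:marks r. hole_darts (u h))"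
      using that(2) by (auto simp: into_filling_def)
    then show ?thesis
      using that filled_by_hole_darts[OF r F R.into_in_darts, of h y]
        map_isoD(4)[OF If, of "R.into h y"] R.into_in_darts by auto
  qed
  \<comment> \<open>The piece \<open>v h k\<close> sits in \<open>x\<close> as the filling of the
    hole \<open>f (Inr (h, k))\<close> of \<open>m\<close>. On the boundary of the piece this uses
    that hole darts of \<open>u h\<close> become hole darts of \<open>m\<close> with the same
    index.\<close>
  have Jinto: "J h (into_filling (u h) (v h) k y) = g (M.into (f (Inr (h, k))) y)"
    if h: "h \<in> marks r" and k: "k \<in> marks (u h)" and y: "y \<in> darts (v h k)" for h k y
  proof (cases "y \<in> ext_face (v h k)")
    case True
    let ?d = "hole_dart (u h) k (bdry_pos (v h k) y)"
    have d: "?d \<in> darts (u h) - ext_face (u h)" "f (Inr (h, ?d)) = hole_dart m (f (Inr (h, k))) (bdry_pos (v h k) y)"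
      using filled_by_hole_dart[OF r F h k QH0D(1)[OF m]] by blast+
    have "f (R.into h (opp (u h) ?d)) = opp m (f (R.into h ?d))"
      using d(1) by (intro filled_by_opp_into[OF r F h]) auto
    also have "\<dots> = opp m (hole_dart m (f (Inr (h, k))) (bdry_pos (v h k) y))"
      using d by (simp add: R.into_inner)
    finally show ?thesis using True by (simp add: into_filling_def J_def v_def)
  next
    case False
    then show ?thesis by (simp add: into_filling_def J_def v_def)
  qed
  \<comment> \<open>Either both sides of the edge lie in \<open>u h\<close> outside its holes, and
    \<open>f\<close> and \<open>g\<close> are followed in turn, or the edge belongs to a piece
    \<open>v h k\<close> and \<open>Jinto\<close> applies.\<close>
  have Jopp: "J h (opp (glue (u h) (v h)) \<zeta>) = opp x (J h \<zeta>)"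
    if h: "h \<in> marks r" and z: "\<zeta> \<in> glue_darts (u h) (v h)" for h \<zeta>
  proof -
    interpret U: gluing "u h" "v h" by (rule GU[OF h])
    have A: ?thesis if y: "y \<in> U.D" "opp (u h) y \<in> U.D" "\<zeta> = Inl y" for y
    proof -
      have "f (R.into h (opp (u h) y)) = opp m (f (R.into h y))"
        using y by (intro filled_by_opp_into[OF r F h]) auto
      moreover have "f (R.into h y) \<in> M.D" "f (R.into h (opp (u h) y)) \<in> M.D"
        using intoD[OF h] y by auto
      ultimately have "g (Inl (f (R.into h (opp (u h) y)))) = opp x (g (Inl (f (R.into h y))))"
        using map_isoD(2)[OF Ig, of "Inl (f (R.into h y))"] M.glue_opp_Inl[of "f (R.into h y)"] by simp
      then show ?thesis using y by (simp add: U.glue_opp_Inl J_def)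
    qed
    have B: ?thesis if k: "k \<in> marks (u h)" "y \<in> darts (v h k)" "\<zeta> = U.into k y" for k y
    proof -
      have "J h (opp (glue (u h) (v h)) \<zeta>) = J h (U.into k (opp (v h k) y))"
        using k by (simp add: U.glue_opp_into)
      also have "\<dots> = g (M.into (f (Inr (h, k))) (opp (v h k) y))"
        using k U.PU(7) by (intro Jinto h) auto
      also have "\<dots> = opp x (g (M.into (f (Inr (h, k))) y))"
        using filled_by_opp_into[OF m G mk[OF h k(1)], of y] k(2) by (simp add: v_def)
      also have "\<dots> = opp x (J h \<zeta>)" using Jinto[OF h k(1,2)] k(3) by simp
      finally show ?thesis .
    qed
    show ?thesis
    proof (cases \<zeta>)
      case (Inl y)
      then have y: "y \<in> U.D" using z by auto
      show ?thesis
      proof (cases "opp (u h) y \<in> hole_darts (u h)")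
        case True
        then obtain k z where "k \<in> marks (u h)" "z \<in> ext_face (v h k)" "Inl y = U.into k z"
          using U.Inl_eq_into[OF y] by metis
        then show ?thesis using B[of k z] Inl U.ext_face_filling_subset by auto
      next
        case False
        then show ?thesis using A[OF y _ Inl] y U.P(7) by auto
      qed
    next
      case (Inr a)
      then obtain k y where "\<zeta> = Inr (k, y)" by (cases a) auto
      then show ?thesis using z B[of k y] by (auto simp: into_filling_def)
    qed
  qed
  have opp': "f' (opp (glue r c) z) = opp x (f' z)" if z: "z \<in> glue_darts r c" for z
  proof -
    have B: ?thesis if k: "h \<in> marks r" "y \<in> darts (c h)" "z = C.into h y" for h y
    proof -
      obtain \<zeta> where z: "\<zeta> \<in> glue_darts (u h) (v h)" "y = \<kappa> h \<zeta>" using Ksur k by blast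
      have oz: "opp (glue (u h) (v h)) \<zeta> \<in> glue_darts (u h) (v h)"
        using planar_map_permutation(7)[OF filled_by_planar_glue[OF uQ[OF k(1)] c(2)[OF k(1)]]] z(1) by simp
      have "f' (opp (glue r c) z) = f' (C.into h (opp (c h) y))"
        using k by (simp add: C.glue_opp_into)
      also have "opp (c h) y = \<kappa> h (opp (glue (u h) (v h)) \<zeta>)"
        using map_isoD(2)[OF Ik[OF k(1)], of \<zeta>] z by simp
      also have "f' (C.into h \<dots>) = opp x (J h \<zeta>)"
        by (simp add: key[OF k(1) oz] Jopp[OF k(1) z(1)])
      also have "J h \<zeta> = f' z" using key[OF k(1) z(1)] z(2) k(3) by simp
      finally show ?thesis .
    qed
    show ?thesis
    proof (cases z)
      case (Inl y)
      then have y: "y \<in> R.D" using z by auto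
      show ?thesis
      proof (cases "opp r y \<in> hole_darts r")
        case True
        then obtain k z where "k \<in> marks r" "z \<in> ext_face (c k)" "Inl y = C.into k z"
          using C.Inl_eq_into[OF y] by metis
        then show ?thesis using B[of k z] Inl C.ext_face_filling_subset by auto
      next
        case False
        then have oy: "opp r y \<in> R.D" using y R.P(7) by auto
        have "f (Inl (opp r y)) = opp m (f (Inl y))"
          using map_isoD(2)[OF If, of "Inl y"] y by (simp add: R.glue_opp_Inl[OF y oy])
        then have "g (Inl (f (Inl (opp r y)))) = opp x (g (Inl (f (Inl y))))"
          using map_isoD(2)[OF Ig, of "Inl (f (Inl y))"] M.glue_opp_Inl[of "f (Inl y)"] fD[OF y] fD[OF oy]
          by simp
        then show ?thesis using Inl by (simp add: C.glue_opp_Inl[OF y oy] f'_def)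
      qed
    next
      case (Inr a)
      then obtain k y where "z = Inr (k, y)" by (cases a) auto
      then show ?thesis using z B[of k y] by (auto simp: into_filling_def)
    qed
  qed
  \<comment> \<open>A normal form for darts of \<open>glue r c\<close>: a dart of \<open>r\<close>,
    or a dart of a content taken off its exterior face.\<close>
  have form: "z \<in> Inl ` R.D \<or> (\<exists>h\<in>marks r. \<exists>\<zeta>\<in>glue_darts (u h) (v h) - Inl ` ext_face (u h). z = Inr (h, \<kappa> h \<zeta>) \<and> f' z = J h \<zeta>)"
    if z: "z \<in> glue_darts r c" for z
  proof (cases z)
    case (Inr a)
    then obtain h y where hy: "z = Inr (h, y)" "h \<in> marks r" "y \<in> darts (c h)" "y \<notin> ext_face (c h)" using z by (cases a) auto
    then obtain \<zeta> where "\<zeta> \<in> glue_darts (u h) (v h)" "y = \<kappa> h \<zeta>" using Ksur by blast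
    then show ?thesis using hy key[OF hy(2)] Kext[OF hy(2)] by (force simp: into_filling_def)
  qed (use z in auto)
  have nxt': "f' (nxt (glue r c) z) = nxt x (f' z)" if z: "z \<in> glue_darts r c" for z
    using form[OF z]
  proof (elim disjE bexE conjE)
    assume "z \<in> Inl ` R.D"
    then obtain y where y: "z = Inl y" "y \<in> R.D" by auto
    have "f (Inl (nxt r y)) = nxt m (f (Inl y))"
      using map_isoD(3)[OF If, of "Inl y"] y by (simp add: R.glue_nxt_Inl)
    then have "g (Inl (f (Inl (nxt r y)))) = nxt x (g (Inl (f (Inl y))))"
      using map_isoD(3)[OF Ig, of "Inl (f (Inl y))"] fD[OF y(2)] by (simp add: M.glue_nxt_Inl)
    then show ?thesis using y by (simp add: C.glue_nxt_Inl f'_def)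
  next
    fix h \<zeta> assume h: "h \<in> marks r" and \<zeta>: "\<zeta> \<in> glue_darts (u h) (v h) - Inl ` ext_face (u h)"
      "z = Inr (h, \<kappa> h \<zeta>)" "f' z = J h \<zeta>"
    interpret U: gluing "u h" "v h" by (rule GU[OF h])
    have y: "\<kappa> h \<zeta> \<in> darts (c h) - ext_face (c h)" using Kin[OF h] Kext[OF h] \<zeta>(1) by auto
    have "nxt (glue r c) z = Inr (h, \<kappa> h (nxt (glue (u h) (v h)) \<zeta>))"
      using C.glue_nxt_Inr[OF h y] map_isoD(3)[OF Ik[OF h], of \<zeta>] \<zeta> by simp
    then have "nxt (glue r c) z = C.into h (\<kappa> h (nxt (glue (u h) (v h)) \<zeta>))"
      using y nxt_in_ext_face_iff[OF C.planar_filling[OF h], of "\<kappa> h \<zeta>"] map_isoD(3)[OF Ik[OF h], of \<zeta>] \<zeta>(1)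
      by (simp add: into_filling_def)
    moreover have "nxt (glue (u h) (v h)) \<zeta> \<in> glue_darts (u h) (v h)"
      using planar_map_permutation(8)[OF filled_by_planar_glue[OF uQ[OF h] c(2)[OF h]]] \<zeta>(1) by simp
    ultimately have "f' (nxt (glue r c) z) = J h (nxt (glue (u h) (v h)) \<zeta>)" using key[OF h] by simp
    also have "\<dots> = nxt x (J h \<zeta>)"
    proof (cases \<zeta>)
      case (Inl y)
      then have y: "y \<in> darts (u h) - hole_darts (u h)" "y \<notin> ext_face (u h)" using \<zeta>(1) by auto
      have "nxt (u h) y \<notin> ext_face (u h)" using y(2) nxt_in_ext_face_iff[OF U.planar] by blast
      moreover have "f (Inr (h, nxt (u h) y)) = nxt m (f (Inr (h, y)))"
        using map_isoD(3)[OF If, of "Inr (h, y)"] y h by (simp add: R.glue_nxt_Inr)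
      moreover have "f (Inr (h, y)) \<in> M.D" using intoD[OF h y(1)] y(2) by (simp add: into_filling_def)
      ultimately show ?thesis
        using Inl y map_isoD(3)[OF Ig, of "Inl (f (Inr (h, y)))"] M.glue_nxt_Inl[of "f (Inr (h, y))"]
        by (simp add: U.glue_nxt_Inl J_def into_filling_def)
    next
      case (Inr a)
      then obtain k y where ky: "\<zeta> = Inr (k, y)" "k \<in> marks (u h)" "y \<in> darts (v h k) - ext_face (v h k)"
        using \<zeta>(1) by (cases a) auto
      then show ?thesis
        using map_isoD(3)[OF Ig, of "Inr (f (Inr (h, k)), y)"] mk[OF h ky(2)]
          M.glue_nxt_Inr[OF mk[OF h ky(2)], of y]
        by (simp add: U.glue_nxt_Inr J_def) (simp add: v_def)
    qed
    finally show ?thesis using \<zeta>(3) by simp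
  qed
  have gin: "g a = g b \<Longrightarrow> a \<in> glue_darts m w \<Longrightarrow> b \<in> glue_darts m w \<Longrightarrow> a = b" for a b
    using inj_onD[OF map_iso_inj_on[OF Ig]] by simp
  have fin: "f a = f b \<Longrightarrow> a \<in> glue_darts r u \<Longrightarrow> b \<in> glue_darts r u \<Longrightarrow> a = b" for a b
    using inj_onD[OF map_iso_inj_on[OF If]] by simp
  \<comment> \<open>the dart of \<open>glue m w\<close> behind a dart of \<open>glue r c\<close>\<close>
  define T where "T h \<zeta> = (case \<zeta> of Inl y \<Rightarrow> Inl (f (Inr (h, y))) | Inr (k, z) \<Rightarrow> Inr (f (Inr (h, k)), z))"
    for h and \<zeta> :: "nat + nat \<times> nat"
  have T: "J h \<zeta> = g (T h \<zeta>)" "T h \<zeta> \<in> glue_darts m w"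
    if h: "h \<in> marks r" and "\<zeta> \<in> glue_darts (u h) (v h) - Inl ` ext_face (u h)" for h \<zeta>
  proof -
    show "J h \<zeta> = g (T h \<zeta>)"
      using that by (auto simp: T_def J_def into_filling_def split: sum.splits)
    show "T h \<zeta> \<in> glue_darts m w"
    proof (cases \<zeta>)
      case (Inl y)
      then have "y \<notin> ext_face (u h)" using that by blast
      then show ?thesis using Inl that intoD[OF h, of y] by (auto simp: T_def into_filling_def)
    next
      case (Inr a)
      then show ?thesis using that mk[OF h] by (cases a) (auto simp: T_def v_def)
    qed
  qed
  have "inj_on f' (glue_darts r c)"
  proof (rule inj_onI)
    fix a b assume ab: "a \<in> glue_darts r c" "b \<in> glue_darts r c" "f' a = f' b"
    \<comment> \<open>A dart of \<open>r\<close> and an interior dart of a content cannot have the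
      same image in \<open>x\<close>: pulled back along \<open>g\<close> and then \<open>f\<close>,
      an \<open>Inl\<close> would equal an \<open>Inr\<close>.\<close>
    have X: False if "a = Inl y" "y \<in> R.D" "h \<in> marks r"
      "\<zeta> \<in> glue_darts (u h) (v h) - Inl ` ext_face (u h)" "f' a = J h \<zeta>" for a y h \<zeta>
    proof -
      have "g (Inl (f (Inl y))) = g (T h \<zeta>)" using that T(1)[OF that(3,4)] by (simp add: f'_def)
      then have "Inl (f (Inl y)) = T h \<zeta>" using fD[OF that(2)] T(2)[OF that(3,4)] by (intro gin) auto
      then obtain y' where y': "\<zeta> = Inl y'" "f (Inl y) = f (Inr (h, y'))"
        by (auto simp: T_def split: sum.splits)
      have "Inl y = Inr (h, y')" by (rule fin[OF y'(2)]) (use that y'(1) in auto)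
      then show False by simp
    qed
    consider y z where "a = Inl y" "y \<in> R.D" "b = Inl z" "z \<in> R.D"
      | h \<zeta> h' \<zeta>' where "h \<in> marks r" "\<zeta> \<in> glue_darts (u h) (v h) - Inl ` ext_face (u h)"
        "a = Inr (h, \<kappa> h \<zeta>)" "f' a = J h \<zeta>" "h' \<in> marks r" "\<zeta>' \<in> glue_darts (u h') (v h') - Inl ` ext_face (u h')"
        "b = Inr (h', \<kappa> h' \<zeta>')" "f' b = J h' \<zeta>'"
      using form[OF ab(1)] form[OF ab(2)] X ab(3) by (elim disjE imageE bexE conjE) metis+
    then show "a = b"
    proof cases
      case 1
      then have "g (Inl (f (Inl y))) = g (Inl (f (Inl z)))" using ab(3) by (simp add: f'_def)
      then have "f (Inl y) = f (Inl z)" using gin fD[OF 1(2)] fD[OF 1(4)] by fastforce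
      then have "Inl y = (Inl z :: nat + nat \<times> nat)" using fin[of "Inl y" "Inl z"] 1 by auto
      then show ?thesis using 1 by simp
    next
      case 2
      have "T h \<zeta> = T h' \<zeta>'"
        using ab(3) 2 T(1)[OF 2(1,2)] T(1)[OF 2(5,6)] by (intro gin T(2)) auto
      moreover have "h = h' \<and> y = y'"
        if "f (Inr (h, y)) = f (Inr (h', y'))"
          "y \<in> darts (u h)" "y \<notin> ext_face (u h)" "y' \<in> darts (u h')" "y' \<notin> ext_face (u h')" for y y'
        using fin[of "Inr (h, y)" "Inr (h', y')"] 2(1,5) that by auto
      ultimately have "h = h' \<and> \<zeta> = \<zeta>'"
        using 2(2,6) QH0_marks_not_ext[OF uQ[OF 2(1)]] QH0_marks_not_ext[OF uQ[OF 2(5)]]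
        by (cases \<zeta>; cases \<zeta>') (force simp: T_def image_iff)+
      then show ?thesis using 2 by simp
    qed
  qed
  moreover have "f' ` glue_darts r c = darts x"
  proof (intro equalityI subsetI)
    fix a assume "a \<in> f' ` glue_darts r c"
    then obtain z where z: "z \<in> glue_darts r c" "a = f' z" by blast
    have gd: "g t \<in> darts x" if "t \<in> glue_darts m w" for t using map_isoD(4)[OF Ig] that by simp
    show "a \<in> darts x"
      using form[OF z(1)] z(2) fD T by (auto simp: f'_def intro!: gd)
  next
    fix a assume "a \<in> darts x"
    then obtain t where t: "t \<in> glue_darts m w" "a = g t" using map_iso_image_darts[OF Ig] by auto
    have Q: "g (T h \<zeta>) \<in> f' ` glue_darts r c" if "h \<in> marks r" "\<zeta> \<in> glue_darts (u h) (v h) - Inl ` ext_face (u h)" for h \<zeta>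
    proof -
      have "g (T h \<zeta>) = f' (C.into h (\<kappa> h \<zeta>))" using T(1)[OF that] key[OF that(1)] that(2) by simp
      moreover have "C.into h (\<kappa> h \<zeta>) \<in> glue_darts r c"
        using Kin[OF that(1)] that by (intro C.into_in_darts) auto
      ultimately show ?thesis by blast
    qed
    show "a \<in> f' ` glue_darts r c"
    proof (cases t)
      case (Inl d)
      then have d: "d \<in> darts m" "d \<notin> hole_darts m" using t by auto
      then obtain s where s: "s \<in> glue_darts r u" "d = f s" using map_iso_image_darts[OF If] by auto
      show ?thesis
      proof (cases s)
        case (Inl y)
        then have "a = f' (Inl y)" using s t \<open>t = Inl d\<close> by (simp add: f'_def)
        then show ?thesis using s(1) Inl by auto
      next
        case (Inr p)
        then obtain h y where hy: "s = Inr (h, y)" "h \<in> marks r" "y \<in> darts (u h)" "y \<notin> ext_face (u h)"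
          using s(1) by (cases p) auto
        then have "y \<notin> hole_darts (u h)" using filled_by_hole_darts[OF r F s(1)] d s(2) by auto
        then show ?thesis using Q[of h "Inl y"] hy s t Inl by (auto simp: T_def)
      qed
    next
      case (Inr p)
      then obtain k' y where k': "t = Inr (k', y)" "k' \<in> marks m" "y \<in> darts (w k') - ext_face (w k')"
        using t(1) by (cases p) auto
      then obtain h k where hk: "h \<in> marks r" "k \<in> marks (u h)" "k' = f (Inr (h, k))"
        using map_isoD(5)[OF If, symmetric] by auto
      then show ?thesis using Q[of h "Inr (k, y)"] k' t by (auto simp: T_def v_def)
    qed
  qed
  moreover have "f' (root (glue r c)) = root x"
    using map_isoD(1)[OF If] map_isoD(1)[OF Ig] by (simp add: f'_def)
  moreover have "f' ` marks (glue r c) = marks x"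
    using c(1) x by (auto simp: QB_iff)
  ultimately have "map_iso f' (glue r c) x"
    using opp' nxt' by (simp add: map_iso_def bij_betw_def)
  then have "filled_by r c f' x"
    using c(1,3) R.per by (auto simp: filled_by_def QB_iff)
  moreover have "\<forall>z\<in>darts r - hole_darts r. f' (Inl z) = g (Inl (f (Inl z)))" by (simp add: f'_def)
  ultimately show ?thesis by blast
qed

section \<open>Decorations of a glued map\<close>

lemma inner_face_subset:
  assumes "planar_map m" "F \<in> inner_faces m"
  shows "F \<subseteq> darts m - ext_face m" "F \<subseteq> darts m - hole_darts m"
proof -
  obtain x where x: "x \<in> darts m" "x \<notin> ext_face m" "x \<notin> hole_darts m" "F = face m x"
    using assms(2) by (auto simp: inner_faces_def)
  have "y \<notin> ext_face m \<and> y \<notin> hole_darts m" if "y \<in> face m x" for y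
    using x that face_eqI[OF assms(1)] planar_map_permutation(10)[OF assms(1)]
    unfolding ext_face_def hole_darts_def by (metis UN_iff)
  then show "F \<subseteq> darts m - ext_face m" "F \<subseteq> darts m - hole_darts m"
    using inner_face_subset_darts[OF assms] x(4) by auto
qed

lemma restr_eq:
  assumes m: "m \<in> QH0" and F: "filled_by m u f x"
  shows "restr (Some m) x \<sigma> = (\<lambda>F\<in>inner_faces m. \<sigma> (f ` Inl ` F))"
proof -
  have "snd (filling m x) ` Inl ` F = f ` Inl ` F" if "F \<in> inner_faces m" for F
    using inner_face_subset(2)[OF QH0D(1)[OF m] that] filling_eq(2)[OF m F]
    by (intro image_cong) auto
  moreover have "Some m \<sqsubseteq>\<^sub>H Some x" using F by auto
  ultimately show ?thesis
    unfolding restr.simps by (intro restrict_ext) simp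
qed

lemma content_eq:
  "m \<in> QH0 \<Longrightarrow> filled_by m u f x \<Longrightarrow> h \<in> marks m \<Longrightarrow> content (Some m) x h = u h"
  by (simp add: filling_eq(1))

lemma content_deco_eq:
  assumes m: "m \<in> QH0" and F: "filled_by m u f x" and h: "h \<in> marks m"
  shows "content_deco (Some m) x \<sigma> h = (\<lambda>F\<in>inner_faces (u h). \<sigma> (f ` (\<lambda>y. Inr (h, y)) ` F))"
proof -
  have "snd (filling m x) ` (\<lambda>y. Inr (h, y)) ` F = f ` (\<lambda>y. Inr (h, y)) ` F"
    if "F \<in> inner_faces (u h)" for F
    using inner_face_subset(1)[OF QH0D(1)[OF filled_byD(1)[OF F h]] that] filling_eq(2)[OF m F] h
    by (intro image_cong) auto
  then show ?thesis using filling_eq(1)[OF m F h] by (auto simp: restrict_def)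
qed

text \<open>Faces are indexed by a sum so that the splitting of decorations has the shape of
  \<open>nn_integral_PiM_Plus_Sigma\<close>.\<close>

definition glued_face ::
  "(nat + nat \<times> nat \<Rightarrow> nat) \<Rightarrow> nat set + nat \<times> nat set \<Rightarrow> nat set" where
  "glued_face f i = (case i of Inl F \<Rightarrow> f ` Inl ` F | Inr (h, F) \<Rightarrow> f ` (\<lambda>y. Inr (h, y)) ` F)"

lemma glued_face_simps [simp]:
  "glued_face f (Inl F) = f ` Inl ` F"
  "glued_face f (Inr (h, F)) = f ` (\<lambda>y. Inr (h, y)) ` F"
  by (simp_all add: glued_face_def)

lemma image_case_prod_Sigma: "(\<lambda>p. case p of (a, b) \<Rightarrow> k a b) ` (SIGMA a:A. B a) = (\<Union>a\<in>A. k a ` B a)"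
  by force

text \<open>Faces are nonempty, so the piece from which a face of the glued map comes can be read
  off its darts.\<close>

lemma bij_betw_glued_face:
  assumes m: "m \<in> QH0" and F: "filled_by m u f x"
  shows "bij_betw (glued_face f) (inner_faces m <+> (SIGMA h:marks m. inner_faces (u h))) (inner_faces x)"
proof -
  interpret gluing m u by (rule filled_by_gluing[OF m F])
  note I = filled_byD(3)[OF F]
  let ?g = "\<lambda>i. case i of Inl F \<Rightarrow> Inl ` F | Inr (h, F) \<Rightarrow> (\<lambda>y. Inr (h, y :: nat)) ` F"
  let ?I = "inner_faces m <+> (SIGMA h:marks m. inner_faces (u h))"
  have ne: "F \<noteq> {}" if "F \<in> inner_faces c" for F and c :: "nat hmap"
    using that by (auto simp: inner_faces_def face_def orbit_nonempty)
  have "inner_faces (glue m u) =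
    (`) Inl ` inner_faces m \<union> (\<Union>h\<in>marks m. (`) (\<lambda>y. Inr (h, y)) ` inner_faces (u h))"
    by (rule inner_faces_glue) (rule QH0_marks_not_ext[OF filled_byD(1)[OF F]])
  then have img: "inner_faces (glue m u) = ?g ` ?I"
    by (simp add: Plus_def image_Un image_image image_case_prod_Sigma)
  have sub: "?g ` ?I \<subseteq> Pow (glue_darts m u)"
    using inner_face_subset_darts[OF filled_by_planar_glue[OF m F]] img[symmetric] by auto
  have "inj_on ?g ?I"
  proof (rule inj_onI)
    fix i j assume ij: "i \<in> ?I" "j \<in> ?I" "?g i = ?g j"
    show "i = j"
    proof (cases i; cases j)
      fix F G assume "i = Inl F" "j = Inl G"
      then show ?thesis using ij(3) by (simp add: inj_image_eq_iff)
    next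
      fix F p assume *: "i = Inl F" "j = Inr p"
      then have "F \<noteq> {}" using ij(1) ne by auto
      then show ?thesis using ij(3) * by (cases p) auto
    next
      fix F p assume *: "i = Inr p" "j = Inl F"
      then have "F \<noteq> {}" using ij(2) ne by auto
      then show ?thesis using ij(3) * by (cases p) auto
    next
      fix p q assume *: "i = Inr p" "j = Inr q"
      obtain h F h' G where pq: "p = (h, F)" "q = (h', G)" by force
      have F: "F \<noteq> {}" "G \<noteq> {}" using ij(1,2) * pq ne by auto
      have eq: "(\<lambda>y. Inr (h, y) :: nat + nat \<times> nat) ` F = (\<lambda>y. Inr (h', y)) ` G"
        using ij(3) * pq by simp
      obtain a where "a \<in> F" using F(1) by auto
      then have "Inr (h, a) \<in> (\<lambda>y. Inr (h', y) :: nat + nat \<times> nat) ` G" using eq by blast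
      then have "h = h'" by auto
      moreover have "F = G"
        using eq unfolding \<open>h = h'\<close> by (subst (asm) inj_image_eq_iff) (auto simp: inj_on_def)
      ultimately show ?thesis using * pq by simp
    qed
  qed
  moreover have "inj_on ((`) f) (?g ` ?I)"
    using sub by (intro inj_on_subset[OF inj_on_image_Pow[OF map_iso_inj_on[OF I, simplified]]])
  moreover have "glued_face f = (`) f \<circ> ?g"
    by (auto simp: fun_eq_iff glued_face_def split: sum.splits)
  moreover have "inner_faces x = (`) f ` ?g ` ?I"
    unfolding img[symmetric]
    by (rule map_iso_inner_faces[OF I filled_by_planar_glue[OF m F] filled_by_marks_glue[OF F]])
  ultimately show ?thesis
    by (simp add: bij_betw_def comp_inj_on image_comp)
qed

lemma card_inner_faces_glued:
  assumes m: "m \<in> QH0" and F: "filled_by m u f x"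
  shows "card (inner_faces x) = card (inner_faces m) + (\<Sum>h\<in>marks m. card (inner_faces (u h)))"
proof -
  interpret gluing m u by (rule filled_by_gluing[OF m F])
  have fin: "finite (marks m)" using marks P(1) finite_subset by blast
  have "card (inner_faces x) = card (inner_faces m <+> (SIGMA h:marks m. inner_faces (u h)))"
    using bij_betw_same_card[OF bij_betw_glued_face[OF m F]] by simp
  also have "\<dots> = card (inner_faces m) + card (SIGMA h:marks m. inner_faces (u h))"
    using fin planar planar_filling
    by (intro card_Plus) (auto intro!: finite_SigmaI finite_inner_faces)
  also have "card (SIGMA h:marks m. inner_faces (u h)) = (\<Sum>h\<in>marks m. card (inner_faces (u h)))"
    using fin planar_filling by (intro card_SigmaI) (auto intro: finite_inner_faces)
  finally show ?thesis .
qed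

lemma spin_glued_Inl:
  assumes m: "m \<in> QH0" and F: "filled_by m u f x" and z: "z \<in> darts m - hole_darts m"
  shows "spin x b \<sigma> (f (Inl z)) = spin m b (restr (Some m) x \<sigma>) z"
proof -
  interpret gluing m u by (rule filled_by_gluing[OF m F])
  note I = filled_byD(3)[OF F] and pg = filled_by_planar_glue[OF m F]
  have "Inl ` ext_face m \<subseteq> glue_darts m u" using ext_face_subset_D by auto
  then have "f (Inl z) \<in> f ` Inl ` ext_face m \<longleftrightarrow> Inl z \<in> (Inl ` ext_face m :: (nat + nat \<times> nat) set)"
    using z by (intro inj_on_image_mem_iff[OF map_iso_inj_on[OF I, simplified]]) auto
  then have ext: "f (Inl z) \<in> ext_face x \<longleftrightarrow> z \<in> ext_face m"
    by (auto simp: map_iso_ext_face[OF I pg] ext_face_glue)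
  show ?thesis
  proof (cases "z \<in> ext_face m")
    case True
    then show ?thesis
      using map_iso_bdry_pos[OF I pg, of "Inl z"] ext by (simp add: spin_def ext_face_glue bdry_pos_glue)
  next
    case False
    then have "face m z \<in> inner_faces m" using z by (auto simp: inner_faces_def)
    moreover have "face x (f (Inl z)) = f ` Inl ` face m z"
      using map_iso_face[OF I pg, of "Inl z"] z by (simp add: glue_face_Inl[OF z])
    ultimately show ?thesis using False ext by (simp only: spin_def restr_eq[OF m F]) simp
  qed
qed

text \<open>At an exterior dart \<open>into_filling\<close> returns the dart of \<open>m\<close>
  across the hole, whose spin is by definition the boundary condition of the hole. A filling thus
  sees its surroundings through \<open>hole_bc\<close> only.\<close>

lemma spin_glued_into:
  assumes m: "m \<in> QH0" and F: "filled_by m u f x" and x: "x \<in> QB"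
    and h: "h \<in> marks m" and y: "y \<in> darts (u h)"
  shows "spin x b \<sigma> (f (into_filling m u h y)) =
    spin (u h) (hole_bc b (Some m) (restr (Some m) x \<sigma>) h) (content_deco (Some m) x \<sigma> h) y"
proof -
  interpret gluing m u by (rule filled_by_gluing[OF m F])
  note I = filled_byD(3)[OF F] and pg = filled_by_planar_glue[OF m F]
  show ?thesis
  proof (cases "y \<in> ext_face (u h)")
    case True
    then show ?thesis
      using spin_glued_Inl[OF m F opp_hole_dart_in_D[OF h]]
      by (simp add: spin_def[of "u h"] into_filling_def)
  next
    case False
    have "Inl ` ext_face m \<subseteq> glue_darts m u" using ext_face_subset_D by auto
    then have "f (Inr (h, y)) \<in> f ` Inl ` ext_face m \<longleftrightarrow> Inr (h, y) \<in> (Inl ` ext_face m :: (nat + nat \<times> nat) set)"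
      using h y False by (intro inj_on_image_mem_iff[OF map_iso_inj_on[OF I, simplified]]) auto
    then have "f (Inr (h, y)) \<notin> ext_face x"
      by (auto simp: map_iso_ext_face[OF I pg] ext_face_glue)
    moreover have "face x (f (Inr (h, y))) = f ` (\<lambda>y. Inr (h, y)) ` face (u h) y"
      using map_iso_face[OF I pg, of "Inr (h, y)"] h y False by (simp add: glue_face_Inr)
    moreover have "face (u h) y \<in> inner_faces (u h)"
      using filled_by_QB_content[OF F x h] y False by (auto simp: inner_faces_def hole_darts_def QB_iff)
    ultimately show ?thesis using False
      by (simp only: spin_def content_deco_eq[OF m F h] into_filling_def) simp
  qed
qed

text \<open>Edges bordering a hole are left out here: they are also edges of the filling and enter
  its energy.\<close>

definition outer_energy :: "real \<Rightarrow> nat hmap \<Rightarrow> (nat \<Rightarrow> 'v::real_normed_vector) \<Rightarrow> 'v deco \<Rightarrow> real" where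
  "outer_energy \<beta> m b \<tau> = \<beta> / 2 * ((\<Sum>z | z \<in> darts m - hole_darts m \<and> opp m z \<in> darts m - hole_darts m.
     (norm (spin m b \<tau> z - spin m b \<tau> (opp m z)))\<^sup>2) / 2)"

text \<open>Each edge of \<open>x\<close> is counted once: either both its sides are darts of
  \<open>m\<close> and no hole is adjacent in \<open>m\<close>, or it is the image of an edge of
  exactly one filling. An exterior dart of a filling stands for the dart of \<open>m\<close> across
  the hole, so the interaction across the boundary of a hole belongs to the filling.\<close>

lemma energy_glued:
  assumes m: "m \<in> QH0" and F: "filled_by m u f x" and x: "x \<in> QB"
  shows "energy \<beta> x b \<sigma> = outer_energy \<beta> m b (restr (Some m) x \<sigma>) +
    (\<Sum>h\<in>marks m. energy \<beta> (u h) (hole_bc b (Some m) (restr (Some m) x \<sigma>) h) (content_deco (Some m) x \<sigma> h))"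
proof -
  interpret gluing m u by (rule filled_by_gluing[OF m F])
  note I = filled_byD(3)[OF F]
  let ?\<tau> = "restr (Some m) x \<sigma>" and ?bc = "\<lambda>h. hole_bc b (Some m) (restr (Some m) x \<sigma>) h"
    and ?c = "\<lambda>h. content_deco (Some m) x \<sigma> h"
  define t where "t z = (norm (spin x b \<sigma> z - spin x b \<sigma> (opp x z)))\<^sup>2" for z
  let ?E = "{z. z \<in> D \<and> opp m z \<in> D}"
  have fin: "finite (marks m)" "finite D" using marks P(1) finite_subset by blast+
  \<comment> \<open>In contrast to the definition of \<open>glue_darts\<close>, all darts of a
    filling occur here, the exterior ones too, and the darts of \<open>m\<close> facing a hole are
    dropped in exchange.\<close>
  have split: "glue_darts m u = Inl ` ?E \<union> case_prod into ` (SIGMA h:marks m. darts (u h))"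
  proof (intro equalityI subsetI)
    fix z assume z: "z \<in> glue_darts m u"
    show "z \<in> Inl ` ?E \<union> case_prod into ` (SIGMA h:marks m. darts (u h))"
    proof (cases z)
      case (Inl d)
      then have d: "d \<in> D" using z by auto
      show ?thesis
      proof (cases "opp m d \<in> hole_darts m")
        case True
        then obtain h y where hy: "h \<in> marks m" "y \<in> ext_face (u h)" "Inl d = into h y"
          using Inl_eq_into[OF d] by metis
        then have "z = case_prod into (h, y)" using Inl by simp
        then show ?thesis using hy ext_face_filling_subset by blast
      next
        case False
        then show ?thesis using d P(7) Inl by auto
      qed
    next
      case (Inr p)
      obtain h y where p: "p = (h, y)" by force
      then have hy: "h \<in> marks m" "y \<in> darts (u h)" "y \<notin> ext_face (u h)" using z Inr by auto
      then have "z = case_prod into (h, y)" using Inr p by (simp add: into_filling_def)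
      then show ?thesis using hy by (intro UnI2 image_eqI[of _ _ "(h, y)"]) auto
    qed
  qed (use into_in_darts in auto)
  have disj: "Inl ` ?E \<inter> case_prod into ` (SIGMA h:marks m. darts (u h)) = {}"
  proof -
    have False if "Inl z = into h y" "opp m z \<in> D" "h \<in> marks m" for z h y
      using that opp_opp_hole[OF hole_dart_in_hole_darts[OF that(3)]] hole_dart_in_hole_darts[OF that(3)]
      by (auto simp: into_filling_def split: if_splits)
    then show ?thesis by auto
  qed
  have inj: "inj_on (case_prod into) (SIGMA h:marks m. darts (u h))"
    using into_inj by (auto simp: inj_on_def)
  have finS: "finite (SIGMA h:marks m. darts (u h))" using fin PU(1) by (intro finite_SigmaI)
  have "(\<Sum>z\<in>darts x. t z) = (\<Sum>z\<in>glue_darts m u. t (f z))"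
    using sum.reindex[OF map_iso_inj_on[OF I], of t] map_iso_image_darts[OF I] by simp
  also have "\<dots> = (\<Sum>z\<in>Inl ` ?E. t (f z)) + (\<Sum>z\<in>case_prod into ` (SIGMA h:marks m. darts (u h)). t (f z))"
    unfolding split using fin finS disj by (intro sum.union_disjoint finite_imageI) (auto elim: rev_finite_subset)
  also have "(\<Sum>z\<in>Inl ` ?E. t (f z)) = (\<Sum>z\<in>?E. (norm (spin m b ?\<tau> z - spin m b ?\<tau> (opp m z)))\<^sup>2)"
  proof -
    have "t (f (Inl z)) = (norm (spin m b ?\<tau> z - spin m b ?\<tau> (opp m z)))\<^sup>2" if z: "z \<in> D" "opp m z \<in> D" for z
    proof -
      have "opp x (f (Inl z)) = f (Inl (opp m z))"
        using map_isoD(2)[OF I, of "Inl z"] z(1) by (simp add: glue_opp_Inl[OF z])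
      then show ?thesis
        unfolding t_def by (simp only: spin_glued_Inl[OF m F z(1)] spin_glued_Inl[OF m F z(2)])
    qed
    then show ?thesis by (simp add: sum.reindex)
  qed
  also have "(\<Sum>z\<in>case_prod into ` (SIGMA h:marks m. darts (u h)). t (f z)) =
      (\<Sum>h\<in>marks m. \<Sum>y\<in>darts (u h). t (f (into h y)))"
  proof -
    have "(\<Sum>h\<in>marks m. \<Sum>y\<in>darts (u h). t (f (into h y))) =
      (\<Sum>(h, y)\<in>(SIGMA h:marks m. darts (u h)). t (f (into h y)))"
      using fin PU(1) by (intro sum.Sigma) auto
    then show ?thesis unfolding sum.reindex[OF inj] o_def by (simp add: case_prod_beta)
  qed
  also have "\<dots> = (\<Sum>h\<in>marks m. \<Sum>y\<in>darts (u h).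
      (norm (spin (u h) (?bc h) (?c h) y - spin (u h) (?bc h) (?c h) (opp (u h) y)))\<^sup>2)"
  proof (intro sum.cong refl)
    fix h y assume h: "h \<in> marks m" and y: "y \<in> darts (u h)"
    show "t (f (into h y)) = (norm (spin (u h) (?bc h) (?c h) y - spin (u h) (?bc h) (?c h) (opp (u h) y)))\<^sup>2"
      unfolding t_def filled_by_opp_into[OF m F h y, symmetric]
      by (simp only: spin_glued_into[OF m F x h y] spin_glued_into[OF m F x h PU(7)[OF h y]])
  qed
  finally have "(\<Sum>z\<in>darts x. t z) / 2 = (\<Sum>z\<in>?E. (norm (spin m b ?\<tau> z - spin m b ?\<tau> (opp m z)))\<^sup>2) / 2 +
    (\<Sum>h\<in>marks m. (\<Sum>y\<in>darts (u h). (norm (spin (u h) (?bc h) (?c h) y - spin (u h) (?bc h) (?c h) (opp (u h) y)))\<^sup>2) / 2)"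
    by (simp only: add_divide_distrib sum_divide_distrib)
  then have "\<beta> / 2 * ((\<Sum>z\<in>darts x. t z) / 2) = \<beta> / 2 * ((\<Sum>z\<in>?E. (norm (spin m b ?\<tau> z - spin m b ?\<tau> (opp m z)))\<^sup>2) / 2) +
    (\<Sum>h\<in>marks m. \<beta> / 2 * ((\<Sum>y\<in>darts (u h). (norm (spin (u h) (?bc h) (?c h) y - spin (u h) (?bc h) (?c h) (opp (u h) y)))\<^sup>2) / 2))"
    by (simp only: distrib_left sum_distrib_left)
  then show ?thesis
    unfolding energy_def outer_energy_def t_def .
qed

text \<open>\<open>\<theta>\<close> finds each face of \<open>r\<close> among the faces of
  \<open>m\<close> and does not depend on \<open>x\<close>; the decoration of \<open>r\<close> is
  therefore a fixed measurable function of that of \<open>m\<close>.\<close>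

lemma submap_trans_restr:
  fixes r m :: "nat hmap option"
  assumes r: "r \<in> QH" and m: "m \<in> QH" and rm: "r \<sqsubseteq>\<^sub>H m"
  obtains \<theta> :: "nat set \<Rightarrow> nat set" where "\<And>F. F \<in> inner_faces_H r \<Longrightarrow> \<theta> F \<in> inner_faces_H m"
    "\<And>x. x \<in> QB \<Longrightarrow> m \<sqsubseteq>\<^sub>H Some x \<Longrightarrow> r \<sqsubseteq>\<^sub>H Some x"
    "\<And>x (\<sigma> :: ('v::zero) deco). x \<in> QB \<Longrightarrow> m \<sqsubseteq>\<^sub>H Some x \<Longrightarrow>
      restr r x \<sigma> = (\<lambda>F\<in>inner_faces_H r. restr m x \<sigma> (\<theta> F))"
proof (cases r)
  case None
  then show thesis by (intro that) (auto simp: restrict_def)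
next
  case (Some r0)
  then obtain m0 where m0: "m = Some m0" using rm by (cases m) auto
  have Q: "r0 \<in> QH0" "m0 \<in> QH0" using r m Some m0 by (auto simp: QH_def)
  obtain u f where F: "filled_by r0 u f m0" using rm Some m0 by auto
  interpret gluing r0 u by (rule filled_by_gluing[OF Q(1) F])
  show thesis
  proof (rule that[of "\<lambda>F. f ` Inl ` F"])
    show 1: "f ` Inl ` F \<in> inner_faces_H m" if "F \<in> inner_faces_H r" for F
      using that bij_betw_apply[OF bij_betw_glued_face[OF Q(1) F], of "Inl F"] Some m0 by auto
    fix x assume x: "x \<in> QB" "m \<sqsubseteq>\<^sub>H Some x"
    then obtain w g where G: "filled_by m0 w g x" using m0 by auto
    obtain u' f' where F': "filled_by r0 u' f' x" "\<And>z. z \<in> D \<Longrightarrow> f' (Inl z) = g (Inl (f (Inl z)))"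
      using filled_by_trans[OF Q x(1) F G] by blast
    then show "r \<sqsubseteq>\<^sub>H Some x" using Some by auto
    fix \<sigma> :: "('v::zero) deco"
    have "f' ` Inl ` F = g ` Inl ` f ` Inl ` F" if "F \<in> inner_faces r0" for F
      unfolding image_image by (intro image_cong refl F'(2)) (use inner_face_subset(2)[OF planar that] in auto)
    then show "restr r x \<sigma> = (\<lambda>F\<in>inner_faces_H r. restr m x \<sigma> (f ` Inl ` F))"
      using 1 unfolding Some m0 restr_eq[OF Q(1) F'(1)] restr_eq[OF Q(2) G]
      by (auto simp: fun_eq_iff restrict_def)
  qed
qed

section \<open>Product measures\<close>

text \<open>Fubini for a decoration split into the part \<open>I\<close> of a submap and the parts
  \<open>J h\<close> of its holes: once the former is fixed, the integrals over the holes
  factorise.\<close>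

lemma nn_integral_PiM_Plus_Sigma:
  fixes \<mu> :: "'v measure" and \<theta> :: "'i + 'h \<times> 'j \<Rightarrow> 'k"
  assumes \<mu>: "sigma_finite_measure \<mu>"
    and fin: "finite I" "finite H" "\<And>h. h \<in> H \<Longrightarrow> finite (J h)"
    and \<theta>: "bij_betw \<theta> (I <+> Sigma H J) K"
    and A: "A \<in> borel_measurable (PiM I (\<lambda>_. \<mu>))"
    and B: "\<And>h. h \<in> H \<Longrightarrow> case_prod (B h) \<in> borel_measurable (PiM I (\<lambda>_. \<mu>) \<Otimes>\<^sub>M PiM (J h) (\<lambda>_. \<mu>))"
  shows "(\<integral>\<^sup>+\<sigma>. A (\<lambda>i\<in>I. \<sigma> (\<theta> (Inl i))) *
      (\<Prod>h\<in>H. B h (\<lambda>i\<in>I. \<sigma> (\<theta> (Inl i))) (\<lambda>j\<in>J h. \<sigma> (\<theta> (Inr (h, j))))) \<partial>PiM K (\<lambda>_. \<mu>)) =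
    (\<integral>\<^sup>+\<tau>. A \<tau> * (\<Prod>h\<in>H. \<integral>\<^sup>+s. B h \<tau> s \<partial>PiM (J h) (\<lambda>_. \<mu>)) \<partial>PiM I (\<lambda>_. \<mu>))"
proof -
  interpret \<mu>: sigma_finite_measure \<mu> by (rule \<mu>)
  interpret P: product_sigma_finite "\<lambda>_. \<mu>" by standard
  \<comment> \<open>\<open>product_sigma_finite\<close> speaks of all indices, also those outside
    \<open>H\<close>, where \<open>J h\<close> could be infinite; there the index set is made
    empty.\<close>
  define J' where "J' h = (if h \<in> H then J h else {})" for h
  have J': "J' h = J h" if "h \<in> H" for h using that by (simp add: J'_def)
  have finJ': "finite (J' h)" for h using fin(3) by (simp add: J'_def)
  interpret Q: product_sigma_finite "\<lambda>h. PiM (J' h) (\<lambda>_. \<mu>)"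
    by standard (rule P.sigma_finite[OF finJ', THEN sigma_finite_measure.sigma_finite_countable])
  interpret QH: sigma_finite_measure "PiM H (\<lambda>h. PiM (J' h) (\<lambda>_. \<mu>))"
    by (rule Q.sigma_finite[OF fin(2)])
  interpret PI: sigma_finite_measure "PiM I (\<lambda>_. \<mu>)"
    by (rule P.sigma_finite[OF fin(1)])
  let ?N = "PiM I (\<lambda>_. \<mu>) \<Otimes>\<^sub>M PiM H (\<lambda>h. PiM (J' h) (\<lambda>_. \<mu>))"
  have finK: "finite K"
    using bij_betw_finite[OF \<theta>] fin by (simp add: finite_SigmaI)
  have inj: "inj_on \<theta> (I <+> Sigma H J)" and img: "K = \<theta> ` (I <+> Sigma H J)"
    using \<theta> by (auto simp: bij_betw_def)
  define \<eta> where "\<eta> = inv_into (I <+> Sigma H J) \<theta>"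
  have \<eta>: "\<eta> (\<theta> a) = a" if "a \<in> I <+> Sigma H J" for a
    unfolding \<eta>_def using inj that by simp
  define \<Phi> where "\<Phi> p = (\<lambda>k\<in>K. case \<eta> k of Inl i \<Rightarrow> fst p i | Inr (h, j) \<Rightarrow> snd p h j)"
    for p :: "('i \<Rightarrow> 'v) \<times> ('h \<Rightarrow> 'j \<Rightarrow> 'v)"
  have \<theta>K: "\<theta> a \<in> K" if "a \<in> I <+> Sigma H J" for a
    using img that by blast
  have \<Phi>\<theta>: "\<Phi> p (\<theta> a) = (case a of Inl i \<Rightarrow> fst p i | Inr (h, j) \<Rightarrow> snd p h j)"
    if "a \<in> I <+> Sigma H J" for p a
    using \<theta>K[OF that] \<eta>[OF that] by (simp add: \<Phi>_def)
  have \<Phi>m: "\<Phi> \<in> measurable ?N (PiM K (\<lambda>_. \<mu>))"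
    unfolding \<Phi>_def
  proof (rule measurable_restrict)
    fix k assume "k \<in> K"
    then obtain a where a: "a \<in> I <+> Sigma H J" "k = \<theta> a" using img by blast
    show "(\<lambda>p. case \<eta> k of Inl i \<Rightarrow> fst p i | Inr (h, j) \<Rightarrow> snd p h j) \<in> measurable ?N \<mu>"
    proof (cases a)
      case (Inl i)
      then have "i \<in> I" using a by auto
      then have "(\<lambda>p. fst p i) \<in> measurable ?N \<mu>"
        by (intro measurable_compose[OF measurable_fst measurable_component_singleton])
      then show ?thesis using \<eta>[OF a(1)] a(2) Inl by simp
    next
      case (Inr b)
      obtain h j where b: "b = (h, j)" by force
      then have hj: "h \<in> H" "j \<in> J' h" using a Inr by (auto simp: J')
      have "(\<lambda>p. snd p h) \<in> measurable ?N (PiM (J' h) (\<lambda>_. \<mu>))"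
        by (rule measurable_compose[OF measurable_snd measurable_component_singleton[OF hj(1)]])
      then have "(\<lambda>p. snd p h j) \<in> measurable ?N \<mu>"
        by (rule measurable_compose) (rule measurable_component_singleton[OF hj(2)])
      then show ?thesis using \<eta>[OF a(1)] a(2) Inr b by simp
    qed
  qed
  \<comment> \<open>The preimage of a box under \<open>\<Phi>\<close> is a product of boxes, so both
    measures agree on boxes, which determine the product measure.\<close>
  have eq: "PiM K (\<lambda>_. \<mu>) = distr ?N (PiM K (\<lambda>_. \<mu>)) \<Phi>"
  proof (rule P.PiM_eqI[symmetric, OF finK])
    fix R assume R: "\<And>k. k \<in> K \<Longrightarrow> R k \<in> sets \<mu>"
    have RI: "R (\<theta> (Inl i)) \<in> sets \<mu>" if "i \<in> I" for i
      using that img by (intro R) auto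
    have RJ: "R (\<theta> (Inr (h, j))) \<in> sets \<mu>" if "h \<in> H" "j \<in> J' h" for h j
      using that img J' by (intro R) auto
    let ?RI = "Pi\<^sub>E I (\<lambda>i. R (\<theta> (Inl i)))"
    let ?RH = "Pi\<^sub>E H (\<lambda>h. Pi\<^sub>E (J' h) (\<lambda>j. R (\<theta> (Inr (h, j)))))"
    have "\<Phi> -` Pi\<^sub>E K R \<inter> space ?N = ?RI \<times> ?RH"
    proof (intro equalityI subsetI)
      fix p assume p: "p \<in> \<Phi> -` Pi\<^sub>E K R \<inter> space ?N"
      obtain \<tau> s where ps: "p = (\<tau>, s)" by force
      have sp: "\<tau> \<in> space (PiM I (\<lambda>_. \<mu>))" "s \<in> space (PiM H (\<lambda>h. PiM (J' h) (\<lambda>_. \<mu>)))"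
        using p ps by (simp_all add: space_pair_measure)
      have v: "\<Phi> p (\<theta> a) \<in> R (\<theta> a)" if "a \<in> I <+> Sigma H J" for a
        using PiE_mem[of "\<Phi> p" K R "\<theta> a"] p \<theta>K[OF that] by simp
      have "\<tau> \<in> ?RI"
      proof (rule PiE_I)
        show "\<tau> i \<in> R (\<theta> (Inl i))" if "i \<in> I" for i
          using v[OF InlI[OF that]] \<Phi>\<theta>[OF InlI[OF that]] ps by simp
        show "\<tau> i = undefined" if "i \<notin> I" for i
          using sp(1) that unfolding space_PiM by (rule PiE_arb)
      qed
      moreover have "s \<in> ?RH"
      proof (rule PiE_I)
        show "s h = undefined" if "h \<notin> H" for h
          using sp(2) that unfolding space_PiM by (rule PiE_arb)
        fix h assume h: "h \<in> H"
        have sh: "s h \<in> Pi\<^sub>E (J' h) (\<lambda>_. space \<mu>)"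
          using PiE_mem[OF sp(2)[unfolded space_PiM] h] .
        show "s h \<in> Pi\<^sub>E (J' h) (\<lambda>j. R (\<theta> (Inr (h, j))))"
        proof (rule PiE_I)
          show "s h j = undefined" if "j \<notin> J' h" for j using sh that by (rule PiE_arb)
          fix j assume "j \<in> J' h"
          then have "Inr (h, j) \<in> I <+> Sigma H J" using h J' by auto
          from v[OF this] \<Phi>\<theta>[OF this] ps show "s h j \<in> R (\<theta> (Inr (h, j)))" by simp
        qed
      qed
      ultimately show "p \<in> ?RI \<times> ?RH" using ps by simp
    next
      fix p assume p: "p \<in> ?RI \<times> ?RH"
      obtain \<tau> s where ps: "p = (\<tau>, s)" by force
      have t: "\<tau> \<in> ?RI" and s: "s \<in> ?RH" using p ps by simp_all
      have "\<tau> \<in> space (PiM I (\<lambda>_. \<mu>))"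
        using subsetD[OF PiE_mono t] RI[THEN sets.sets_into_space] by (simp add: space_PiM)
      moreover have "s \<in> space (PiM H (\<lambda>h. PiM (J' h) (\<lambda>_. \<mu>)))"
        unfolding space_PiM
        by (rule subsetD[OF PiE_mono s], rule PiE_mono) (rule RJ[THEN sets.sets_into_space])
      moreover have "\<Phi> p \<in> Pi\<^sub>E K R"
      proof (rule PiE_I)
        show "\<Phi> p k = undefined" if "k \<notin> K" for k using that by (simp add: \<Phi>_def)
        fix k assume "k \<in> K"
        then obtain a where a: "a \<in> I <+> Sigma H J" "k = \<theta> a" using img by blast
        show "\<Phi> p k \<in> R k"
        proof (cases a)
          case (Inl i)
          then show ?thesis using PiE_mem[OF t, of i] a \<Phi>\<theta>[OF a(1)] ps by auto
        next
          case (Inr b)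
          obtain h j where b: "b = (h, j)" by force
          then have hj: "h \<in> H" "j \<in> J' h" using a Inr J' by auto
          then show ?thesis using PiE_mem[OF PiE_mem[OF s hj(1)] hj(2)] a \<Phi>\<theta>[OF a(1)] ps Inr b by simp
        qed
      qed
      ultimately show "p \<in> \<Phi> -` Pi\<^sub>E K R \<inter> space ?N"
        using ps by (simp add: space_pair_measure)
    qed
    then have "emeasure (distr ?N (PiM K (\<lambda>_. \<mu>)) \<Phi>) (Pi\<^sub>E K R) = emeasure ?N (?RI \<times> ?RH)"
      using R finK by (subst emeasure_distr[OF \<Phi>m]) (auto intro: sets_PiM_I_finite)
    also have "\<dots> = emeasure (PiM I (\<lambda>_. \<mu>)) ?RI * emeasure (PiM H (\<lambda>h. PiM (J' h) (\<lambda>_. \<mu>))) ?RH"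
      using RI RJ fin finJ' by (intro QH.emeasure_pair_measure_Times sets_PiM_I_finite) auto
    also have "emeasure (PiM I (\<lambda>_. \<mu>)) ?RI = (\<Prod>i\<in>I. emeasure \<mu> (R (\<theta> (Inl i))))"
      using RI fin by (intro P.emeasure_PiM) auto
    also have "emeasure (PiM H (\<lambda>h. PiM (J' h) (\<lambda>_. \<mu>))) ?RH =
        (\<Prod>h\<in>H. emeasure (PiM (J' h) (\<lambda>_. \<mu>)) (Pi\<^sub>E (J' h) (\<lambda>j. R (\<theta> (Inr (h, j))))))"
      using RJ fin finJ' by (intro Q.emeasure_PiM sets_PiM_I_finite) auto
    also have "\<dots> = (\<Prod>h\<in>H. \<Prod>j\<in>J h. emeasure \<mu> (R (\<theta> (Inr (h, j)))))"
      using RJ fin(3) J' by (intro prod.cong refl) (subst P.emeasure_PiM, auto)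
    also have "\<dots> = (\<Prod>p\<in>Sigma H J. emeasure \<mu> (R (\<theta> (Inr p))))"
      using fin by (subst prod.Sigma) (auto intro!: prod.cong)
    also have "(\<Prod>i\<in>I. emeasure \<mu> (R (\<theta> (Inl i)))) * \<dots> = (\<Prod>a\<in>I <+> Sigma H J. emeasure \<mu> (R (\<theta> a)))"
      using fin by (subst prod.Plus) (auto simp: finite_SigmaI)
    also have "\<dots> = (\<Prod>k\<in>K. emeasure \<mu> (R k))"
      by (rule prod.reindex_bij_betw[OF \<theta>])
    finally show "emeasure (distr ?N (PiM K (\<lambda>_. \<mu>)) \<Phi>) (Pi\<^sub>E K R) = (\<Prod>k\<in>K. emeasure \<mu> (R k))" .
  qed simp
  have rI: "(\<lambda>i\<in>I. \<Phi> (\<tau>, s) (\<theta> (Inl i))) = \<tau>" if "\<tau> \<in> space (PiM I (\<lambda>_. \<mu>))" for \<tau> s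
    using that by (auto simp: \<Phi>\<theta>[OF InlI] space_PiM PiE_def extensional_def restrict_def fun_eq_iff)
  have rJ: "(\<lambda>j\<in>J h. \<Phi> (\<tau>, s) (\<theta> (Inr (h, j)))) = s h"
    if "s \<in> space (PiM H (\<lambda>h. PiM (J' h) (\<lambda>_. \<mu>)))" "h \<in> H" for \<tau> s h
  proof
    fix j
    have "s h \<in> extensional (J h)" using that J'[OF that(2)] by (auto simp: space_PiM PiE_def Pi_def)
    then show "(\<lambda>j\<in>J h. \<Phi> (\<tau>, s) (\<theta> (Inr (h, j)))) j = s h j"
      using that(2) \<Phi>\<theta>[OF InrI[OF SigmaI[of h H j J]]] by (auto simp: extensional_def restrict_def)
  qed
  have rIm: "(\<lambda>\<sigma>. \<lambda>i\<in>I. \<sigma> (\<theta> (Inl i))) \<in> measurable (PiM K (\<lambda>_. \<mu>)) (PiM I (\<lambda>_. \<mu>))"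
    using img by (intro measurable_restrict measurable_component_singleton) auto
  have rJm: "(\<lambda>\<sigma>. \<lambda>j\<in>J h. \<sigma> (\<theta> (Inr (h, j)))) \<in> measurable (PiM K (\<lambda>_. \<mu>)) (PiM (J h) (\<lambda>_. \<mu>))"
    if "h \<in> H" for h
    using img that by (intro measurable_restrict measurable_component_singleton) auto
  let ?F = "\<lambda>\<sigma>. A (\<lambda>i\<in>I. \<sigma> (\<theta> (Inl i))) *
      (\<Prod>h\<in>H. B h (\<lambda>i\<in>I. \<sigma> (\<theta> (Inl i))) (\<lambda>j\<in>J h. \<sigma> (\<theta> (Inr (h, j)))))"
  have Fm: "?F \<in> borel_measurable (PiM K (\<lambda>_. \<mu>))"
    using measurable_compose[OF rIm A] measurable_compose[OF measurable_Pair[OF rIm rJm] B]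
    by (intro borel_measurable_times_ennreal borel_measurable_prod_ennreal) simp_all
  have "integral\<^sup>N (PiM K (\<lambda>_. \<mu>)) ?F = (\<integral>\<^sup>+p. ?F (\<Phi> p) \<partial>?N)"
    by (subst eq, rule nn_integral_distr[OF \<Phi>m]) (use Fm in simp)
  also have "\<dots> = (\<integral>\<^sup>+p. A (fst p) * (\<Prod>h\<in>H. B h (fst p) (snd p h)) \<partial>?N)"
  proof (rule nn_integral_cong)
    fix p assume "p \<in> space ?N"
    then obtain \<tau> s where p: "p = (\<tau>, s)" "\<tau> \<in> space (PiM I (\<lambda>_. \<mu>))"
      "s \<in> space (PiM H (\<lambda>h. PiM (J' h) (\<lambda>_. \<mu>)))" by (auto simp: space_pair_measure)
    show "?F (\<Phi> p) = A (fst p) * (\<Prod>h\<in>H. B h (fst p) (snd p h))"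
      unfolding p(1) rI[OF p(2)] fst_conv snd_conv
      by (intro arg_cong2[where f="(*)"] prod.cong refl) (simp add: rJ[OF p(3)])
  qed
  also have "\<dots> = (\<integral>\<^sup>+\<tau>. \<integral>\<^sup>+s. A \<tau> * (\<Prod>h\<in>H. B h \<tau> (s h)) \<partial>PiM H (\<lambda>h. PiM (J' h) (\<lambda>_. \<mu>)) \<partial>PiM I (\<lambda>_. \<mu>))"
  proof (subst QH.nn_integral_fst[symmetric])
    have "(\<lambda>p. B h (fst p) (snd p h)) \<in> borel_measurable ?N" if "h \<in> H" for h
    proof -
      have "(\<lambda>p. (fst p, snd p h)) \<in> measurable ?N (PiM I (\<lambda>_. \<mu>) \<Otimes>\<^sub>M PiM (J' h) (\<lambda>_. \<mu>))"
        by (intro measurable_Pair measurable_fst measurable_compose[OF measurable_snd measurable_component_singleton[OF that]])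
      from measurable_compose[OF this, of "case_prod (B h)"] B[OF that] show ?thesis
        by (simp add: J'[OF that])
    qed
    then show "(\<lambda>p. A (fst p) * (\<Prod>h\<in>H. B h (fst p) (snd p h))) \<in> borel_measurable ?N"
      using measurable_compose[OF measurable_fst A]
      by (intro borel_measurable_times_ennreal borel_measurable_prod_ennreal) simp_all
  qed simp
  also have "\<dots> = (\<integral>\<^sup>+\<tau>. A \<tau> * (\<Prod>h\<in>H. \<integral>\<^sup>+s. B h \<tau> s \<partial>PiM (J h) (\<lambda>_. \<mu>)) \<partial>PiM I (\<lambda>_. \<mu>))"
  proof (rule nn_integral_cong)
    fix \<tau> assume \<tau>: "\<tau> \<in> space (PiM I (\<lambda>_. \<mu>))"
    have Bt: "B h \<tau> \<in> borel_measurable (PiM (J' h) (\<lambda>_. \<mu>))" if "h \<in> H" for h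
      using measurable_compose[OF measurable_Pair1'[OF \<tau>] B[OF that]] J'[OF that] by simp
    have "(\<lambda>s. \<Prod>h\<in>H. B h \<tau> (s h)) \<in> borel_measurable (PiM H (\<lambda>h. PiM (J' h) (\<lambda>_. \<mu>)))"
    proof (rule borel_measurable_prod_ennreal)
      fix h assume h: "h \<in> H"
      show "(\<lambda>s. B h \<tau> (s h)) \<in> borel_measurable (PiM H (\<lambda>h. PiM (J' h) (\<lambda>_. \<mu>)))"
        using measurable_component_singleton[OF h] Bt[OF h] by (rule measurable_compose)
    qed
    then have "(\<integral>\<^sup>+s. A \<tau> * (\<Prod>h\<in>H. B h \<tau> (s h)) \<partial>PiM H (\<lambda>h. PiM (J' h) (\<lambda>_. \<mu>))) =
        A \<tau> * (\<integral>\<^sup>+s. (\<Prod>h\<in>H. B h \<tau> (s h)) \<partial>PiM H (\<lambda>h. PiM (J' h) (\<lambda>_. \<mu>)))"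
      by (rule nn_integral_cmult)
    also have "(\<integral>\<^sup>+s. (\<Prod>h\<in>H. B h \<tau> (s h)) \<partial>PiM H (\<lambda>h. PiM (J' h) (\<lambda>_. \<mu>))) =
        (\<Prod>h\<in>H. \<integral>\<^sup>+s. B h \<tau> s \<partial>PiM (J' h) (\<lambda>_. \<mu>))"
      by (rule Q.product_nn_integral_prod[OF fin(2) Bt])
    also have "\<dots> = (\<Prod>h\<in>H. \<integral>\<^sup>+s. B h \<tau> s \<partial>PiM (J h) (\<lambda>_. \<mu>))"
      by (intro prod.cong) (simp_all add: J')
    finally show "(\<integral>\<^sup>+s. A \<tau> * (\<Prod>h\<in>H. B h \<tau> (s h)) \<partial>PiM H (\<lambda>h. PiM (J' h) (\<lambda>_. \<mu>))) =
        A \<tau> * (\<Prod>h\<in>H. \<integral>\<^sup>+s. B h \<tau> s \<partial>PiM (J h) (\<lambda>_. \<mu>))" .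
  qed
  finally show ?thesis .
qed

text \<open>Distributivity of products over countable sums, obtained as Fubini for counting
  measures.\<close>

lemma nn_integral_count_space_PiE_prod:
  fixes g :: "'h \<Rightarrow> 'w \<Rightarrow> ennreal"
  assumes "finite H" "\<And>h. h \<in> H \<Longrightarrow> countable (W h)"
  shows "(\<integral>\<^sup>+w. (\<Prod>h\<in>H. g h (w h)) \<partial>count_space (Pi\<^sub>E H W)) = (\<Prod>h\<in>H. \<integral>\<^sup>+w. g h w \<partial>count_space (W h))"
proof -
  define W' where "W' h = (if h \<in> H then W h else {})" for h
  have W': "countable (W' h)" for h using assms(2) by (simp add: W'_def)
  interpret product_sigma_finite "\<lambda>h. count_space (W' h)"
    by standard (rule sigma_finite_measure_count_space_countable[OF W', THEN sigma_finite_measure.sigma_finite_countable])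
  have "Pi\<^sub>E H W = Pi\<^sub>E H W'" by (rule PiE_cong) (simp add: W'_def)
  then have "(\<integral>\<^sup>+w. (\<Prod>h\<in>H. g h (w h)) \<partial>count_space (Pi\<^sub>E H W)) =
      (\<integral>\<^sup>+w. (\<Prod>h\<in>H. g h (w h)) \<partial>PiM H (\<lambda>h. count_space (W' h)))"
    by (simp add: count_space_PiM_finite[OF assms(1) W'])
  also have "\<dots> = (\<Prod>h\<in>H. \<integral>\<^sup>+w. g h w \<partial>count_space (W' h))"
    by (rule product_nn_integral_prod) (simp_all add: assms(1))
  finally show ?thesis by (simp add: W'_def cong: prod.cong)
qed

section \<open>Measurability\<close>

text \<open>\<open>opp\<close> and \<open>nxt\<close> are the identity off the finite set of darts,
  so a map is determined by finite data: its darts, two finite graphs, the root and the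
  marks.\<close>

lemma countable_planar_maps: "countable {m :: nat hmap. planar_map m \<and> marks m \<subseteq> darts m}" (is "countable ?A")
proof -
  let ?e = "\<lambda>m :: nat hmap. (darts m, (\<lambda>x. (x, opp m x)) ` darts m, (\<lambda>x. (x, nxt m x)) ` darts m, root m, marks m)"
  have "countable (Collect finite \<times> Collect finite \<times> Collect finite \<times> (UNIV :: nat set) \<times> Collect finite ::
      (nat set \<times> (nat \<times> nat) set \<times> (nat \<times> nat) set \<times> nat \<times> nat set) set)"
    by (intro countable_SIGMA countable_Collect_finite) simp
  moreover have "?e ` ?A \<subseteq> Collect finite \<times> Collect finite \<times> Collect finite \<times> UNIV \<times> Collect finite"
    using planar_map_permutation(1) by (auto intro: rev_finite_subset)
  ultimately have "countable (?e ` ?A)" by (rule countable_subset[rotated])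
  moreover have "inj_on ?e ?A"
  proof (rule inj_onI)
    fix m m' assume m: "m \<in> ?A" "m' \<in> ?A" and eq: "?e m = ?e m'"
    then have d: "darts m' = darts m" "marks m' = marks m" "root m' = root m" by auto
    have g: "k x = k' x" if "(\<lambda>x. (x, k x)) ` darts m = (\<lambda>x. (x, k' x)) ` darts m'"
      "k permutes darts m" "k' permutes darts m'" for k k' x
    proof (cases "x \<in> darts m")
      case True
      then have "(x, k x) \<in> (\<lambda>x. (x, k' x)) ` darts m'" using that(1) by blast
      then show ?thesis by auto
    next
      case False
      then show ?thesis using that(2,3) d by (simp add: permutes_not_in)
    qed
    have P: "planar_map m" "planar_map m'" using m by simp_all
    have "opp m = opp m'"
      by (rule ext, rule g[OF _ planar_map_permutation(3)[OF P(1)] planar_map_permutation(3)[OF P(2)]])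
        (use eq[unfolded prod.inject] in blast)
    moreover have "nxt m = nxt m'"
      by (rule ext, rule g[OF _ planar_map_permutation(4)[OF P(1)] planar_map_permutation(4)[OF P(2)]])
        (use eq[unfolded prod.inject] in blast)
    ultimately show "m = m'" using d by (intro hmap.equality) simp_all
  qed
  ultimately show ?thesis by (rule countable_image_inj_on)
qed

lemma countable_QH0: "countable QH0"
  by (rule countable_subset[OF _ countable_planar_maps]) (use QH0D(1,2) in blast)

lemma countable_QB: "countable QB"
  by (rule countable_subset[OF _ countable_QH0]) (auto simp: QB_iff)

lemma countable_QB_per: "countable (QB_per d)"
  by (rule countable_subset[OF _ countable_QB]) (auto simp: QB_per_def)

lemma countable_QH: "countable QH"
  by (simp add: QH_def countable_QH0)

lemma space_deco_alg: "space deco_alg = extensional (Collect finite)"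
  by (auto simp: deco_alg_def space_PiM PiE_def)

text \<open>The coordinates outside \<open>J\<close> are constantly \<open>undefined\<close>, hence
  measurable.\<close>

lemma measurable_into_deco_alg:
  assumes "J \<subseteq> Collect finite"
  shows "(\<lambda>\<sigma>. \<sigma>) \<in> measurable (PiM J (\<lambda>_. borel)) (deco_alg :: 'v::topological_space deco measure)"
  unfolding deco_alg_def
proof (rule measurable_PiM_single')
  show "(\<lambda>\<sigma>. \<sigma> F) \<in> borel_measurable (PiM J (\<lambda>_. borel :: 'v measure))" for F :: "nat set"
  proof (cases "F \<in> J")
    case True
    then show ?thesis by (rule measurable_component_singleton)
  next
    case False
    then have "\<sigma> F = undefined" if "\<sigma> \<in> space (PiM J (\<lambda>_. borel :: 'v measure))" for \<sigma>
      using that by (auto simp: space_PiM PiE_def extensional_def)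
    then show ?thesis by (subst measurable_cong[where g="\<lambda>_. undefined"]) auto
  qed
qed (use assms in \<open>auto simp: space_PiM PiE_def extensional_def\<close>)

lemma inner_faces_subset_finite: "planar_map m \<Longrightarrow> inner_faces m \<subseteq> Collect finite"
  using inner_faces_finite by auto

lemma inner_faces_H_subset_finite: "m \<in> QH \<Longrightarrow> inner_faces_H m \<subseteq> Collect finite"
  by (cases m) (auto simp: QH_def dest: inner_faces_finite[OF QH0D(1)])

lemma measurable_restrict_deco:
  assumes "inner_faces x \<subseteq> Collect finite"
  shows "(\<lambda>\<sigma>. restrict \<sigma> (inner_faces x)) \<in> measurable (deco_alg :: 'v::topological_space deco measure) (PiM (inner_faces x) (\<lambda>_. borel))"
  unfolding deco_alg_def by (rule measurable_restrict_subset) (rule assms)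

text \<open>A random decoration has coordinates at all finite sets; for a submap \<open>m\<close> of
  \<open>x\<close>, \<open>restr\<close> reads only those at interior faces of
  \<open>x\<close>.\<close>

lemma restr_restrict:
  fixes \<sigma> :: "'v::zero deco"
  assumes m: "m \<in> QH" and mx: "m \<sqsubseteq>\<^sub>H Some x"
  shows "restr m x (restrict \<sigma> (inner_faces x)) = restr m x \<sigma>"
proof (cases m)
  case (Some m0)
  then obtain u f where F: "filled_by m0 u f x" using mx by auto
  have Q: "m0 \<in> QH0" using m Some by (auto simp: QH_def)
  show ?thesis
    unfolding Some restr_eq[OF Q F]
    using bij_betw_apply[OF bij_betw_glued_face[OF Q F], of "Inl _"]
    by (intro restrict_ext) (simp add: InlI)
qed simp

lemma measurable_restr:
  assumes m: "m \<in> QH" and mx: "m \<sqsubseteq>\<^sub>H Some x"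
  shows "restr m x \<in> measurable (PiM (inner_faces x) (\<lambda>_. borel)) (PiM (inner_faces_H m) (\<lambda>_. borel :: 'v::{zero,topological_space} measure))"
proof (cases m)
  case None
  have "restr None x = (\<lambda>_ :: 'v deco. \<lambda>_. undefined)" by (rule ext) simp
  then show ?thesis unfolding None by (simp add: space_PiM)
next
  case (Some m0)
  then obtain u f where F: "filled_by m0 u f x" using mx by auto
  have Q: "m0 \<in> QH0" using m Some by (auto simp: QH_def)
  show ?thesis
    unfolding Some restr_eq[OF Q F, abs_def] inner_faces_H.simps
    using bij_betw_apply[OF bij_betw_glued_face[OF Q F], of "Inl _"]
    by (intro measurable_restrict measurable_component_singleton) (simp add: InlI)
qed

lemma measurable_restr_deco_alg:
  assumes m: "m \<in> QH" and x: "x \<in> QB"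
  shows "restr m x \<in> measurable deco_alg (PiM (inner_faces_H m) (\<lambda>_. borel :: 'v::{zero,topological_space} measure))"
proof (cases "m \<sqsubseteq>\<^sub>H Some x")
  case True
  have "inner_faces x \<subseteq> Collect finite"
    using x by (intro inner_faces_subset_finite) (auto simp: QB_iff QH0D(1))
  from measurable_compose[OF measurable_restrict_deco[OF this] measurable_restr[OF m True]]
  show ?thesis by (simp only: restr_restrict[OF m True])
next
  case False
  then obtain m0 where "m = Some m0" by (cases m) auto
  then have "restr m x = (\<lambda>_ :: 'v deco. \<lambda>F\<in>inner_faces_H m. 0)"
    using False by (auto simp: fun_eq_iff)
  then show ?thesis by (simp add: space_PiM)
qed

lemma content_QB:
  assumes m: "m \<in> QH" and x: "x \<in> QB" and mx: "m \<sqsubseteq>\<^sub>H Some x" and h: "h \<in> holes m"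
  shows "content m x h \<in> QB"
proof (cases m)
  case (Some m0)
  then obtain u f where F: "filled_by m0 u f x" using mx by auto
  have Q: "m0 \<in> QH0" using m Some by (auto simp: QH_def)
  then show ?thesis using filled_by_QB_content[OF F x] content_eq[OF Q F] h Some by simp
qed (simp add: x)

lemma measurable_content_deco:
  fixes m :: "nat hmap option"
  assumes m: "m \<in> QH" and x: "x \<in> QB" and mx: "m \<sqsubseteq>\<^sub>H Some x" and h: "h \<in> holes m"
  shows "(\<lambda>\<sigma>. content_deco m x \<sigma> h) \<in> measurable deco_alg (deco_alg :: 'v::topological_space deco measure)"
proof (cases m)
  case (Some m0)
  then obtain u f where F: "filled_by m0 u f x" using mx by auto
  have Q: "m0 \<in> QH0" using m Some by (auto simp: QH_def)
  have h': "h \<in> marks m0" using h Some by simp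
  have fin: "inner_faces (u h) \<subseteq> Collect finite"
    by (rule inner_faces_subset_finite[OF QH0D(1)[OF filled_byD(1)[OF F h']]])
  have "(\<lambda>\<sigma>. \<lambda>G\<in>inner_faces (u h). \<sigma> (f ` (\<lambda>y. Inr (h, y)) ` G)) \<in>
    measurable deco_alg (PiM (inner_faces (u h)) (\<lambda>_. borel :: 'v measure))"
    unfolding deco_alg_def using fin
    by (intro measurable_restrict measurable_component_singleton) auto
  from measurable_compose[OF this measurable_into_deco_alg[OF fin]]
  show ?thesis unfolding Some content_deco_eq[OF Q F h'] .
qed simp

text \<open>The boundary condition varies along with the decoration: for a hole it is itself a
  function of the spins around the hole.\<close>

lemma borel_measurable_energy:
  fixes bc :: "'a \<Rightarrow> nat \<Rightarrow> 'v::{real_normed_vector, second_countable_topology}"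
  assumes w: "w \<in> QB" and bc: "\<And>i. (\<lambda>\<omega>. bc \<omega> i) \<in> borel_measurable N"
    and s: "s \<in> measurable N (PiM (inner_faces w) (\<lambda>_. borel))"
  shows "(\<lambda>\<omega>. energy \<beta> w (bc \<omega>) (s \<omega>)) \<in> borel_measurable N"
proof -
  have "(\<lambda>\<omega>. spin w (bc \<omega>) (s \<omega>) x) \<in> borel_measurable N" if x: "x \<in> darts w" for x
  proof (cases "x \<in> ext_face w")
    case False
    then have "face w x \<in> inner_faces w"
      using x w by (auto simp: inner_faces_def hole_darts_def QB_iff)
    from measurable_compose[OF s measurable_component_singleton[OF this]]
    show ?thesis using False by (simp add: spin_def)
  qed (simp add: spin_def bc)
  moreover have "opp w x \<in> darts w" if "x \<in> darts w" for x
    using that w planar_map_permutation(7)[of w] by (auto simp: QB_iff QH0D(1))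
  ultimately show ?thesis
    unfolding energy_def
    by (intro borel_measurable_times borel_measurable_divide borel_measurable_sum
        borel_measurable_power measurable_compose[OF borel_measurable_diff borel_measurable_norm] borel_measurable_const) blast+
qed

lemma borel_measurable_spin_D:
  fixes b :: "nat \<Rightarrow> 'v::{real_normed_vector, second_countable_topology}"
  assumes x: "x \<in> darts m - hole_darts m"
  shows "(\<lambda>\<tau>. spin m b \<tau> x) \<in> borel_measurable (PiM (inner_faces m) (\<lambda>_. borel))"
proof (cases "x \<in> ext_face m")
  case False
  then have "face m x \<in> inner_faces m"
    using x by (auto simp: inner_faces_def)
  from measurable_component_singleton[OF this] show ?thesis using False by (simp add: spin_def)
qed (simp add: spin_def)

lemma borel_measurable_outer_energy:
  fixes b :: "nat \<Rightarrow> 'v::{real_normed_vector, second_countable_topology}"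
  shows "outer_energy \<beta> m b \<in> borel_measurable (PiM (inner_faces m) (\<lambda>_. borel))"
  unfolding outer_energy_def[abs_def]
  by (intro borel_measurable_times borel_measurable_divide borel_measurable_sum
        borel_measurable_power measurable_compose[OF borel_measurable_diff borel_measurable_norm] borel_measurable_const
        borel_measurable_spin_D) auto

lemma borel_measurable_hole_bc:
  fixes b :: "nat \<Rightarrow> 'v::{real_normed_vector, second_countable_topology}"
  assumes m: "m \<in> QH" and h: "h \<in> holes m"
  shows "(\<lambda>\<tau>. hole_bc b m \<tau> h i) \<in> borel_measurable (PiM (inner_faces_H m) (\<lambda>_. borel))"
proof (cases m)
  case (Some m0)
  then have Q: "m0 \<in> QH0" "h \<in> marks m0" using m h by (auto simp: QH_def)
  have "hole_dart m0 h i \<in> hole_darts m0"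
    using funpow_in_orbit[of h "inv (nxt m0)" h i] orbit_inv_eq[of "nxt m0" h]
      planar_map_permutation(5)[OF QH0D(1)[OF Q(1)]] Q(2)
    by (auto simp: hole_dart_def hole_darts_def face_def permutation_self_in_orbit intro!: bexI[of _ h])
  then show ?thesis
    unfolding Some using borel_measurable_spin_D[OF QH0D(7)[OF Q(1)]] by simp
qed simp

section \<open>Boltzmann laws and their Markov property\<close>

lemma glue_cong:
  assumes "gluing m u" and eq: "\<And>h. h \<in> marks m \<Longrightarrow> u h = u' h"
  shows "glue m u = glue m u'"
proof -
  interpret gluing m u by fact
  have d: "glue_darts m u = glue_darts m u'" using eq by (auto simp: glue_darts_def)
  have o: "glue_opp m u z = glue_opp m u' z" if z: "z \<in> glue_darts m u" for z
  proof (cases z)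
    case (Inl x)
    show ?thesis
    proof (cases "opp m x \<in> hole_darts m")
      case True
      then obtain h where "h \<in> marks m" "opp m x \<in> face m h" by (auto simp: hole_darts_def)
      then show ?thesis using Inl eq mark_of_eq by (simp add: glue_opp_def Let_def)
    qed (simp add: Inl glue_opp_def)
  next
    case (Inr p)
    then show ?thesis using z eq by (cases p) (simp add: glue_opp_def Let_def)
  qed
  have n: "glue_nxt m u z = glue_nxt m u' z" if z: "z \<in> glue_darts m u" for z
    using z eq by (cases z) (auto simp: glue_nxt_def)
  show ?thesis
    using eq o n unfolding glue_def d[symmetric] by (auto simp: fun_eq_iff Sigma_def)
qed

lemma filled_by_cong:
  assumes "m \<in> QH0" "filled_by m u f p" and eq: "\<And>h. h \<in> marks m \<Longrightarrow> u h = u' h"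
  shows "filled_by m u' f p"
  using assms(2) glue_cong[OF filled_by_gluing[OF assms(1,2)] eq] eq by (auto simp: filled_by_def)

lemma filled_by_same_content:
  assumes m: "m \<in> QH0" and F: "filled_by m u f p" "filled_by m u f' p'" and p: "p \<in> QB" "p' \<in> QB"
  shows "p = p'"
proof -
  have "map_iso (inv_into (darts (glue m u)) f) p (glue m u)"
    by (rule map_iso_sym[OF filled_byD(3)[OF F(1)] filled_by_planar_glue[OF m F(1)] filled_by_marks_glue[OF F(1)]])
  from map_iso_trans[OF this filled_byD(3)[OF F(2)]] show ?thesis
    using p by (intro chosen_unique) (auto simp: QB_iff QH0D)
qed

text \<open>Restricting to the marks makes the family an element of \<open>PiE\<close>, so that
  distinct families stand for distinct maps.\<close>

definition hole_contents :: "nat hmap \<Rightarrow> nat hmap \<Rightarrow> nat \<Rightarrow> nat hmap" where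
  "hole_contents m x = (\<lambda>h\<in>marks m. content (Some m) x h)"

lemma filled_by_hole_contents:
  assumes "m \<in> QH0" "Some m \<sqsubseteq>\<^sub>H Some x"
  obtains f where "filled_by m (hole_contents m x) f x"
proof -
  obtain u f where F: "filled_by m u f x" using assms(2) by auto
  have "filled_by m (hole_contents m x) f x"
    by (rule filled_by_cong[OF assms(1) F]) (simp add: hole_contents_def filling_eq(1)[OF assms(1) F])
  then show thesis by (rule that)
qed

text \<open>Turns a sum over maps containing \<open>m\<close> into a sum over free choices of the
  contents. Injectivity comes from the uniqueness of representatives, surjectivity from
  \<open>filled_by_QB\<close>.\<close>

lemma bij_betw_hole_contents:
  assumes m: "m \<in> QH0"
  shows "bij_betw (hole_contents m) {x \<in> QB_per (perimeter m). Some m \<sqsubseteq>\<^sub>H Some x}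
    (Pi\<^sub>E (marks m) (\<lambda>h. QB_per (card (face m h))))"
  unfolding bij_betw_def
proof (intro conjI inj_onI equalityI subsetI)
  fix x y assume x: "x \<in> {x \<in> QB_per (perimeter m). Some m \<sqsubseteq>\<^sub>H Some x}"
    and y: "y \<in> {x \<in> QB_per (perimeter m). Some m \<sqsubseteq>\<^sub>H Some x}"
    and eq: "hole_contents m x = hole_contents m y"
  obtain f where f: "filled_by m (hole_contents m x) f x"
    using filled_by_hole_contents[OF m] x by blast
  obtain g where g: "filled_by m (hole_contents m y) g y"
    using filled_by_hole_contents[OF m] y by blast
  show "x = y"
    by (rule filled_by_same_content[OF m f g[folded eq]]) (use x y in \<open>auto simp: QB_per_def\<close>)
next
  fix w assume "w \<in> hole_contents m ` {x \<in> QB_per (perimeter m). Some m \<sqsubseteq>\<^sub>H Some x}"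
  then obtain x where x: "x \<in> QB" "Some m \<sqsubseteq>\<^sub>H Some x" "w = hole_contents m x"
    by (auto simp: QB_per_def)
  obtain f where f: "filled_by m w f x" using filled_by_hole_contents[OF m x(2)] x(3) by blast
  show "w \<in> Pi\<^sub>E (marks m) (\<lambda>h. QB_per (card (face m h)))"
    using filled_by_QB_content[OF f x(1)] filled_byD(2)[OF f] x(3)
    by (auto simp: QB_per_def hole_contents_def)
next
  fix w assume w: "w \<in> Pi\<^sub>E (marks m) (\<lambda>h. QB_per (card (face m h)))"
  obtain c f where c: "c \<in> QB" "filled_by m w f c" "perimeter c = perimeter m"
    by (rule filled_by_QB[OF m, of w]) (use PiE_mem[OF w] in \<open>auto simp: QB_per_def\<close>)
  have "hole_contents m c = w"
    using w by (auto simp: hole_contents_def filling_eq(1)[OF m c(2)] restrict_def fun_eq_iff PiE_def extensional_def)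
  moreover have "c \<in> {x \<in> QB_per (perimeter m). Some m \<sqsubseteq>\<^sub>H Some x}"
    using c by (auto simp: QB_per_def)
  ultimately show "w \<in> hole_contents m ` {x \<in> QB_per (perimeter m). Some m \<sqsubseteq>\<^sub>H Some x}"
    by blast
qed

lemma measurable_deco_maps:
  assumes "\<And>x. x \<in> QB \<Longrightarrow> g x \<in> measurable deco_alg N"
  shows "(\<lambda>p. g (fst p) (snd p)) \<in> measurable deco_maps N"
  by (rule measurable_compose_countable'[OF _ _ countable_QB])
    (use assms in \<open>auto simp: deco_maps_def\<close>)

section \<open>Boltzmann laws as measures, their integrals and their dependence on the boundary
  condition\<close>

locale boltzmann =
  fixes \<beta> q :: real and \<mu> :: "'v::{real_normed_vector, second_countable_topology} measure"
  assumes q: "q \<ge> 0" and sets_\<mu>: "sets \<mu> = sets borel" and sigma_finite: "sigma_finite_measure \<mu>"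
begin

sublocale P: product_sigma_finite "\<lambda>_. \<mu>"
  by (simp add: product_sigma_finite_def sigma_finite)

abbreviation "law \<equiv> boltzmann_law \<beta> q \<mu>"
abbreviation "weight \<equiv> boltzmann_weight \<beta> q \<mu>"
abbreviation "Z \<equiv> partition_function \<beta> q \<mu>"

lemma sets_PiM_\<mu>: "sets (PiM J (\<lambda>_. \<mu>)) = sets (PiM J (\<lambda>_. borel))"
  by (rule sets_PiM_cong) (simp_all add: sets_\<mu>)

lemma measurable_PiM_\<mu>: "measurable (PiM J (\<lambda>_. \<mu>)) N = measurable (PiM J (\<lambda>_. borel)) N"
  by (rule measurable_cong_sets) (simp_all add: sets_PiM_\<mu>)

lemma finite_faces_QB: "w \<in> QB \<Longrightarrow> finite (inner_faces w)"
  by (simp add: QB_iff QH0D(1) finite_inner_faces)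

lemma measurable_Pair_deco_maps:
  assumes "w \<in> QB"
  shows "(\<lambda>\<sigma>. (w, \<sigma>)) \<in> measurable (PiM (inner_faces w) (\<lambda>_. \<mu>)) deco_maps"
  unfolding deco_maps_def measurable_PiM_\<mu>
  using assms by (intro measurable_Pair measurable_const measurable_into_deco_alg)
    (auto simp: QB_iff dest: inner_faces_finite[OF QH0D(1)])

lemma borel_measurable_energy_PiM:
  "w \<in> QB \<Longrightarrow> energy \<beta> w b \<in> borel_measurable (PiM (inner_faces w) (\<lambda>_. \<mu>))"
  unfolding measurable_PiM_\<mu> by (rule borel_measurable_energy) simp_all

lemma borel_measurable_boltzmann_density:
  assumes w: "w \<in> QB" and F: "F \<in> borel_measurable deco_maps"
  shows "(\<lambda>\<sigma>. ennreal (exp (- energy \<beta> w b \<sigma>)) * F (w, \<sigma>)) \<in> borel_measurable (PiM (inner_faces w) (\<lambda>_. \<mu>))"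
  using borel_measurable_energy_PiM[OF w] measurable_compose[OF measurable_Pair_deco_maps[OF w] F]
  by (intro borel_measurable_times_ennreal measurable_compose[OF _ measurable_ennreal]
      measurable_compose[OF borel_measurable_uminus borel_measurable_exp]) simp_all

text \<open>The Boltzmann weight as a functional on test functions, before normalisation. Linearity
  and monotone convergence of this functional give both the countable additivity of the law and the
  formula for its integrals.\<close>

definition boltzmann_integral where
  "boltzmann_integral d b F = (\<integral>\<^sup>+ m. ennreal (q ^ card (inner_faces m)) *
     (\<integral>\<^sup>+ \<sigma>. ennreal (exp (- energy \<beta> m b \<sigma>)) * F (m, \<sigma>) \<partial>PiM (inner_faces m) (\<lambda>_. \<mu>)) \<partial>count_space (QB_per d))"

lemma weight_eq: "weight d b A = boltzmann_integral d b (indicator A)"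
  by (simp add: boltzmann_weight_def boltzmann_integral_def)

lemma QB_per_QB: "w \<in> QB_per d \<Longrightarrow> w \<in> QB"
  by (simp add: QB_per_def)

lemma boltzmann_integral_cong:
  assumes "\<And>x \<sigma>. x \<in> QB_per d \<Longrightarrow> \<sigma> \<in> space (PiM (inner_faces x) (\<lambda>_. \<mu>)) \<Longrightarrow> F (x, \<sigma>) = G (x, \<sigma>)"
  shows "boltzmann_integral d b F = boltzmann_integral d b G"
  unfolding boltzmann_integral_def
  by (intro nn_integral_cong arg_cong2[where f="(*)"] refl) (simp add: assms)

lemma boltzmann_integral_mono:
  assumes "\<And>x \<sigma>. x \<in> QB_per d \<Longrightarrow> F (x, \<sigma>) \<le> G (x, \<sigma>)"
  shows "boltzmann_integral d b F \<le> boltzmann_integral d b G"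
  unfolding boltzmann_integral_def
  by (intro nn_integral_mono mult_left_mono) (simp_all add: assms)

lemma space_deco_maps_QB_per:
  assumes "x \<in> QB_per d" "\<sigma> \<in> space (PiM (inner_faces x) (\<lambda>_. \<mu>))"
  shows "(x, \<sigma>) \<in> space deco_maps"
  using measurable_space[OF measurable_Pair_deco_maps[OF QB_per_QB[OF assms(1)]] assms(2)] .

lemma weight_space: "weight d b (space deco_maps) = Z d b"
  unfolding partition_function_def weight_eq
  by (rule boltzmann_integral_cong) (simp add: space_deco_maps_QB_per)

lemma weight_le: "weight d b A \<le> Z d b"
  unfolding partition_function_def weight_eq
  by (rule boltzmann_integral_mono) (simp add: indicator_def)

lemma boltzmann_integral_cmult:
  assumes F: "F \<in> borel_measurable deco_maps"
  shows "boltzmann_integral d b (\<lambda>p. c * F p) = c * boltzmann_integral d b F"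
proof -
  have "ennreal (q ^ card (inner_faces m)) *
     (\<integral>\<^sup>+ \<sigma>. ennreal (exp (- energy \<beta> m b \<sigma>)) * (c * F (m, \<sigma>)) \<partial>PiM (inner_faces m) (\<lambda>_. \<mu>)) =
    c * (ennreal (q ^ card (inner_faces m)) *
     (\<integral>\<^sup>+ \<sigma>. ennreal (exp (- energy \<beta> m b \<sigma>)) * F (m, \<sigma>) \<partial>PiM (inner_faces m) (\<lambda>_. \<mu>)))"
    if "m \<in> QB_per d" for m
    by (subst mult.left_commute[of c], subst nn_integral_cmult[symmetric],
        rule borel_measurable_boltzmann_density[OF QB_per_QB[OF that] F]) (simp add: mult_ac)
  then have "boltzmann_integral d b (\<lambda>p. c * F p) = (\<integral>\<^sup>+ m. c * (ennreal (q ^ card (inner_faces m)) *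
     (\<integral>\<^sup>+ \<sigma>. ennreal (exp (- energy \<beta> m b \<sigma>)) * F (m, \<sigma>) \<partial>PiM (inner_faces m) (\<lambda>_. \<mu>))) \<partial>count_space (QB_per d))"
    unfolding boltzmann_integral_def by (intro nn_integral_cong) simp
  also have "\<dots> = c * boltzmann_integral d b F"
    unfolding boltzmann_integral_def by (rule nn_integral_cmult) simp
  finally show ?thesis .
qed

lemma boltzmann_integral_add:
  assumes F: "F \<in> borel_measurable deco_maps" and G: "G \<in> borel_measurable deco_maps"
  shows "boltzmann_integral d b (\<lambda>p. F p + G p) = boltzmann_integral d b F + boltzmann_integral d b G"
proof -
  have "(\<integral>\<^sup>+ \<sigma>. ennreal (exp (- energy \<beta> m b \<sigma>)) * (F (m, \<sigma>) + G (m, \<sigma>)) \<partial>PiM (inner_faces m) (\<lambda>_. \<mu>)) =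
    (\<integral>\<^sup>+ \<sigma>. ennreal (exp (- energy \<beta> m b \<sigma>)) * F (m, \<sigma>) \<partial>PiM (inner_faces m) (\<lambda>_. \<mu>)) +
    (\<integral>\<^sup>+ \<sigma>. ennreal (exp (- energy \<beta> m b \<sigma>)) * G (m, \<sigma>) \<partial>PiM (inner_faces m) (\<lambda>_. \<mu>))"
    if "m \<in> QB_per d" for m
    unfolding distrib_left using QB_per_QB[OF that] F G
    by (intro nn_integral_add borel_measurable_boltzmann_density)
  then show ?thesis
    unfolding boltzmann_integral_def
    by (subst nn_integral_add[symmetric]) (auto intro!: nn_integral_cong simp: distrib_left)
qed

lemma boltzmann_integral_SUP:
  assumes U: "\<And>i. U i \<in> borel_measurable deco_maps" "incseq U"
  shows "boltzmann_integral d b (\<lambda>p. SUP i. U i p) = (SUP i. boltzmann_integral d b (U i))"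
proof -
  have inc: "U i p \<le> U j p" if "i \<le> j" for i j p
    by (rule le_funD[OF incseqD[OF U(2) that]])
  let ?I = "\<lambda>i m. \<integral>\<^sup>+ \<sigma>. ennreal (exp (- energy \<beta> m b \<sigma>)) * U i (m, \<sigma>) \<partial>PiM (inner_faces m) (\<lambda>_. \<mu>)"
  have "(\<integral>\<^sup>+ \<sigma>. ennreal (exp (- energy \<beta> m b \<sigma>)) * (SUP i. U i (m, \<sigma>)) \<partial>PiM (inner_faces m) (\<lambda>_. \<mu>)) =
    (SUP i. ?I i m)" if "m \<in> QB_per d" for m
    unfolding SUP_mult_left_ennreal using QB_per_QB[OF that] U(1)
    by (intro nn_integral_monotone_convergence_SUP borel_measurable_boltzmann_density)
      (auto simp: incseq_def le_fun_def intro!: mult_left_mono inc)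
  then have "boltzmann_integral d b (\<lambda>p. SUP i. U i p) =
    (\<integral>\<^sup>+ m. (SUP i. ennreal (q ^ card (inner_faces m)) * ?I i m) \<partial>count_space (QB_per d))"
    unfolding boltzmann_integral_def SUP_mult_left_ennreal[symmetric] by (intro nn_integral_cong) simp
  also have "\<dots> = (SUP i. boltzmann_integral d b (U i))"
    unfolding boltzmann_integral_def
    by (rule nn_integral_monotone_convergence_SUP)
      (auto simp: incseq_def le_fun_def intro!: mult_left_mono nn_integral_mono inc)
  finally show ?thesis .
qed

lemma sets_law [simp]: "sets (law d b) = sets deco_maps"
  and space_law [simp]: "space (law d b) = space deco_maps"
  by (simp_all add: boltzmann_law_def)

text \<open>\<open>measure_of\<close> takes the prescribed values once countable additivity is
  known. It follows from monotone convergence for partial sums of indicators, division by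
  \<open>Z\<close> being multiplication by a constant.\<close>

lemma emeasure_law:
  assumes A: "A \<in> sets deco_maps"
  shows "emeasure (law d b) A = weight d b A / Z d b"
proof (rule emeasure_measure_of[OF boltzmann_law_def])
  show "sets deco_maps \<subseteq> Pow (space deco_maps)" by (rule sets.space_closed)
  show "A \<in> sets (law d b)" using A by simp
  show "positive (sets (law d b)) (\<lambda>A. weight d b A / Z d b)"
    by (simp add: positive_def boltzmann_weight_def)
  show "countably_additive (sets (law d b)) (\<lambda>A. weight d b A / Z d b)"
  proof (rule countably_additiveI)
    fix S :: "nat \<Rightarrow> _" assume S: "range S \<subseteq> sets (law d b)" "disjoint_family S"
    have S': "indicator (S i) \<in> borel_measurable deco_maps" for i
      using S(1) by (intro borel_measurable_indicator) auto
    have sum: "(\<lambda>p. \<Sum>i<n. indicator (S i) p :: ennreal) \<in> borel_measurable deco_maps" for n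
      using S' by (rule borel_measurable_sum)
    have fin: "boltzmann_integral d b (\<lambda>p. \<Sum>i<n. indicator (S i) p) = (\<Sum>i<n. weight d b (S i))" for n
    proof (induction n)
      case 0 then show ?case by (simp add: boltzmann_integral_def)
    next
      case (Suc n)
      then show ?case by (simp add: boltzmann_integral_add[OF sum S'] weight_eq)
    qed
    have "weight d b (\<Union>i. S i) = boltzmann_integral d b (\<lambda>p. SUP n. \<Sum>i<n. indicator (S i) p)"
      unfolding weight_eq suminf_indicator[OF S(2), symmetric] suminf_eq_SUP ..
    also have "\<dots> = (SUP n. boltzmann_integral d b (\<lambda>p. \<Sum>i<n. indicator (S i) p))"
      by (rule boltzmann_integral_SUP[OF sum]) (auto simp: incseq_def le_fun_def intro!: sum_mono2)
    also have "\<dots> = (\<Sum>i. weight d b (S i))"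
      by (simp add: fin suminf_eq_SUP)
    finally show "(\<Sum>i. weight d b (S i) / Z d b) = weight d b (\<Union>i. S i) / Z d b"
      by (simp add: divide_ennreal_def)
  qed
qed

lemma nn_integral_law:
  assumes F: "F \<in> borel_measurable deco_maps"
  shows "(\<integral>\<^sup>+p. F p \<partial>law d b) = boltzmann_integral d b F / Z d b"
proof -
  have sb: "f \<in> borel_measurable (law d b) \<longleftrightarrow> f \<in> borel_measurable deco_maps" for f :: "_ \<Rightarrow> ennreal"
    by (simp add: measurable_def)
  have "F \<in> borel_measurable (law d b)" using F by (simp add: sb)
  then show ?thesis
  proof (induction rule: borel_measurable_induct)
    case (cong f g)
    have "boltzmann_integral d b f = boltzmann_integral d b g"
      using cong(3) by (intro boltzmann_integral_cong) (simp add: space_deco_maps_QB_per)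
    moreover have "integral\<^sup>N (law d b) f = integral\<^sup>N (law d b) g"
      using cong(3) by (intro nn_integral_cong) simp
    ultimately show ?case using cong(4) by simp
  next
    case (set A)
    then show ?case by (simp add: emeasure_law weight_eq)
  next
    case (mult u c)
    then show ?case
      by (simp add: nn_integral_cmult boltzmann_integral_cmult sb divide_ennreal_def mult.assoc)
  next
    case (add u v)
    then show ?case
      by (simp add: nn_integral_add boltzmann_integral_add sb divide_ennreal_def distrib_right)
  next
    case (seq U)
    have "integral\<^sup>N (law d b) (\<lambda>p. SUP i. U i p) = (SUP i. integral\<^sup>N (law d b) (U i))"
      using seq by (intro nn_integral_monotone_convergence_SUP) auto
    also have "\<dots> = (SUP i. boltzmann_integral d b (U i)) / Z d b"
      by (simp add: seq divide_ennreal_def SUP_mult_right_ennreal)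
    also have "(SUP i. boltzmann_integral d b (U i)) = boltzmann_integral d b (\<lambda>p. SUP i. U i p)"
      using seq by (intro boltzmann_integral_SUP[symmetric]) (auto simp: sb)
    finally show ?case by (simp add: SUP_apply[abs_def])
  qed
qed

text \<open>The boundary condition of a hole is random, so the laws have to form a kernel. The
  weight is a countable sum over maps of integrals with a parameter, each measurable by
  Fubini.\<close>

lemma borel_measurable_weight:
  assumes bc: "\<And>i. (\<lambda>\<omega>. bc \<omega> i) \<in> borel_measurable N" and B: "B \<in> sets deco_maps"
  shows "(\<lambda>\<omega>. weight d (bc \<omega>) B) \<in> borel_measurable N"
proof -
  interpret C: sigma_finite_measure "count_space (QB_per d)"
    by (rule sigma_finite_measure_count_space_countable[OF countable_QB_per])
  let ?g = "\<lambda>m \<omega>. ennreal (q ^ card (inner_faces m)) *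
     (\<integral>\<^sup>+ \<sigma>. ennreal (exp (- energy \<beta> m (bc \<omega>) \<sigma>)) * indicator B (m, \<sigma>) \<partial>PiM (inner_faces m) (\<lambda>_. \<mu>))"
  have g: "?g m \<in> borel_measurable N" if m: "m \<in> QB_per d" for m
  proof -
    interpret S: sigma_finite_measure "PiM (inner_faces m) (\<lambda>_. \<mu>)"
      by (rule P.sigma_finite[OF finite_faces_QB[OF QB_per_QB[OF m]]])
    let ?N = "N \<Otimes>\<^sub>M PiM (inner_faces m) (\<lambda>_. \<mu>)"
    have snd: "snd \<in> measurable ?N (PiM (inner_faces m) (\<lambda>_. borel))"
      using measurable_snd[of N "PiM (inner_faces m) (\<lambda>_. \<mu>)"]
      by (simp add: measurable_cong_sets[OF refl sets_PiM_\<mu>])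
    have "(\<lambda>p. energy \<beta> m (bc (fst p)) (snd p)) \<in> borel_measurable ?N"
      by (rule borel_measurable_energy[OF QB_per_QB[OF m] measurable_compose[OF measurable_fst bc] snd])
    moreover have "(\<lambda>p. indicator B (m, snd p) :: ennreal) \<in> borel_measurable ?N"
      using measurable_compose[OF measurable_compose[OF measurable_snd measurable_Pair_deco_maps[OF QB_per_QB[OF m]]]
          borel_measurable_indicator[OF B]] .
    ultimately have "(\<lambda>p. ennreal (exp (- energy \<beta> m (bc (fst p)) (snd p))) * indicator B (m, snd p)) \<in> borel_measurable ?N"
      by (intro borel_measurable_times_ennreal measurable_compose[OF _ measurable_ennreal]
        measurable_compose[OF borel_measurable_uminus borel_measurable_exp]) simp_all
    then show ?thesis
      by (intro borel_measurable_times_ennreal borel_measurable_const S.borel_measurable_nn_integral)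
        (simp add: split_beta')
  qed
  have "(\<lambda>p. ?g (snd p) (fst p)) \<in> borel_measurable (N \<Otimes>\<^sub>M count_space (QB_per d))"
    by (rule measurable_compose_countable'[OF measurable_compose[OF measurable_fst g] measurable_snd countable_QB_per])
  then show ?thesis
    unfolding boltzmann_weight_def
    by (intro C.borel_measurable_nn_integral) (simp add: split_beta')
qed

lemma borel_measurable_emeasure_law:
  assumes bc: "\<And>i. (\<lambda>\<omega>. bc \<omega> i) \<in> borel_measurable N" and B: "B \<in> sets deco_maps"
  shows "(\<lambda>\<omega>. emeasure (law d (bc \<omega>)) B) \<in> borel_measurable N"
  unfolding emeasure_law[OF B] weight_space[symmetric]
  by (intro borel_measurable_divide_ennreal borel_measurable_weight bc B sets.top)

end

section \<open>Factorisation of the Boltzmann weight over the holes of a submap\<close>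

lemma ennreal_exp_uminus_sum:
  assumes "finite H"
  shows "ennreal (exp (- (a + sum e H))) = ennreal (exp (- a)) * (\<Prod>h\<in>H. ennreal (exp (- e h)))"
proof -
  have "exp (- (a + sum e H)) = exp (- a) * (\<Prod>h\<in>H. exp (- e h))"
    by (simp only: minus_add_distrib exp_add sum_negf[symmetric] exp_sum[OF assms])
  then show ?thesis by (simp add: ennreal_mult prod_ennreal prod_nonneg)
qed

context boltzmann
begin

text \<open>The number of faces and the energy are additive under gluing, and the reference measure
  is a product. Since maps containing \<open>m\<close> correspond to free choices of the contents,
  the total for a fixed decoration of \<open>m\<close> is a product of one weight per hole.\<close>

lemma boltzmann_integral_submap:
  assumes m: "m \<in> QH0" and d: "d = perimeter m"
    and A: "A \<in> borel_measurable (PiM (inner_faces m) (\<lambda>_. borel))"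
    and B: "\<And>h. h \<in> marks m \<Longrightarrow> B h \<in> sets deco_maps"
  shows "boltzmann_integral d b (\<lambda>p. if Some m \<sqsubseteq>\<^sub>H Some (fst p) then A (restr (Some m) (fst p) (snd p)) *
      (\<Prod>h\<in>marks m. indicator (B h) (content (Some m) (fst p) h, content_deco (Some m) (fst p) (snd p) h)) else 0) =
    (\<integral>\<^sup>+\<tau>. ennreal (q ^ card (inner_faces m)) * ennreal (exp (- outer_energy \<beta> m b \<tau>)) * A \<tau> *
      (\<Prod>h\<in>marks m. weight (card (face m h)) (hole_bc b (Some m) \<tau> h) (B h)) \<partial>PiM (inner_faces m) (\<lambda>_. \<mu>))"
    (is "boltzmann_integral d b ?F = (\<integral>\<^sup>+\<tau>. ?R \<tau> \<partial>_)")
proof -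
  let ?bc = "hole_bc b (Some m)"
  let ?W = "\<lambda>h. QB_per (card (face m h))"
  note pl = QH0D(1)[OF m]
  have finm: "finite (marks m)"
    using QH0D(2)[OF m] planar_map_permutation(1)[OF pl] finite_subset by blast
  define A' where "A' \<tau> = ennreal (exp (- outer_energy \<beta> m b \<tau>)) * A \<tau>" for \<tau>
  define k where "k h w \<tau> s = ennreal (exp (- energy \<beta> w (?bc \<tau> h) s)) * indicator (B h) (w, s)" for h w \<tau> s
  \<comment> \<open>The contribution of a map containing \<open>m\<close>, expressed through its
    contents \<open>w\<close> alone.\<close>
  define G where "G w = ennreal (q ^ card (inner_faces m)) *
    (\<Prod>h\<in>marks m. ennreal (q ^ card (inner_faces (w h)))) *
    (\<integral>\<^sup>+\<tau>. A' \<tau> * (\<Prod>h\<in>marks m. \<integral>\<^sup>+s. k h (w h) \<tau> s \<partial>PiM (inner_faces (w h)) (\<lambda>_. \<mu>)) \<partial>PiM (inner_faces m) (\<lambda>_. \<mu>))" for w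
  have A'm: "A' \<in> borel_measurable (PiM (inner_faces m) (\<lambda>_. \<mu>))"
    unfolding A'_def measurable_PiM_\<mu> using A borel_measurable_outer_energy[of \<beta> m b]
    by (intro borel_measurable_times_ennreal measurable_compose[OF _ measurable_ennreal]
        measurable_compose[OF borel_measurable_uminus borel_measurable_exp]) simp_all
  have bcm: "(\<lambda>\<tau>. ?bc \<tau> h i) \<in> borel_measurable (PiM (inner_faces m) (\<lambda>_. \<mu>))" if "h \<in> marks m" for h i
    using borel_measurable_hole_bc[of "Some m" h b i] m that by (simp add: QH_def measurable_PiM_\<mu>)
  have km: "case_prod (k h w) \<in> borel_measurable (PiM (inner_faces m) (\<lambda>_. \<mu>) \<Otimes>\<^sub>M PiM (inner_faces w) (\<lambda>_. \<mu>))"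
    if h: "h \<in> marks m" and w: "w \<in> QB" for h w
  proof -
    let ?N = "PiM (inner_faces m) (\<lambda>_. \<mu>) \<Otimes>\<^sub>M PiM (inner_faces w) (\<lambda>_. \<mu>)"
    have snd: "snd \<in> measurable ?N (PiM (inner_faces w) (\<lambda>_. borel))"
      using measurable_snd[of "PiM (inner_faces m) (\<lambda>_. \<mu>)" "PiM (inner_faces w) (\<lambda>_. \<mu>)"]
      by (simp add: measurable_cong_sets[OF refl sets_PiM_\<mu>])
    have "(\<lambda>p. energy \<beta> w (?bc (fst p) h) (snd p)) \<in> borel_measurable ?N"
      by (rule borel_measurable_energy[OF w measurable_compose[OF measurable_fst bcm[OF h]] snd])
    moreover have "(\<lambda>p. indicator (B h) (w, snd p) :: ennreal) \<in> borel_measurable ?N"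
      using measurable_compose[OF measurable_compose[OF measurable_snd measurable_Pair_deco_maps[OF w]]
          borel_measurable_indicator[OF B[OF h]]] .
    ultimately show ?thesis
      unfolding k_def split_beta'
      by (intro borel_measurable_times_ennreal measurable_compose[OF _ measurable_ennreal]
        measurable_compose[OF borel_measurable_uminus borel_measurable_exp]) simp_all
  qed
  have point: "ennreal (q ^ card (inner_faces x)) *
      (\<integral>\<^sup>+\<sigma>. ennreal (exp (- energy \<beta> x b \<sigma>)) * ?F (x, \<sigma>) \<partial>PiM (inner_faces x) (\<lambda>_. \<mu>)) = G (hole_contents m x)"
    if x: "x \<in> QB" and mx: "Some m \<sqsubseteq>\<^sub>H Some x" for x
  proof -
    let ?w = "hole_contents m x"
    obtain f where F: "filled_by m ?w f x" by (rule filled_by_hole_contents[OF m mx])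
    have wQ: "?w h \<in> QB" if "h \<in> marks m" for h by (rule filled_by_QB_content[OF F x that])
    let ?\<tau> = "\<lambda>\<sigma>. \<lambda>i\<in>inner_faces m. \<sigma> (glued_face f (Inl i))"
    let ?s = "\<lambda>\<sigma> h. \<lambda>j\<in>inner_faces (?w h). \<sigma> (glued_face f (Inr (h, j)))"
    have r: "restr (Some m) x \<sigma> = ?\<tau> \<sigma>" for \<sigma> :: "'v deco"
      by (simp only: restr_eq[OF m F] glued_face_simps)
    have c: "content_deco (Some m) x \<sigma> h = ?s \<sigma> h" if "h \<in> marks m" for \<sigma> :: "'v deco" and h
      by (simp only: content_deco_eq[OF m F that] glued_face_simps)
    have integrand: "ennreal (exp (- energy \<beta> x b \<sigma>)) * ?F (x, \<sigma>) =
      A' (?\<tau> \<sigma>) * (\<Prod>h\<in>marks m. k h (?w h) (?\<tau> \<sigma>) (?s \<sigma> h))" for \<sigma>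
    proof -
      have "energy \<beta> x b \<sigma> = outer_energy \<beta> m b (?\<tau> \<sigma>) +
          (\<Sum>h\<in>marks m. energy \<beta> (?w h) (?bc (?\<tau> \<sigma>) h) (?s \<sigma> h))"
        unfolding energy_glued[OF m F x] r
        by (intro arg_cong2[where f="(+)"] sum.cong refl) (simp only: c)
      then have "ennreal (exp (- energy \<beta> x b \<sigma>)) = ennreal (exp (- outer_energy \<beta> m b (?\<tau> \<sigma>))) *
          (\<Prod>h\<in>marks m. ennreal (exp (- energy \<beta> (?w h) (?bc (?\<tau> \<sigma>) h) (?s \<sigma> h))))"
        by (simp only: ennreal_exp_uminus_sum[OF finm])
      moreover have "?F (x, \<sigma>) = A (?\<tau> \<sigma>) * (\<Prod>h\<in>marks m. indicator (B h) (?w h, ?s \<sigma> h))"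
      proof -
        have "?F (x, \<sigma>) = A (?\<tau> \<sigma>) * (\<Prod>h\<in>marks m. indicator (B h) (content (Some m) x h, content_deco (Some m) x \<sigma> h))"
          using mx by (simp only: fst_conv snd_conv if_True r)
        also have "(\<Prod>h\<in>marks m. indicator (B h) (content (Some m) x h, content_deco (Some m) x \<sigma> h)) =
            (\<Prod>h\<in>marks m. indicator (B h) (?w h, ?s \<sigma> h) :: ennreal)"
          by (intro prod.cong refl) (simp only: c content_eq[OF m F])
        finally show ?thesis .
      qed
      ultimately show ?thesis
        by (simp only: A'_def k_def prod.distrib) (simp only: mult_ac)
    qed
    have "(\<integral>\<^sup>+\<sigma>. ennreal (exp (- energy \<beta> x b \<sigma>)) * ?F (x, \<sigma>) \<partial>PiM (inner_faces x) (\<lambda>_. \<mu>)) =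
      (\<integral>\<^sup>+\<tau>. A' \<tau> * (\<Prod>h\<in>marks m. \<integral>\<^sup>+s. k h (?w h) \<tau> s \<partial>PiM (inner_faces (?w h)) (\<lambda>_. \<mu>)) \<partial>PiM (inner_faces m) (\<lambda>_. \<mu>))"
      unfolding integrand
      by (rule nn_integral_PiM_Plus_Sigma[OF sigma_finite finite_inner_faces[OF pl] finm finite_faces_QB[OF wQ]
            bij_betw_glued_face[OF m F] A'm km[OF _ wQ]])
    moreover have "ennreal (q ^ card (inner_faces x)) = ennreal (q ^ card (inner_faces m)) *
        (\<Prod>h\<in>marks m. ennreal (q ^ card (inner_faces (?w h))))"
      using q by (simp add: card_inner_faces_glued[OF m F] power_add power_sum ennreal_mult prod_ennreal prod_nonneg)
    ultimately show ?thesis unfolding G_def by simp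
  qed
  let ?S = "{x \<in> QB_per d. Some m \<sqsubseteq>\<^sub>H Some x}"
  have "boltzmann_integral d b ?F = (\<integral>\<^sup>+x. ennreal (q ^ card (inner_faces x)) *
      (\<integral>\<^sup>+\<sigma>. ennreal (exp (- energy \<beta> x b \<sigma>)) * ?F (x, \<sigma>) \<partial>PiM (inner_faces x) (\<lambda>_. \<mu>)) \<partial>count_space ?S)"
    unfolding boltzmann_integral_def by (rule nn_integral_count_space_eq) auto
  also have "\<dots> = (\<integral>\<^sup>+x. G (hole_contents m x) \<partial>count_space ?S)"
    by (rule nn_integral_cong, rule point) (auto simp: QB_per_def)
  also have "\<dots> = (\<integral>\<^sup>+w. G w \<partial>count_space (Pi\<^sub>E (marks m) ?W))"
    by (rule nn_integral_bij_count_space[OF bij_betw_hole_contents[OF m, folded d]])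
  also have "\<dots> = (\<integral>\<^sup>+w. \<integral>\<^sup>+\<tau>. ennreal (q ^ card (inner_faces m)) * A' \<tau> *
      (\<Prod>h\<in>marks m. ennreal (q ^ card (inner_faces (w h))) *
        (\<integral>\<^sup>+s. k h (w h) \<tau> s \<partial>PiM (inner_faces (w h)) (\<lambda>_. \<mu>))) \<partial>PiM (inner_faces m) (\<lambda>_. \<mu>)
      \<partial>count_space (Pi\<^sub>E (marks m) ?W))"
  proof (rule nn_integral_cong)
    fix w assume "w \<in> space (count_space (Pi\<^sub>E (marks m) ?W))"
    then have w: "w h \<in> QB" if "h \<in> marks m" for h using that by (auto simp: QB_per_def)
    have "(\<lambda>\<tau>. \<integral>\<^sup>+s. k h (w h) \<tau> s \<partial>PiM (inner_faces (w h)) (\<lambda>_. \<mu>)) \<in> borel_measurable (PiM (inner_faces m) (\<lambda>_. \<mu>))"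
      if "h \<in> marks m" for h
      using km[OF that w[OF that]]
      by (rule sigma_finite_measure.borel_measurable_nn_integral[OF P.sigma_finite[OF finite_faces_QB[OF w[OF that]]]])
    then have "(\<lambda>\<tau>. A' \<tau> * (\<Prod>h\<in>marks m. \<integral>\<^sup>+s. k h (w h) \<tau> s \<partial>PiM (inner_faces (w h)) (\<lambda>_. \<mu>))) \<in>
        borel_measurable (PiM (inner_faces m) (\<lambda>_. \<mu>))"
      using A'm by (intro borel_measurable_times_ennreal borel_measurable_prod_ennreal)
    then show "G w = (\<integral>\<^sup>+\<tau>. ennreal (q ^ card (inner_faces m)) * A' \<tau> *
      (\<Prod>h\<in>marks m. ennreal (q ^ card (inner_faces (w h))) *
        (\<integral>\<^sup>+s. k h (w h) \<tau> s \<partial>PiM (inner_faces (w h)) (\<lambda>_. \<mu>))) \<partial>PiM (inner_faces m) (\<lambda>_. \<mu>))"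
      unfolding G_def by (subst nn_integral_cmult[symmetric]) (simp_all add: prod.distrib mult_ac)
  qed
  \<comment> \<open>The sum over contents is moved inside the integral: for fixed
    \<open>\<tau>\<close> it is a sum of products over families and becomes a product of
    sums.\<close>
  also have "\<dots> = (\<integral>\<^sup>+\<tau>. \<integral>\<^sup>+w. ennreal (q ^ card (inner_faces m)) * A' \<tau> *
      (\<Prod>h\<in>marks m. ennreal (q ^ card (inner_faces (w h))) *
        (\<integral>\<^sup>+s. k h (w h) \<tau> s \<partial>PiM (inner_faces (w h)) (\<lambda>_. \<mu>)))
      \<partial>count_space (Pi\<^sub>E (marks m) ?W) \<partial>PiM (inner_faces m) (\<lambda>_. \<mu>))"
  proof (rule nn_integral_count_space_nn_integral[symmetric])
    show "countable (Pi\<^sub>E (marks m) ?W)" by (intro countable_PiE finm countable_QB_per)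
    fix w assume "w \<in> Pi\<^sub>E (marks m) ?W"
    then have w: "w h \<in> QB" if "h \<in> marks m" for h using that by (auto simp: QB_per_def)
    have "(\<lambda>\<tau>. \<integral>\<^sup>+s. k h (w h) \<tau> s \<partial>PiM (inner_faces (w h)) (\<lambda>_. \<mu>)) \<in> borel_measurable (PiM (inner_faces m) (\<lambda>_. \<mu>))"
      if "h \<in> marks m" for h
      using km[OF that w[OF that]]
      by (rule sigma_finite_measure.borel_measurable_nn_integral[OF P.sigma_finite[OF finite_faces_QB[OF w[OF that]]]])
    then show "(\<lambda>\<tau>. ennreal (q ^ card (inner_faces m)) * A' \<tau> * (\<Prod>h\<in>marks m. ennreal (q ^ card (inner_faces (w h))) *
        (\<integral>\<^sup>+s. k h (w h) \<tau> s \<partial>PiM (inner_faces (w h)) (\<lambda>_. \<mu>)))) \<in> borel_measurable (PiM (inner_faces m) (\<lambda>_. \<mu>))"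
      using A'm by (intro borel_measurable_times_ennreal borel_measurable_prod_ennreal borel_measurable_const)
  qed
  also have "\<dots> = (\<integral>\<^sup>+\<tau>. ?R \<tau> \<partial>PiM (inner_faces m) (\<lambda>_. \<mu>))"
  proof (rule nn_integral_cong)
    fix \<tau>
    have "(\<integral>\<^sup>+w. (\<Prod>h\<in>marks m. ennreal (q ^ card (inner_faces (w h))) *
        (\<integral>\<^sup>+s. k h (w h) \<tau> s \<partial>PiM (inner_faces (w h)) (\<lambda>_. \<mu>))) \<partial>count_space (Pi\<^sub>E (marks m) ?W)) =
      (\<Prod>h\<in>marks m. weight (card (face m h)) (?bc \<tau> h) (B h))"
      using nn_integral_count_space_PiE_prod[OF finm countable_QB_per,
          where g="\<lambda>h w. ennreal (q ^ card (inner_faces w)) * (\<integral>\<^sup>+s. k h w \<tau> s \<partial>PiM (inner_faces w) (\<lambda>_. \<mu>))"]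
      unfolding boltzmann_weight_def k_def .
    then show "(\<integral>\<^sup>+w. ennreal (q ^ card (inner_faces m)) * A' \<tau> *
      (\<Prod>h\<in>marks m. ennreal (q ^ card (inner_faces (w h))) *
        (\<integral>\<^sup>+s. k h (w h) \<tau> s \<partial>PiM (inner_faces (w h)) (\<lambda>_. \<mu>)))
      \<partial>count_space (Pi\<^sub>E (marks m) ?W)) = ?R \<tau>"
      by (subst nn_integral_cmult) (simp_all add: A'_def mult.assoc)
  qed
  finally show ?thesis .
qed

text \<open>If some partition function is zero, both sides vanish; otherwise a finite product has
  finite factors and each factor can be normalised. The finiteness is assumed of the product, which
  is what integrability provides: an infinite factor can hide behind a zero one.\<close>

lemma prod_weight_eq:
  assumes "finite H" and "(\<Prod>h\<in>H. Z (d h) (b h)) \<noteq> \<infinity>" and "\<And>h. h \<in> H \<Longrightarrow> B h \<in> sets deco_maps"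
  shows "(\<Prod>h\<in>H. weight (d h) (b h) (B h)) =
    (\<Prod>h\<in>H. emeasure (law (d h) (b h)) (B h)) * (\<Prod>h\<in>H. Z (d h) (b h))"
proof (cases "\<exists>h\<in>H. Z (d h) (b h) = 0")
  case True
  then obtain h where h: "h \<in> H" "Z (d h) (b h) = 0" by blast
  then have "weight (d h) (b h) (B h) = 0" using weight_le[of "d h" "b h" "B h"] by simp
  then have "(\<Prod>h\<in>H. weight (d h) (b h) (B h)) = 0" "(\<Prod>h\<in>H. Z (d h) (b h)) = 0"
    using h assms(1) by (auto intro!: prod_zero)
  then show ?thesis by (simp only: mult_zero_right)
next
  case False
  have fin: "Z (d h) (b h) \<noteq> \<infinity>" if "h \<in> H" for h
    using assms(1,2) False that by (auto simp: ennreal_prod_eq_top)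
  have "weight (d h) (b h) (B h) = emeasure (law (d h) (b h)) (B h) * Z (d h) (b h)" if h: "h \<in> H" for h
    using False fin[OF h] h emeasure_law[OF assms(3)[OF h]]
    by (metis ennreal_divide_times ennreal_divide_self mult.right_neutral top.not_eq_extremum infinity_ennreal_def)
  then show ?thesis by (simp add: prod.distrib[symmetric])
qed

text \<open>
  The weight of a map containing \<open>m\<close> factorises over the holes of \<open>m\<close>, so conditioning on
  the part in \<open>m\<close> amounts to dividing by the partition functions of the holes.  These are finite
  almost everywhere because the total partition function is.
\<close>

lemma law_markov:
  assumes law: "prob_space (law d b)" and m: "m \<in> QH"
    and A: "A \<in> borel_measurable (PiM (inner_faces_H m) (\<lambda>_. borel))"
    and B: "\<And>h. h \<in> holes m \<Longrightarrow> B h \<in> sets deco_maps"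
  shows "(\<integral>\<^sup>+p. (if m \<sqsubseteq>\<^sub>H Some (fst p) then A (restr m (fst p) (snd p)) *
      (\<Prod>h\<in>holes m. indicator (B h) (content m (fst p) h, content_deco m (fst p) (snd p) h)) else 0) \<partial>law d b) =
    (\<integral>\<^sup>+p. (if m \<sqsubseteq>\<^sub>H Some (fst p) then A (restr m (fst p) (snd p)) *
      (\<Prod>h\<in>holes m. emeasure (law (hole_per d m h) (hole_bc b m (restr m (fst p) (snd p)) h)) (B h)) else 0) \<partial>law d b)"
proof (cases m)
  case None
  then show ?thesis
    using B prob_space.emeasure_space_1[OF law]
    by (simp add: nn_integral_cmult_indicator)
next
  case (Some m0)
  then have Q: "m0 \<in> QH0" using m by (auto simp: QH_def)
  note pl = QH0D(1)[OF Q]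
  have finm: "finite (marks m0)"
    using QH0D(2)[OF Q] planar_map_permutation(1)[OF pl] finite_subset by blast
  let ?L = "\<lambda>\<tau> h. emeasure (law (card (face m0 h)) (hole_bc b m \<tau> h)) (B h)"
  let ?A = "\<lambda>\<tau>. A \<tau> * (\<Prod>h\<in>marks m0. ?L \<tau> h)"
  define F where "F A B p = (if m \<sqsubseteq>\<^sub>H Some (fst p) then A (restr m (fst p) (snd p)) *
      (\<Prod>h\<in>marks m0. indicator (B h) (content m (fst p) h, content_deco m (fst p) (snd p) h)) else 0 :: ennreal)"
    for A and B :: "nat \<Rightarrow> (nat hmap \<times> 'v deco) set" and p
  have Bm: "B h \<in> sets deco_maps" if "h \<in> marks m0" for h using B[of h] that Some by simp
  have Am: "A \<in> borel_measurable (PiM (inner_faces m0) (\<lambda>_. borel))" using A Some by simp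
  have bcm: "(\<lambda>\<tau>. hole_bc b m \<tau> h i) \<in> borel_measurable (PiM (inner_faces m0) (\<lambda>_. borel))" if "h \<in> marks m0" for h i
    using borel_measurable_hole_bc[OF m, of h b i] that Some by simp
  have A'm: "?A \<in> borel_measurable (PiM (inner_faces m0) (\<lambda>_. borel))"
    by (intro borel_measurable_times_ennreal borel_measurable_prod_ennreal Am borel_measurable_emeasure_law bcm Bm)
  have Fm: "F A B \<in> borel_measurable deco_maps"
    if A: "A \<in> borel_measurable (PiM (inner_faces m0) (\<lambda>_. borel))" and B: "\<And>h. h \<in> marks m0 \<Longrightarrow> B h \<in> sets deco_maps"
    for A B
    unfolding F_def
  proof (rule measurable_deco_maps)
    fix x assume x: "x \<in> QB"
    show "(\<lambda>\<sigma>. if m \<sqsubseteq>\<^sub>H Some x then A (restr m x \<sigma>) *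
      (\<Prod>h\<in>marks m0. indicator (B h) (content m x h, content_deco m x \<sigma> h)) else 0) \<in> borel_measurable deco_alg"
    proof (cases "m \<sqsubseteq>\<^sub>H Some x")
      case True
      have "(\<lambda>\<sigma>. A (restr m x \<sigma>)) \<in> borel_measurable deco_alg"
        using measurable_compose[OF measurable_restr_deco_alg[OF m x]] A Some by simp
      moreover have "(\<lambda>\<sigma>. indicator (B h) (content m x h, content_deco m x \<sigma> h) :: ennreal) \<in> borel_measurable deco_alg"
        if h: "h \<in> marks m0" for h
      proof -
        have "(\<lambda>\<sigma>. (content m x h, content_deco m x \<sigma> h)) \<in> measurable deco_alg deco_maps"
          unfolding deco_maps_def
          using content_QB[OF m x True] measurable_content_deco[OF m x True] h Some
          by (intro measurable_Pair measurable_const) auto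
        from measurable_compose[OF this borel_measurable_indicator[OF B[OF h]]] show ?thesis .
      qed
      ultimately show ?thesis
        using True by (simp add: borel_measurable_times_ennreal borel_measurable_prod_ennreal)
    qed simp
  qed
  have Sm: "space deco_maps \<in> sets (deco_maps :: (nat hmap \<times> 'v deco) measure)" by (rule sets.top)
  have "boltzmann_integral d b (F A B) = boltzmann_integral d b (F ?A (\<lambda>_. space deco_maps))"
  proof (cases "d = perimeter m0")
    case True
    let ?c = "\<lambda>\<tau>. ennreal (q ^ card (inner_faces m0)) * ennreal (exp (- outer_energy \<beta> m0 b \<tau>))"
    let ?Z = "\<lambda>\<tau> h. Z (card (face m0 h)) (hole_bc b m \<tau> h)"
    have I: "boltzmann_integral d b (F A B) = (\<integral>\<^sup>+\<tau>. ?c \<tau> * A \<tau> *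
        (\<Prod>h\<in>marks m0. weight (card (face m0 h)) (hole_bc b m \<tau> h) (B h)) \<partial>PiM (inner_faces m0) (\<lambda>_. \<mu>))"
      if "A \<in> borel_measurable (PiM (inner_faces m0) (\<lambda>_. borel))" "\<And>h. h \<in> marks m0 \<Longrightarrow> B h \<in> sets deco_maps"
      for A B
      using boltzmann_integral_submap[OF Q True that] unfolding F_def Some .
    have one: "(\<lambda>_. 1 :: ennreal) \<in> borel_measurable (PiM (inner_faces m0) (\<lambda>_. borel :: 'v measure))" by simp
    \<comment> \<open>The trivial test function with trivial events gives the mass of the maps
      containing \<open>m\<close>, which is at most \<open>Z d b\<close>. Its finiteness bounds the
      product of the partition functions of the holes almost everywhere where \<open>?c\<close> is
      nonzero.\<close>
    have "(\<integral>\<^sup>+\<tau>. ?c \<tau> * (\<Prod>h\<in>marks m0. ?Z \<tau> h) \<partial>PiM (inner_faces m0) (\<lambda>_. \<mu>)) =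
        boltzmann_integral d b (F (\<lambda>_. 1) (\<lambda>_. space deco_maps))"
      using I[OF one Sm] by (simp add: weight_space)
    also have "\<dots> \<le> Z d b"
      unfolding partition_function_def weight_eq
      by (rule boltzmann_integral_mono) (auto simp: F_def indicator_def intro!: prod_le_1)
    also have "Z d b < \<infinity>"
    proof -
      \<comment> \<open>Being a probability law forces \<open>Z d b\<close> to be finite, since a
        quotient by infinity is zero in \<open>ennreal\<close>.\<close>
      have "weight d b (space deco_maps) / Z d b = 1"
        using prob_space.emeasure_space_1[OF law] emeasure_law[OF Sm] by simp
      then show ?thesis by (cases "Z d b = \<top>") (auto simp: weight_space less_top divide_ennreal_def)
    qed
    finally have fin: "(\<integral>\<^sup>+\<tau>. ?c \<tau> * (\<Prod>h\<in>marks m0. ?Z \<tau> h) \<partial>PiM (inner_faces m0) (\<lambda>_. \<mu>)) \<noteq> \<infinity>" by simp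
    have "(\<lambda>\<tau>. ?c \<tau> * (\<Prod>h\<in>marks m0. ?Z \<tau> h)) \<in> borel_measurable (PiM (inner_faces m0) (\<lambda>_. \<mu>))"
      unfolding measurable_PiM_\<mu> weight_space[symmetric]
      using borel_measurable_outer_energy[of \<beta> m0 b] bcm Sm
      by (intro borel_measurable_times_ennreal borel_measurable_prod_ennreal borel_measurable_weight
        measurable_compose[OF _ measurable_ennreal] measurable_compose[OF borel_measurable_uminus borel_measurable_exp])
        simp_all
    from nn_integral_PInf_AE[OF this fin]
    have "AE \<tau> in PiM (inner_faces m0) (\<lambda>_. \<mu>). ?c \<tau> * A \<tau> * (\<Prod>h\<in>marks m0. weight (card (face m0 h)) (hole_bc b m \<tau> h) (B h)) =
        ?c \<tau> * ?A \<tau> * (\<Prod>h\<in>marks m0. weight (card (face m0 h)) (hole_bc b m \<tau> h) (space deco_maps))"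
    proof eventually_elim
      case (elim \<tau>)
      show ?case
      \<comment> \<open>\<open>?c \<tau>\<close> vanishes when \<open>q = 0\<close> and
        \<open>m0\<close> has interior faces; both integrands are then zero.\<close>
      proof (cases "?c \<tau> = 0")
        case False
        then have "(\<Prod>h\<in>marks m0. ?Z \<tau> h) \<noteq> \<infinity>"
          using elim by (auto simp: ennreal_mult_eq_top_iff)
        from prod_weight_eq[OF finm this Bm] show ?thesis
          by (simp add: weight_space mult.assoc)
      qed simp
    qed
    then have "(\<integral>\<^sup>+\<tau>. ?c \<tau> * A \<tau> * (\<Prod>h\<in>marks m0. weight (card (face m0 h)) (hole_bc b m \<tau> h) (B h)) \<partial>PiM (inner_faces m0) (\<lambda>_. \<mu>)) =
        (\<integral>\<^sup>+\<tau>. ?c \<tau> * ?A \<tau> * (\<Prod>h\<in>marks m0. weight (card (face m0 h)) (hole_bc b m \<tau> h) (space deco_maps)) \<partial>PiM (inner_faces m0) (\<lambda>_. \<mu>))"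
      by (rule nn_integral_cong_AE)
    moreover have "boltzmann_integral d b (F A B) = (\<integral>\<^sup>+\<tau>. ?c \<tau> * A \<tau> *
        (\<Prod>h\<in>marks m0. weight (card (face m0 h)) (hole_bc b m \<tau> h) (B h)) \<partial>PiM (inner_faces m0) (\<lambda>_. \<mu>))"
      by (rule I[OF Am Bm])
    ultimately show ?thesis
      using I[OF A'm Sm] by simp
  next
    \<comment> \<open>Filling preserves the perimeter, so no map of another perimeter contains
      \<open>m\<close> and both integrals vanish.\<close>
    case False
    have "\<not> m \<sqsubseteq>\<^sub>H Some x" if "x \<in> QB_per d" for x
      using that False filled_by_perimeter[OF Q] by (auto simp: QB_per_def Some)
    then show ?thesis by (intro boltzmann_integral_cong) (simp add: F_def)
  qed
  then have "(\<integral>\<^sup>+p. F A B p \<partial>law d b) = (\<integral>\<^sup>+p. F ?A (\<lambda>_. space deco_maps) p \<partial>law d b)"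
    using nn_integral_law Fm[OF Am Bm] Fm[OF A'm Sm] by simp
  also have "\<dots> = (\<integral>\<^sup>+p. (if m \<sqsubseteq>\<^sub>H Some (fst p) then ?A (restr m (fst p) (snd p)) else 0) \<partial>law d b)"
  proof (rule nn_integral_cong)
    fix p assume "p \<in> space (law d b)"
    then have p: "fst p \<in> QB" "snd p \<in> space deco_alg" by (auto simp: deco_maps_def space_pair_measure)
    have "(content m (fst p) h, content_deco m (fst p) (snd p) h) \<in> space deco_maps"
      if "m \<sqsubseteq>\<^sub>H Some (fst p)" "h \<in> marks m0" for h
      using content_QB[OF m p(1) that(1)] measurable_space[OF measurable_content_deco[OF m p(1) that(1)] p(2)] that(2) Some
      by (auto simp: deco_maps_def space_pair_measure)
    then show "F ?A (\<lambda>_. space deco_maps) p = (if m \<sqsubseteq>\<^sub>H Some (fst p) then ?A (restr m (fst p) (snd p)) else 0)"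
      by (simp add: F_def)
  qed
  finally show ?thesis
    unfolding F_def by (simp only: Some holes.simps hole_per.simps)
qed

end

section \<open>Local maps as stopping maps\<close>

lemma finite_holes: "m \<in> QH \<Longrightarrow> finite (holes m)"
  by (cases m) (auto simp: QH_def intro: finite_subset[OF QH0D(2) planar_map_permutation(1)[OF QH0D(1)]])

text \<open>A version of the bijection of faces that includes the empty map, whose single content is
  the whole map. It lets a box of decorations of \<open>x\<close> be rewritten as one condition on
  the submap and one on each content.\<close>

lemma submap_faces:
  assumes m: "m \<in> QH" and x: "x \<in> QB" and mx: "m \<sqsubseteq>\<^sub>H Some x"
  obtains \<theta>0 :: "nat set \<Rightarrow> nat set" and \<theta>1 :: "nat \<Rightarrow> nat set \<Rightarrow> nat set"
  where "inner_faces x = \<theta>0 ` inner_faces_H m \<union> (\<Union>h\<in>holes m. \<theta>1 h ` inner_faces (content m x h))"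
    "\<And>\<sigma> :: 'v::zero deco. restr m x \<sigma> = (\<lambda>F\<in>inner_faces_H m. \<sigma> (\<theta>0 F))"
    "\<And>(\<sigma> :: 'v deco) h F. h \<in> holes m \<Longrightarrow> F \<in> inner_faces (content m x h) \<Longrightarrow> content_deco m x \<sigma> h F = \<sigma> (\<theta>1 h F)"
proof (cases m)
  case None
  show thesis
    by (rule that[of id "\<lambda>_. id"]) (auto simp: None restrict_def)
next
  case (Some m0)
  then have Q: "m0 \<in> QH0" using m by (auto simp: QH_def)
  obtain u f where F: "filled_by m0 u f x" using mx Some by auto
  note bij = bij_betw_glued_face[OF Q F]
  show thesis
  proof (rule that[of "\<lambda>F. f ` Inl ` F" "\<lambda>h F. f ` (\<lambda>y. Inr (h, y)) ` F"])
    have "inner_faces x = glued_face f ` (inner_faces m0 <+> (SIGMA h:marks m0. inner_faces (u h)))"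
      using bij by (simp add: bij_betw_def)
    also have "\<dots> = (\<lambda>F. f ` Inl ` F) ` inner_faces m0 \<union> (\<Union>h\<in>marks m0. (\<lambda>F. f ` (\<lambda>y. Inr (h, y)) ` F) ` inner_faces (u h))"
      by (simp add: Plus_def image_Un image_image glued_face_def image_case_prod_Sigma)
    also have "\<dots> = (\<lambda>F. f ` Inl ` F) ` inner_faces_H m \<union>
        (\<Union>h\<in>holes m. (\<lambda>F. f ` (\<lambda>y. Inr (h, y)) ` F) ` inner_faces (content m x h))"
      unfolding Some using content_eq[OF Q F] by simp
    finally show "inner_faces x = \<dots>" .
    show "restr m x \<sigma> = (\<lambda>F\<in>inner_faces_H m. \<sigma> (f ` Inl ` F))" for \<sigma> :: "'v deco"
      unfolding Some restr_eq[OF Q F] by simp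
    fix \<sigma> :: "'v deco" and h G
    assume h: "h \<in> holes m" and G: "G \<in> inner_faces (content m x h)"
    then have h': "h \<in> marks m0" using Some by simp
    show "content_deco m x \<sigma> h G = \<sigma> (f ` (\<lambda>y. Inr (h, y)) ` G)"
      using G unfolding Some content_deco_eq[OF Q F h'] content_eq[OF Q F h'] by simp
  qed
qed

lemma content_unique:
  assumes m: "m \<in> QH" and x: "x \<in> QB" "m \<sqsubseteq>\<^sub>H Some x" and y: "y \<in> QB" "m \<sqsubseteq>\<^sub>H Some y"
    and eq: "\<And>h. h \<in> holes m \<Longrightarrow> content m x h = content m y h"
  shows "x = y"
proof (cases m)
  case None
  then show ?thesis using eq[of 0] by simp
next
  case (Some m0)
  then have Q: "m0 \<in> QH0" using m by (auto simp: QH_def)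
  have "hole_contents m0 x = hole_contents m0 y"
    using eq Some by (auto simp: hole_contents_def restrict_def fun_eq_iff)
  then show ?thesis
    using filled_by_hole_contents[OF Q] filled_by_same_content[OF Q _ _ x(1) y(1)] x(2) y(2) Some by metis
qed

text \<open>
  Transitivity of \<open>\<sqsubseteq>\<^sub>H\<close> is only available when the largest map has no holes, so the filtration is
  built from chains of submaps.
\<close>

definition submap_chain :: "(nat hmap option \<times> nat hmap option) set" where
  "submap_chain = {(r, m). r \<in> QH \<and> m \<in> QH \<and> r \<sqsubseteq>\<^sub>H m}\<^sup>*"

lemma submap_chain_refl: "(m, m) \<in> submap_chain"
  by (simp add: submap_chain_def)

lemma submap_chain_step: "(r, m) \<in> submap_chain \<Longrightarrow> m \<in> QH \<Longrightarrow> m' \<in> QH \<Longrightarrow> m \<sqsubseteq>\<^sub>H m' \<Longrightarrow> (r, m') \<in> submap_chain"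
  unfolding submap_chain_def by (rule rtrancl_into_rtrancl) simp_all

lemma submap_chain_QH: "(r, m) \<in> submap_chain \<Longrightarrow> m \<in> QH \<Longrightarrow> r \<in> QH"
  unfolding submap_chain_def by (induction rule: converse_rtrancl_induct) auto

lemma submap_chain_None: "(r, None) \<in> submap_chain \<Longrightarrow> r = None"
proof -
  have "(r, m) \<in> submap_chain \<Longrightarrow> m = None \<Longrightarrow> r = None" for m
    unfolding submap_chain_def
  proof (induction rule: rtrancl_induct)
    case (step y z)
    then show ?case by (cases y) auto
  qed simp
  then show "(r, None) \<in> submap_chain \<Longrightarrow> r = None" by simp
qed

text \<open>The face maps of the links are composed. Transitivity is invoked only below the
  hole-free \<open>x\<close>: if \<open>r'\<close> is a submap of \<open>x\<close>, so is its submap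
  \<open>r\<close>.\<close>

lemma submap_chain_restr:
  assumes "(r, m) \<in> submap_chain" "m \<in> QH"
  shows "\<exists>\<theta>. (\<forall>F\<in>inner_faces_H r. \<theta> F \<in> inner_faces_H m) \<and>
    (\<forall>x\<in>QB. m \<sqsubseteq>\<^sub>H Some x \<longrightarrow> r \<sqsubseteq>\<^sub>H Some x \<and>
      (\<forall>\<sigma> :: 'v::zero deco. restr r x \<sigma> = (\<lambda>F\<in>inner_faces_H r. restr m x \<sigma> (\<theta> F))))"
  using assms unfolding submap_chain_def
proof (induction rule: converse_rtrancl_induct)
  case base
  have "restr m x \<sigma> = (\<lambda>F\<in>inner_faces_H m. restr m x \<sigma> F)" if "x \<in> QB" "m \<sqsubseteq>\<^sub>H Some x" for x and \<sigma> :: "'v deco"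
    by (rule submap_faces[where ?'v='v, OF base that]) (auto simp: restrict_def fun_eq_iff)
  then show ?case by (intro exI[of _ "\<lambda>F. F"]) blast
next
  case (step r r')
  then obtain \<theta> where \<theta>: "\<forall>F\<in>inner_faces_H r'. \<theta> F \<in> inner_faces_H m"
    "\<And>x. x \<in> QB \<Longrightarrow> m \<sqsubseteq>\<^sub>H Some x \<Longrightarrow> r' \<sqsubseteq>\<^sub>H Some x"
    "\<And>x \<sigma>. x \<in> QB \<Longrightarrow> m \<sqsubseteq>\<^sub>H Some x \<Longrightarrow> restr r' x (\<sigma> :: 'v deco) = (\<lambda>F\<in>inner_faces_H r'. restr m x \<sigma> (\<theta> F))"
    by blast
  have "r \<in> QH" "r' \<in> QH" "r \<sqsubseteq>\<^sub>H r'" using step(1) by auto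
  then obtain \<theta>' where \<theta>': "\<And>F. F \<in> inner_faces_H r \<Longrightarrow> \<theta>' F \<in> inner_faces_H r'"
    "\<And>x. x \<in> QB \<Longrightarrow> r' \<sqsubseteq>\<^sub>H Some x \<Longrightarrow> r \<sqsubseteq>\<^sub>H Some x"
    "\<And>x \<sigma>. x \<in> QB \<Longrightarrow> r' \<sqsubseteq>\<^sub>H Some x \<Longrightarrow> restr r x (\<sigma> :: 'v deco) = (\<lambda>F\<in>inner_faces_H r. restr r' x \<sigma> (\<theta>' F))"
    using submap_trans_restr[where ?'v='v] by blast
  show ?case
  proof (intro exI[of _ "\<lambda>F. \<theta> (\<theta>' F)"] conjI ballI impI allI)
    fix x and \<sigma> :: "'v deco" assume x: "x \<in> QB" "m \<sqsubseteq>\<^sub>H Some x"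
    show "r \<sqsubseteq>\<^sub>H Some x" using \<theta>'(2)[OF x(1) \<theta>(2)[OF x]] .
    show "restr r x \<sigma> = (\<lambda>F\<in>inner_faces_H r. restr m x \<sigma> (\<theta> (\<theta>' F)))"
      unfolding \<theta>'(3)[OF x(1) \<theta>(2)[OF x]] \<theta>(3)[OF x] using \<theta>'(1) by (intro restrict_ext) simp
  qed (use \<theta>(1) \<theta>'(1) in blast)
qed

section \<open>Events and conditional laws attached to a local map\<close>

locale local_map_space = boltzmann \<beta> q \<mu> + prob_space M
  for \<beta> q :: real and \<mu> :: "'v::{real_normed_vector, second_countable_topology} measure" and M :: "'w measure" +
  fixes l :: nat and b :: "nat \<Rightarrow> 'v" and X :: "'w \<Rightarrow> nat hmap" and \<phi> :: "'w \<Rightarrow> 'v deco"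
    and S :: "'w \<Rightarrow> nat hmap option"
  assumes local_map: "local_map \<beta> q \<mu> l b M X \<phi> S"
begin

lemma X_meas: "X \<in> measurable M (count_space QB)"
  and \<phi>_meas: "\<phi> \<in> measurable M deco_alg"
  and S_meas: "S \<in> measurable M (count_space QH)"
  and distr_X: "distr M deco_maps (\<lambda>\<omega>. (X \<omega>, \<phi> \<omega>)) = law (2 * l) b"
  and S_sub: "AE \<omega> in M. S \<omega> \<sqsubseteq>\<^sub>H Some (X \<omega>)"
  using local_map by (auto simp: local_map_def boltzmann_map_def)

lemma X_QB: "\<omega> \<in> space M \<Longrightarrow> X \<omega> \<in> QB"
  using measurable_space[OF X_meas] by simp

lemma S_QH: "\<omega> \<in> space M \<Longrightarrow> S \<omega> \<in> QH"
  using measurable_space[OF S_meas] by simp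

lemma X\<phi>_meas: "(\<lambda>\<omega>. (X \<omega>, \<phi> \<omega>)) \<in> measurable M deco_maps"
  unfolding deco_maps_def using X_meas \<phi>_meas by (rule measurable_Pair)

lemma prob_space_law: "prob_space (law (2 * l) b)"
  unfolding distr_X[symmetric] by (rule prob_space_distr[OF X\<phi>_meas])

lemma sets_X [measurable]: "{\<omega> \<in> space M. X \<omega> = x} \<in> sets M"
proof (cases "x \<in> QB")
  case True
  then have "X -` {x} \<inter> space M \<in> sets M" by (intro measurable_sets[OF X_meas]) auto
  then show ?thesis by (simp add: vimage_def Int_def conj_commute)
next
  case False
  then have "{\<omega> \<in> space M. X \<omega> = x} = {}" using X_QB by auto
  then show ?thesis by (simp only: sets.empty_sets)
qed

lemma sets_S [measurable]: "{\<omega> \<in> space M. S \<omega> = r} \<in> sets M"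
proof (cases "r \<in> QH")
  case True
  then have "S -` {r} \<inter> space M \<in> sets M" by (intro measurable_sets[OF S_meas]) auto
  then show ?thesis by (simp add: vimage_def Int_def conj_commute)
next
  case False
  then have "{\<omega> \<in> space M. S \<omega> = r} = {}" using S_QH by auto
  then show ?thesis by (simp only: sets.empty_sets)
qed

lemma measurable_at_X:
  assumes "\<And>x. x \<in> QB \<Longrightarrow> g x \<in> measurable deco_alg N"
  shows "(\<lambda>\<omega>. g (X \<omega>) (\<phi> \<omega>)) \<in> measurable M N"
  by (rule measurable_compose_countable'[OF measurable_compose[OF \<phi>_meas assms] X_meas countable_QB])

definition Ev :: "nat hmap option \<Rightarrow> 'w set" where
  "Ev m = {\<omega> \<in> space M. m \<sqsubseteq>\<^sub>H Some (X \<omega>)}"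

definition R :: "nat hmap option \<Rightarrow> 'w \<Rightarrow> 'v deco" where
  "R m \<omega> = restr m (X \<omega>) (\<phi> \<omega>)"

definition Cev :: "nat hmap option \<Rightarrow> (nat \<Rightarrow> (nat hmap \<times> 'v deco) set) \<Rightarrow> 'w set" where
  "Cev m B = {\<omega> \<in> Ev m. \<forall>h\<in>holes m. (content m (X \<omega>) h, content_deco m (X \<omega>) (\<phi> \<omega>) h) \<in> B h}"

text \<open>The conditional probability that the Markov property predicts for \<open>Cev m B\<close>
  when the decoration of \<open>m\<close> is \<open>\<tau>\<close>.\<close>

definition K :: "nat hmap option \<Rightarrow> (nat \<Rightarrow> (nat hmap \<times> 'v deco) set) \<Rightarrow> 'v deco \<Rightarrow> ennreal" where
  "K m B \<tau> = (\<Prod>h\<in>holes m. emeasure (law (hole_per (2 * l) m h) (hole_bc b m \<tau> h)) (B h))"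

abbreviation "N m \<equiv> PiM (inner_faces_H m) (\<lambda>_. borel :: 'v measure)"

lemma sets_Ev [measurable]: "Ev m \<in> sets M"
proof -
  have "X -` {x \<in> QB. m \<sqsubseteq>\<^sub>H Some x} \<inter> space M \<in> sets M"
    by (rule measurable_sets[OF X_meas]) auto
  also have "X -` {x \<in> QB. m \<sqsubseteq>\<^sub>H Some x} \<inter> space M = Ev m"
    using X_QB by (auto simp: Ev_def)
  finally show ?thesis .
qed

lemma R_meas: "m \<in> QH \<Longrightarrow> R m \<in> measurable M (N m)"
  unfolding R_def[abs_def] by (rule measurable_at_X) (rule measurable_restr_deco_alg)

lemma K_meas:
  assumes m: "m \<in> QH" and B: "\<And>h. h \<in> holes m \<Longrightarrow> B h \<in> sets deco_maps"
  shows "K m B \<in> borel_measurable (N m)"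
  unfolding K_def[abs_def]
  by (intro borel_measurable_prod_ennreal borel_measurable_emeasure_law borel_measurable_hole_bc m B)

lemma measurable_contents:
  assumes m: "m \<in> QH" and x: "x \<in> QB" and mx: "m \<sqsubseteq>\<^sub>H Some x" and B: "\<And>h. h \<in> holes m \<Longrightarrow> B h \<in> sets deco_maps"
  shows "(\<lambda>\<sigma>. \<Prod>h\<in>holes m. indicator (B h) (content m x h, content_deco m x \<sigma> h) :: ennreal) \<in> borel_measurable (deco_alg :: 'v deco measure)"
proof (rule borel_measurable_prod_ennreal)
  fix h assume h: "h \<in> holes m"
  have "(\<lambda>\<sigma>. (content m x h, content_deco m x \<sigma> h)) \<in> measurable deco_alg (deco_maps :: (_ \<times> 'v deco) measure)"
    unfolding deco_maps_def
    using content_QB[OF m x mx h] measurable_content_deco[OF m x mx h]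
    by (intro measurable_Pair measurable_const) auto
  from measurable_compose[OF this borel_measurable_indicator[OF B[OF h]]]
  show "(\<lambda>\<sigma>. indicator (B h) (content m x h, content_deco m x \<sigma> h) :: ennreal) \<in> borel_measurable deco_alg" .
qed

lemma indicator_Cev:
  assumes "m \<in> QH" "\<omega> \<in> space M"
  shows "(indicator (Cev m B) \<omega> :: ennreal) = (if m \<sqsubseteq>\<^sub>H Some (X \<omega>) then
    (\<Prod>h\<in>holes m. indicator (B h) (content m (X \<omega>) h, content_deco m (X \<omega>) (\<phi> \<omega>) h)) else 0)"
  using finite_holes[OF assms(1)] assms(2)
  by (auto simp: Cev_def Ev_def indicator_def)

lemma sets_Cev:
  assumes m: "m \<in> QH" and B: "\<And>h. h \<in> holes m \<Longrightarrow> B h \<in> sets deco_maps"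
  shows "Cev m B \<in> sets M"
proof -
  have "(\<lambda>\<omega>. if m \<sqsubseteq>\<^sub>H Some (X \<omega>) then
    (\<Prod>h\<in>holes m. indicator (B h) (content m (X \<omega>) h, content_deco m (X \<omega>) (\<phi> \<omega>) h)) else 0 :: ennreal) \<in> borel_measurable M"
  proof (rule measurable_at_X)
    fix x assume "x \<in> QB"
    then show "(\<lambda>\<sigma>. if m \<sqsubseteq>\<^sub>H Some x then (\<Prod>h\<in>holes m. indicator (B h) (content m x h, content_deco m x \<sigma> h))
      else 0 :: ennreal) \<in> borel_measurable deco_alg"
      using measurable_contents[OF m _ _ B] by (cases "m \<sqsubseteq>\<^sub>H Some x") simp_all
  qed
  then have "(indicator (Cev m B) :: 'w \<Rightarrow> ennreal) \<in> borel_measurable M"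
    by (subst measurable_cong[OF indicator_Cev[OF m]])
  then have "Cev m B \<inter> space M \<in> sets M" by (simp add: borel_measurable_indicator_iff)
  moreover have "Cev m B \<inter> space M = Cev m B" by (auto simp: Cev_def Ev_def)
  ultimately show ?thesis by simp
qed

lemma markov:
  assumes m: "m \<in> QH" and A: "A \<in> borel_measurable (N m)" and B: "\<And>h. h \<in> holes m \<Longrightarrow> B h \<in> sets deco_maps"
  shows "(\<integral>\<^sup>+\<omega>. A (R m \<omega>) * indicator (Cev m B) \<omega> \<partial>M) = (\<integral>\<^sup>+\<omega>. A (R m \<omega>) * K m B (R m \<omega>) * indicator (Ev m) \<omega> \<partial>M)"
proof -
  let ?F = "\<lambda>p. if m \<sqsubseteq>\<^sub>H Some (fst p) then A (restr m (fst p) (snd p)) *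
      (\<Prod>h\<in>holes m. indicator (B h) (content m (fst p) h, content_deco m (fst p) (snd p) h)) else 0"
  let ?G = "\<lambda>p. if m \<sqsubseteq>\<^sub>H Some (fst p) then A (restr m (fst p) (snd p)) * K m B (restr m (fst p) (snd p)) else 0"
  have Am: "(\<lambda>\<sigma>. A (restr m x \<sigma>)) \<in> borel_measurable deco_alg" if "x \<in> QB" for x
    by (rule measurable_compose[OF measurable_restr_deco_alg[OF m that] A])
  have Km: "(\<lambda>\<sigma>. K m B (restr m x \<sigma>)) \<in> borel_measurable deco_alg" if "x \<in> QB" for x
    by (rule measurable_compose[OF measurable_restr_deco_alg[OF m that] K_meas[OF m B]])
  have F: "?F \<in> borel_measurable deco_maps"
  proof (rule measurable_deco_maps)
    fix x assume x: "x \<in> QB"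
    show "(\<lambda>\<sigma>. if m \<sqsubseteq>\<^sub>H Some x then A (restr m x \<sigma>) *
      (\<Prod>h\<in>holes m. indicator (B h) (content m x h, content_deco m x \<sigma> h)) else 0) \<in> borel_measurable deco_alg"
      using Am[OF x] measurable_contents[OF m x _ B] by (cases "m \<sqsubseteq>\<^sub>H Some x") simp_all
  qed
  have G: "?G \<in> borel_measurable deco_maps"
  proof (rule measurable_deco_maps)
    fix x assume x: "x \<in> QB"
    show "(\<lambda>\<sigma>. if m \<sqsubseteq>\<^sub>H Some x then A (restr m x \<sigma>) * K m B (restr m x \<sigma>) else 0) \<in> borel_measurable deco_alg"
      using Am[OF x] Km[OF x] by (cases "m \<sqsubseteq>\<^sub>H Some x") simp_all
  qed
  have "(\<integral>\<^sup>+\<omega>. A (R m \<omega>) * indicator (Cev m B) \<omega> \<partial>M) = (\<integral>\<^sup>+\<omega>. ?F (X \<omega>, \<phi> \<omega>) \<partial>M)"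
    by (rule nn_integral_cong) (simp add: indicator_Cev[OF m] R_def)
  also have "\<dots> = (\<integral>\<^sup>+p. ?F p \<partial>law (2 * l) b)"
    unfolding distr_X[symmetric] by (rule nn_integral_distr[OF X\<phi>_meas, symmetric]) (use F in simp)
  also have "\<dots> = (\<integral>\<^sup>+p. ?G p \<partial>law (2 * l) b)"
    unfolding K_def by (rule law_markov[OF prob_space_law m A B])
  also have "\<dots> = (\<integral>\<^sup>+\<omega>. ?G (X \<omega>, \<phi> \<omega>) \<partial>M)"
    unfolding distr_X[symmetric] by (rule nn_integral_distr[OF X\<phi>_meas]) (use G in simp)
  also have "\<dots> = (\<integral>\<^sup>+\<omega>. A (R m \<omega>) * K m B (R m \<omega>) * indicator (Ev m) \<omega> \<partial>M)"
    by (rule nn_integral_cong) (simp add: R_def Ev_def indicator_def)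
  finally show ?thesis .
qed

text \<open>
  On the event \<open>E\<close> and where \<open>m\<close> is a submap, the holes of \<open>m\<close> are conditionally
  independent Boltzmann maps given the decoration of \<open>m\<close>.
\<close>

definition hole_markov :: "'w set \<Rightarrow> nat hmap option \<Rightarrow> bool" where
  "hole_markov E m \<longleftrightarrow> (\<forall>A\<in>sets (N m). \<forall>B. (\<forall>h\<in>holes m. B h \<in> sets deco_maps) \<longrightarrow>
     emeasure M (E \<inter> {\<omega> \<in> space M. R m \<omega> \<in> A} \<inter> Cev m B) =
     (\<integral>\<^sup>+\<omega>. K m B (R m \<omega>) * indicator (E \<inter> {\<omega> \<in> space M. R m \<omega> \<in> A} \<inter> Ev m) \<omega> \<partial>M))"

lemma sets_R: "m \<in> QH \<Longrightarrow> A \<in> sets (N m) \<Longrightarrow> {\<omega> \<in> space M. R m \<omega> \<in> A} \<in> sets M"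
  using measurable_sets[OF R_meas] by (simp add: vimage_def Int_def conj_commute)

lemma hole_markov_space:
  assumes m: "m \<in> QH"
  shows "hole_markov (space M) m"
  unfolding hole_markov_def
proof (intro ballI allI impI)
  fix A B assume A: "A \<in> sets (N m)" and B: "\<forall>h\<in>holes m. B h \<in> sets (deco_maps :: (_ \<times> 'v deco) measure)"
  have C: "Cev m B \<in> sets M" using sets_Cev[OF m] B by blast
  have "emeasure M (space M \<inter> {\<omega> \<in> space M. R m \<omega> \<in> A} \<inter> Cev m B) =
    (\<integral>\<^sup>+\<omega>. indicator (space M \<inter> {\<omega> \<in> space M. R m \<omega> \<in> A} \<inter> Cev m B) \<omega> \<partial>M)"
    using C sets_R[OF m A] by (intro nn_integral_indicator[symmetric]) auto
  also have "\<dots> = (\<integral>\<^sup>+\<omega>. indicator A (R m \<omega>) * indicator (Cev m B) \<omega> \<partial>M)"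
    by (rule nn_integral_cong) (simp add: indicator_def)
  also have "\<dots> = (\<integral>\<^sup>+\<omega>. indicator A (R m \<omega>) * K m B (R m \<omega>) * indicator (Ev m) \<omega> \<partial>M)"
    using A B by (intro markov m) simp_all
  also have "\<dots> = (\<integral>\<^sup>+\<omega>. K m B (R m \<omega>) * indicator (space M \<inter> {\<omega> \<in> space M. R m \<omega> \<in> A} \<inter> Ev m) \<omega> \<partial>M)"
    by (rule nn_integral_cong) (simp add: indicator_def)
  finally show "emeasure M (space M \<inter> {\<omega> \<in> space M. R m \<omega> \<in> A} \<inter> Cev m B) =
     (\<integral>\<^sup>+\<omega>. K m B (R m \<omega>) * indicator (space M \<inter> {\<omega> \<in> space M. R m \<omega> \<in> A} \<inter> Ev m) \<omega> \<partial>M)" .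
qed

lemma measurable_restr_S:
  "(\<lambda>\<omega>. (S \<omega>, restr (S \<omega>) (X \<omega>) (\<phi> \<omega>))) \<in> measurable M (count_space QH \<Otimes>\<^sub>M deco_alg)"
proof (rule measurable_Pair[OF S_meas])
  have "R r \<in> measurable M deco_alg" if "r \<in> QH" for r
    using measurable_compose[OF R_meas[OF that] measurable_into_deco_alg[OF inner_faces_H_subset_finite[OF that]]] .
  then have "(\<lambda>\<omega>. R (S \<omega>) \<omega>) \<in> measurable M deco_alg"
    by (rule measurable_compose_countable'[OF _ S_meas countable_QH])
  then show "(\<lambda>\<omega>. restr (S \<omega>) (X \<omega>) (\<phi> \<omega>)) \<in> measurable M deco_alg"
    by (simp add: R_def)
qed

lemma subalgebra_sigma_sub: "subalgebra M (sigma_sub M X \<phi> S)"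
  unfolding subalgebra_def sigma_sub_def using sets_image_in_sets[OF refl measurable_restr_S] by simp

text \<open>The conditional expectation in \<open>local_map\<close> is integrated over the events of
  \<open>sigma_sub\<close> on which \<open>S = m\<close> and the decoration of \<open>m\<close> is
  constrained. From here on the argument deals with measures of events; conditional expectations
  return with the filtration.\<close>

lemma hole_markov_S:
  assumes m: "m \<in> QH"
  shows "hole_markov {\<omega> \<in> space M. S \<omega> = m} m"
  unfolding hole_markov_def
proof (intro ballI allI impI)
  fix A B assume A: "A \<in> sets (N m)" and B: "\<forall>h\<in>holes m. B h \<in> sets (deco_maps :: (_ \<times> 'v deco) measure)"
  let ?G = "sigma_sub M X \<phi> S" and ?E = "{\<omega> \<in> space M. S \<omega> = m}"
  let ?D = "?E \<inter> {\<omega> \<in> space M. R m \<omega> \<in> A}"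
  interpret G: finite_measure_subalgebra M ?G
    by unfold_locales (rule subalgebra_sigma_sub)
  define c where "c = nn_cond_exp M ?G (indicator {\<omega>' \<in> ?E. m \<sqsubseteq>\<^sub>H Some (X \<omega>') \<and>
      (\<forall>h\<in>holes m. (content m (X \<omega>') h, content_deco m (X \<omega>') (\<phi> \<omega>') h) \<in> B h)})"
  have ev: "{\<omega>' \<in> ?E. m \<sqsubseteq>\<^sub>H Some (X \<omega>') \<and>
      (\<forall>h\<in>holes m. (content m (X \<omega>') h, content_deco m (X \<omega>') (\<phi> \<omega>') h) \<in> B h)} = ?E \<inter> Cev m B"
    by (auto simp: Cev_def Ev_def)
  have C: "Cev m B \<in> sets M" using sets_Cev[OF m] B by blast
  have c: "AE \<omega> in M. \<omega> \<in> ?E \<longrightarrow> c \<omega> = K m B (R m \<omega>)"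
    using local_map m B unfolding local_map_def holes_indep_boltzmann_def c_def K_def R_def by blast
  have "?D \<in> sets ?G"
  proof -
    let ?J = "inner_faces_H m"
    \<comment> \<open>\<open>sigma_sub\<close> is built on decorations with all finite sets as
      coordinates; \<open>A\<close> is pulled back along the restriction to the faces of
      \<open>m\<close>, which leaves \<open>R m\<close> unchanged.\<close>
    let ?A = "{\<sigma> \<in> space deco_alg. restrict \<sigma> ?J \<in> A}"
    have "(\<lambda>\<sigma>. restrict \<sigma> ?J) \<in> measurable deco_alg (N m)"
      unfolding deco_alg_def by (rule measurable_restrict_subset) (rule inner_faces_H_subset_finite[OF m])
    then have "?A \<in> sets deco_alg" using A by measurable
    then have "{m} \<times> ?A \<in> sets (count_space QH \<Otimes>\<^sub>M deco_alg)" using m by (intro pair_measureI) auto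
    then have "(\<lambda>\<omega>. (S \<omega>, restr (S \<omega>) (X \<omega>) (\<phi> \<omega>))) -` ({m} \<times> ?A) \<inter> space M \<in> sets ?G"
      unfolding sigma_sub_def by (rule in_vimage_algebra)
    also have "(\<lambda>\<omega>. (S \<omega>, restr (S \<omega>) (X \<omega>) (\<phi> \<omega>))) -` ({m} \<times> ?A) \<inter> space M = ?D"
    proof -
      have "restrict (R m \<omega>) ?J = R m \<omega>" "R m \<omega> \<in> space deco_alg" if "\<omega> \<in> space M" for \<omega>
        using measurable_space[OF R_meas[OF m] that] inner_faces_H_subset_finite[OF m]
        by (auto simp: space_PiM PiE_def space_deco_alg extensional_restrict extensional_def)
      then show ?thesis by (auto simp: R_def)
    qed
    finally show ?thesis .
  qed
  then have Dm: "indicator ?D \<in> borel_measurable ?G" "?D \<in> sets M"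
    using subalgebra_sigma_sub by (auto simp: subalgebra_def)
  have "emeasure M (?D \<inter> Cev m B) = (\<integral>\<^sup>+\<omega>. indicator ?D \<omega> * indicator (?E \<inter> Cev m B) \<omega> \<partial>M)"
  proof -
    have "emeasure M (?D \<inter> Cev m B) = (\<integral>\<^sup>+\<omega>. indicator (?D \<inter> Cev m B) \<omega> \<partial>M)"
      using C Dm(2) by (intro nn_integral_indicator[symmetric]) auto
    also have "\<dots> = (\<integral>\<^sup>+\<omega>. indicator ?D \<omega> * indicator (?E \<inter> Cev m B) \<omega> \<partial>M)"
      by (rule nn_integral_cong) (auto simp: indicator_def)
    finally show ?thesis .
  qed
  also have "\<dots> = (\<integral>\<^sup>+\<omega>. indicator ?D \<omega> * c \<omega> \<partial>M)"
    unfolding c_def ev using C by (intro G.nn_cond_exp_intg[symmetric] Dm(1)) auto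
  \<comment> \<open>Almost surely \<open>S\<close> is a submap of \<open>X\<close>, so
    \<open>Ev m\<close> is automatic where \<open>S = m\<close>.\<close>
  also have "\<dots> = (\<integral>\<^sup>+\<omega>. K m B (R m \<omega>) * indicator (?D \<inter> Ev m) \<omega> \<partial>M)"
    using c S_sub by (intro nn_integral_cong_AE, eventually_elim) (auto simp: indicator_def Ev_def)
  finally show "emeasure M (?D \<inter> Cev m B) = (\<integral>\<^sup>+\<omega>. K m B (R m \<omega>) * indicator (?D \<inter> Ev m) \<omega> \<partial>M)" .
qed

end

lemma content_deco_restrict:
  assumes m: "Some m \<in> QH" and x: "x \<in> QB" and mx: "Some m \<sqsubseteq>\<^sub>H Some x" and h: "h \<in> marks m"
  shows "content_deco (Some m) x (restrict \<sigma> (inner_faces x)) h = content_deco (Some m) x \<sigma> h"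
proof -
  have Q: "m \<in> QH0" using m by (auto simp: QH_def)
  obtain u f where F: "filled_by m u f x" using mx by auto
  have "f ` (\<lambda>y. Inr (h, y)) ` G \<in> inner_faces x" if "G \<in> inner_faces (u h)" for G
    using bij_betw_apply[OF bij_betw_glued_face[OF Q F], of "Inr (h, G)"] that h by auto
  then show ?thesis unfolding content_deco_eq[OF Q F h] by (intro restrict_ext) simp
qed

section \<open>Conditional probabilities given the whole decorated map\<close>

context local_map_space
begin

text \<open>The elementary events of the decorated map. Coordinates of \<open>\<phi>\<close> at sets
  other than interior faces of \<open>X\<close> are discarded.\<close>

definition Xat :: "nat hmap \<Rightarrow> 'v deco set \<Rightarrow> 'w set" where
  "Xat x A = {\<omega> \<in> space M. X \<omega> = x \<and> restrict (\<phi> \<omega>) (inner_faces x) \<in> A}"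

lemma restrict_\<phi>_meas:
  assumes "x \<in> QB"
  shows "(\<lambda>\<omega>. restrict (\<phi> \<omega>) (inner_faces x)) \<in> measurable M (PiM (inner_faces x) (\<lambda>_. borel))"
  using assms by (intro measurable_compose[OF \<phi>_meas measurable_restrict_deco] inner_faces_subset_finite)
    (auto simp: QB_iff QH0D(1))

lemma sets_Xat:
  assumes "x \<in> QB" "A \<in> sets (PiM (inner_faces x) (\<lambda>_. borel))"
  shows "Xat x A \<in> sets M"
proof -
  have "Xat x A = {\<omega> \<in> space M. X \<omega> = x} \<inter> ((\<lambda>\<omega>. restrict (\<phi> \<omega>) (inner_faces x)) -` A \<inter> space M)"
    by (auto simp: Xat_def)
  also have "\<dots> \<in> sets M"
    by (rule sets.Int[OF sets_X measurable_sets[OF restrict_\<phi>_meas[OF assms(1)] assms(2)]])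
  finally show ?thesis .
qed

text \<open>
  \<open>E\<close> has a conditional probability given the whole decorated map that depends, where \<open>m\<close> is
  a submap, on the decoration of \<open>m\<close> only.  By the Markov property of the Boltzmann law this
  is equivalent to \<open>hole_markov\<close>, and unlike the latter it is visibly inherited by larger submaps.
\<close>

definition has_density :: "'w set \<Rightarrow> nat hmap option \<Rightarrow> ('v deco \<Rightarrow> ennreal) \<Rightarrow> bool" where
  "has_density E m d \<longleftrightarrow> d \<in> borel_measurable (N m) \<and> (\<forall>x\<in>QB. m \<sqsubseteq>\<^sub>H Some x \<longrightarrow>
     (\<forall>A\<in>sets (PiM (inner_faces x) (\<lambda>_. borel)). emeasure M (E \<inter> Xat x A) = (\<integral>\<^sup>+\<omega>. d (R m \<omega>) * indicator (Xat x A) \<omega> \<partial>M)))"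

text \<open>The law of the decoration of \<open>m\<close> on the event \<open>E\<close>, without
  normalisation; the case \<open>Ev m\<close> is the reference for the density.\<close>

definition R_law :: "'w set \<Rightarrow> nat hmap option \<Rightarrow> 'v deco measure" where
  "R_law E m = distr (density M (indicator E)) (N m) (R m)"

lemma sets_R_law [simp]: "sets (R_law E m) = sets (N m)"
  by (simp add: R_law_def)

lemma nn_integral_R_law:
  assumes m: "m \<in> QH" and E: "E \<in> sets M" and f: "f \<in> borel_measurable (N m)"
  shows "(\<integral>\<^sup>+\<tau>. f \<tau> \<partial>R_law E m) = (\<integral>\<^sup>+\<omega>. f (R m \<omega>) * indicator E \<omega> \<partial>M)"
proof -
  have "(\<integral>\<^sup>+\<tau>. f \<tau> \<partial>R_law E m) = (\<integral>\<^sup>+\<omega>. f (R m \<omega>) \<partial>density M (indicator E))"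
    unfolding R_law_def using R_meas[OF m] f by (intro nn_integral_distr) simp_all
  also have "\<dots> = (\<integral>\<^sup>+\<omega>. indicator E \<omega> * f (R m \<omega>) \<partial>M)"
    using E measurable_compose[OF R_meas[OF m] f] by (intro nn_integral_density) simp_all
  finally show ?thesis by (simp add: mult.commute)
qed

lemma emeasure_R_law:
  assumes m: "m \<in> QH" and E: "E \<in> sets M" and A: "A \<in> sets (N m)"
  shows "emeasure (R_law E m) A = emeasure M (E \<inter> {\<omega> \<in> space M. R m \<omega> \<in> A})"
proof -
  have "emeasure (R_law E m) A = (\<integral>\<^sup>+\<tau>. indicator A \<tau> \<partial>R_law E m)" using A by simp
  also have "\<dots> = (\<integral>\<^sup>+\<omega>. indicator A (R m \<omega>) * indicator E \<omega> \<partial>M)"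
    using A by (intro nn_integral_R_law m E) simp
  also have "\<dots> = (\<integral>\<^sup>+\<omega>. indicator (E \<inter> {\<omega> \<in> space M. R m \<omega> \<in> A}) \<omega> \<partial>M)"
    by (rule nn_integral_cong) (auto simp: indicator_def)
  also have "\<dots> = emeasure M (E \<inter> {\<omega> \<in> space M. R m \<omega> \<in> A})"
    using E sets_R[OF m A] by (intro nn_integral_indicator) auto
  finally show ?thesis .
qed

text \<open>\<open>d\<close> is the Radon-Nikodym derivative of the law of the decoration of
  \<open>m\<close> on \<open>E\<close> with respect to the law without \<open>E\<close>, both taken
  on \<open>Ev m\<close>; it is the conditional probability of \<open>E\<close> given this
  decoration. The Markov property on \<open>E\<close> says that the contents bring no further
  information about \<open>E\<close>, so \<open>d\<close> is also the conditional probability given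
  the whole decorated map.\<close>

lemma density_of_hole_markov:
  assumes m: "m \<in> QH" and E: "E \<in> sets M" and H: "hole_markov E m"
  shows "\<exists>d. has_density E m d"
proof -
  let ?\<nu> = "R_law (E \<inter> Ev m) m" and ?\<rho> = "R_law (Ev m) m"
  have EE: "E \<inter> Ev m \<in> sets M" using E sets_Ev by blast
  have fin: "finite_measure ?\<rho>"
    by (rule finite_measureI) (simp add: emeasure_R_law[OF m sets_Ev, of "space (N m)"] sets_eq_imp_space_eq[OF sets_R_law])
  interpret \<rho>: finite_measure ?\<rho> by (rule fin)
  have "absolutely_continuous ?\<rho> ?\<nu>"
  proof (unfold absolutely_continuous_def, rule subsetI)
    fix A assume A: "A \<in> null_sets ?\<rho>"
    then have A': "A \<in> sets (N m)" by auto
    have "emeasure ?\<nu> A \<le> emeasure ?\<rho> A"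
      unfolding emeasure_R_law[OF m EE A'] emeasure_R_law[OF m sets_Ev A']
      by (rule emeasure_mono) (use sets_Ev sets_R[OF m A'] in auto)
    then show "A \<in> null_sets ?\<nu>" using A A' by (auto simp: null_sets_def)
  qed
  then have dens: "density ?\<rho> (RN_deriv ?\<rho> ?\<nu>) = ?\<nu>"
    by (intro \<rho>.density_RN_deriv) simp_all
  define d where "d = RN_deriv ?\<rho> ?\<nu>"
  have d: "d \<in> borel_measurable (N m)"
    unfolding d_def using borel_measurable_RN_deriv[of ?\<rho> ?\<nu>] by (simp add: measurable_cong_sets[OF sets_R_law refl])
  have star: "(\<integral>\<^sup>+\<omega>. f (R m \<omega>) * indicator (E \<inter> Ev m) \<omega> \<partial>M) =
      (\<integral>\<^sup>+\<omega>. d (R m \<omega>) * f (R m \<omega>) * indicator (Ev m) \<omega> \<partial>M)" if f: "f \<in> borel_measurable (N m)" for f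
  proof -
    have "(\<integral>\<^sup>+\<omega>. f (R m \<omega>) * indicator (E \<inter> Ev m) \<omega> \<partial>M) = (\<integral>\<^sup>+\<tau>. f \<tau> \<partial>?\<nu>)"
      by (rule nn_integral_R_law[symmetric, OF m EE f])
    also have "\<dots> = (\<integral>\<^sup>+\<tau>. d \<tau> * f \<tau> \<partial>?\<rho>)"
      using d f unfolding dens[folded d_def, symmetric]
      by (intro nn_integral_density) (simp_all add: measurable_cong_sets[OF sets_R_law refl])
    also have "\<dots> = (\<integral>\<^sup>+\<omega>. d (R m \<omega>) * f (R m \<omega>) * indicator (Ev m) \<omega> \<partial>M)"
      using d f by (intro nn_integral_R_law m sets_Ev) simp
    finally show ?thesis .
  qed
  have "has_density E m d"
    unfolding has_density_def
  proof (intro conjI ballI impI d)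
    fix x A assume x: "x \<in> QB" and mx: "m \<sqsubseteq>\<^sub>H Some x" and A: "A \<in> sets (PiM (inner_faces x) (\<lambda>_. borel :: 'v measure))"
    let ?I = "inner_faces x" and ?N = "PiM (inner_faces x) (\<lambda>_. borel :: 'v measure)"
    let ?r = "\<lambda>\<omega>. restrict (\<phi> \<omega>) (inner_faces x)"
    obtain \<theta>0 :: "nat set \<Rightarrow> nat set" and \<theta>1 :: "nat \<Rightarrow> nat set \<Rightarrow> nat set"
      where \<theta>: "?I = \<theta>0 ` inner_faces_H m \<union> (\<Union>h\<in>holes m. \<theta>1 h ` inner_faces (content m x h))"
        "\<And>\<sigma> :: 'v deco. restr m x \<sigma> = (\<lambda>F\<in>inner_faces_H m. \<sigma> (\<theta>0 F))"
        "\<And>(\<sigma> :: 'v deco) h F. h \<in> holes m \<Longrightarrow> F \<in> inner_faces (content m x h) \<Longrightarrow> content_deco m x \<sigma> h F = \<sigma> (\<theta>1 h F)"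
      by (rule submap_faces[where ?'v='v, OF m x mx]) blast
    have i0: "\<theta>0 F \<in> ?I" if "F \<in> inner_faces_H m" for F using that unfolding \<theta>(1) by blast
    have i1: "\<theta>1 h F \<in> ?I" if "h \<in> holes m" "F \<in> inner_faces (content m x h)" for h F
      using that unfolding \<theta>(1) by blast
    define L where "L = distr (density M (indicator (E \<inter> {\<omega> \<in> space M. X \<omega> = x}))) ?N ?r"
    define L' where "L' = distr (density M (\<lambda>\<omega>. d (R m \<omega>) * indicator {\<omega> \<in> space M. X \<omega> = x} \<omega>)) ?N ?r"
    have dR: "(\<lambda>\<omega>. d (R m \<omega>)) \<in> borel_measurable M" by (rule measurable_compose[OF R_meas[OF m] d])
    have eL: "emeasure L A = emeasure M (E \<inter> Xat x A)" if A: "A \<in> sets ?N" for A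
    proof -
      have V: "?r -` A \<inter> space M \<in> sets M" by (rule measurable_sets[OF restrict_\<phi>_meas[OF x] A])
      have "emeasure L A = emeasure (density M (indicator (E \<inter> {\<omega> \<in> space M. X \<omega> = x}))) (?r -` A \<inter> space M)"
        unfolding L_def using A restrict_\<phi>_meas[OF x] by (subst emeasure_distr) simp_all
      also have "\<dots> = (\<integral>\<^sup>+\<omega>. indicator (E \<inter> {\<omega> \<in> space M. X \<omega> = x}) \<omega> * indicator (?r -` A \<inter> space M) \<omega> \<partial>M)"
        using V E sets_X by (intro emeasure_density) auto
      also have "\<dots> = (\<integral>\<^sup>+\<omega>. indicator (E \<inter> Xat x A) \<omega> \<partial>M)"
        by (rule nn_integral_cong) (auto simp: indicator_def Xat_def)
      also have "\<dots> = emeasure M (E \<inter> Xat x A)"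
        using E sets_Xat[OF x A] by (intro nn_integral_indicator) auto
      finally show ?thesis .
    qed
    have eL': "emeasure L' A = (\<integral>\<^sup>+\<omega>. d (R m \<omega>) * indicator (Xat x A) \<omega> \<partial>M)" if A: "A \<in> sets ?N" for A
    proof -
      have V: "?r -` A \<inter> space M \<in> sets M" by (rule measurable_sets[OF restrict_\<phi>_meas[OF x] A])
      have "emeasure L' A = emeasure (density M (\<lambda>\<omega>. d (R m \<omega>) * indicator {\<omega> \<in> space M. X \<omega> = x} \<omega>)) (?r -` A \<inter> space M)"
        unfolding L'_def using A restrict_\<phi>_meas[OF x] by (subst emeasure_distr) simp_all
      also have "\<dots> = (\<integral>\<^sup>+\<omega>. d (R m \<omega>) * indicator {\<omega> \<in> space M. X \<omega> = x} \<omega> * indicator (?r -` A \<inter> space M) \<omega> \<partial>M)"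
        using V dR sets_X by (intro emeasure_density) auto
      also have "\<dots> = (\<integral>\<^sup>+\<omega>. d (R m \<omega>) * indicator (Xat x A) \<omega> \<partial>M)"
        by (rule nn_integral_cong) (auto simp: indicator_def Xat_def)
      finally show ?thesis .
    qed
    \<comment> \<open>It suffices to compare the two measures on boxes, since \<open>L\<close> is
      finite.\<close>
    have "L = L'"
    proof (rule measure_eqI_PiM_finite)
      show "finite ?I" using x by (rule finite_faces_QB)
      show "sets L = sets ?N" "sets L' = sets ?N" by (simp_all add: L_def L'_def)
      show "range (\<lambda>_::nat. Pi\<^sub>E ?I (\<lambda>_. UNIV)) \<subseteq> prod_algebra ?I (\<lambda>_. borel :: 'v measure)"
        using finite_faces_QB[OF x] by (auto intro!: prod_algebraI_finite)
      show "(\<Union>i::nat. Pi\<^sub>E ?I (\<lambda>_. UNIV)) = space ?N" by (simp add: space_PiM)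
      have "emeasure L (space ?N) \<noteq> \<infinity>" by (simp add: eL)
      then show "emeasure L (Pi\<^sub>E ?I (\<lambda>_. UNIV)) \<noteq> \<infinity>" by (simp add: space_PiM)
      fix A :: "nat set \<Rightarrow> 'v set" assume A: "\<And>F. F \<in> ?I \<Longrightarrow> A F \<in> sets borel"
      have PA: "Pi\<^sub>E ?I A \<in> sets ?N" using A finite_faces_QB[OF x] by (intro sets_PiM_I_finite) auto
      define A0 where "A0 = Pi\<^sub>E (inner_faces_H m) (\<lambda>F. A (\<theta>0 F))"
      \<comment> \<open>\<open>B h\<close> prescribes the map that fills \<open>h\<close> and
        confines its decoration to the corresponding sides of the box.\<close>
      define B where "B h = {content m x h} \<times> {\<sigma> \<in> space deco_alg. \<forall>F\<in>inner_faces (content m x h). \<sigma> F \<in> A (\<theta>1 h F)}" for h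
      have finH: "finite (inner_faces_H m)"
        using m by (cases m) (auto simp: QH_def finite_inner_faces QH0D(1))
      have A0: "A0 \<in> sets (N m)" unfolding A0_def using A i0 finH by (intro sets_PiM_I_finite) simp_all
      have B: "B h \<in> sets deco_maps" if h: "h \<in> holes m" for h
      proof -
        have c: "content m x h \<in> QB" by (rule content_QB[OF m x mx h])
        have "{\<sigma> \<in> space deco_alg. \<sigma> F \<in> A (\<theta>1 h F)} \<in> sets deco_alg" if "F \<in> inner_faces (content m x h)" for F
        proof -
          have "(\<lambda>\<sigma>. \<sigma> F) \<in> borel_measurable (deco_alg :: 'v deco measure)"
            unfolding deco_alg_def using that inner_faces_subset_finite[OF QH0D(1)] c
            by (intro measurable_component_singleton) (auto simp: QB_iff)
          moreover have "A (\<theta>1 h F) \<in> sets borel" by (intro A i1 h that)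
          ultimately show ?thesis by measurable
        qed
        then have "{\<sigma> \<in> space deco_alg. \<forall>F\<in>inner_faces (content m x h). \<sigma> F \<in> A (\<theta>1 h F)} \<in> sets (deco_alg :: 'v deco measure)"
          by (intro sets.sets_Collect_finite_All finite_faces_QB[OF c])
        then show ?thesis unfolding B_def deco_maps_def using c by (intro pair_measureI) auto
      qed
      \<comment> \<open>Prescribing all contents prescribes \<open>X\<close>, by
        \<open>content_unique\<close>. A box at \<open>x\<close> is therefore an event of the kind
        that \<open>hole_markov\<close> treats.\<close>
      have atA: "Xat x (Pi\<^sub>E ?I A) = {\<omega> \<in> space M. R m \<omega> \<in> A0} \<inter> Cev m B"
      proof (intro equalityI subsetI)
        fix \<omega> assume "\<omega> \<in> Xat x (Pi\<^sub>E ?I A)"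
        then have \<omega>: "\<omega> \<in> space M" "X \<omega> = x" "\<And>F. F \<in> ?I \<Longrightarrow> \<phi> \<omega> F \<in> A F" by (auto simp: Xat_def)
        have "R m \<omega> \<in> A0" unfolding R_def \<omega>(2) \<theta>(2) A0_def using \<omega>(3) i0 by (intro PiE_I) simp_all
        moreover have "(content m x h, content_deco m x (\<phi> \<omega>) h) \<in> B h" if h: "h \<in> holes m" for h
          unfolding B_def using \<omega>(3)[OF i1[OF h]] \<theta>(3)[OF h]
            measurable_space[OF measurable_content_deco[OF m x mx h] measurable_space[OF \<phi>_meas \<omega>(1)]] by simp
        ultimately show "\<omega> \<in> {\<omega> \<in> space M. R m \<omega> \<in> A0} \<inter> Cev m B"
          using \<omega>(1,2) mx by (auto simp: Cev_def Ev_def)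
      next
        fix \<omega> assume "\<omega> \<in> {\<omega> \<in> space M. R m \<omega> \<in> A0} \<inter> Cev m B"
        then have \<omega>: "\<omega> \<in> space M" "m \<sqsubseteq>\<^sub>H Some (X \<omega>)" "R m \<omega> \<in> A0"
          "\<And>h. h \<in> holes m \<Longrightarrow> (content m (X \<omega>) h, content_deco m (X \<omega>) (\<phi> \<omega>) h) \<in> B h"
          by (auto simp: Cev_def Ev_def)
        have X: "X \<omega> = x"
          using \<omega>(4) by (intro content_unique[OF m X_QB[OF \<omega>(1)] \<omega>(2) x mx]) (simp add: B_def)
        have "\<phi> \<omega> F \<in> A F" if F: "F \<in> ?I" for F
          using F[unfolded \<theta>(1)]
        proof (elim UnE imageE UN_E)
          fix G assume "F = \<theta>0 G" "G \<in> inner_faces_H m"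
          then show ?thesis using \<omega>(3) unfolding R_def X \<theta>(2) A0_def by (auto simp: PiE_def Pi_def)
        next
          fix h G assume "F = \<theta>1 h G" "h \<in> holes m" "G \<in> inner_faces (content m x h)"
          then show ?thesis using \<omega>(4)[of h] \<theta>(3)[of h G "\<phi> \<omega>"] unfolding X B_def by auto
        qed
        then show "\<omega> \<in> Xat x (Pi\<^sub>E ?I A)" using \<omega>(1) X by (auto simp: Xat_def)
      qed
      have KB: "(\<lambda>\<tau>. indicator A0 \<tau> * K m B \<tau>) \<in> borel_measurable (N m)"
        using A0 K_meas[OF m B] by simp
      \<comment> \<open>The Markov property on \<open>E\<close> trades the contents for the kernel
        \<open>K\<close>, then \<open>star\<close> trades \<open>E\<close> for \<open>d\<close>, and
        finally the Markov property of the Boltzmann law trades \<open>K\<close> back for the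
        contents.\<close>
      have "emeasure L (Pi\<^sub>E ?I A) = emeasure M (E \<inter> {\<omega> \<in> space M. R m \<omega> \<in> A0} \<inter> Cev m B)"
        unfolding eL[OF PA] atA by (simp add: Int_assoc)
      also have "\<dots> = (\<integral>\<^sup>+\<omega>. K m B (R m \<omega>) * indicator (E \<inter> {\<omega> \<in> space M. R m \<omega> \<in> A0} \<inter> Ev m) \<omega> \<partial>M)"
        using H A0 B unfolding hole_markov_def by blast
      also have "\<dots> = (\<integral>\<^sup>+\<omega>. indicator A0 (R m \<omega>) * K m B (R m \<omega>) * indicator (E \<inter> Ev m) \<omega> \<partial>M)"
        by (rule nn_integral_cong) (auto simp: indicator_def)
      also have "\<dots> = (\<integral>\<^sup>+\<omega>. d (R m \<omega>) * (indicator A0 (R m \<omega>) * K m B (R m \<omega>)) * indicator (Ev m) \<omega> \<partial>M)"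
        by (rule star[OF KB])
      also have "\<dots> = (\<integral>\<^sup>+\<omega>. d (R m \<omega>) * indicator A0 (R m \<omega>) * K m B (R m \<omega>) * indicator (Ev m) \<omega> \<partial>M)"
        by (simp add: mult.assoc)
      also have "\<dots> = (\<integral>\<^sup>+\<omega>. d (R m \<omega>) * indicator A0 (R m \<omega>) * indicator (Cev m B) \<omega> \<partial>M)"
        using d A0 B by (intro markov[symmetric] m) simp_all
      also have "\<dots> = emeasure L' (Pi\<^sub>E ?I A)"
        unfolding eL'[OF PA] atA by (rule nn_integral_cong) (auto simp: indicator_def)
      finally show "emeasure L (Pi\<^sub>E ?I A) = emeasure L' (Pi\<^sub>E ?I A)" .
    qed
    then show "emeasure M (E \<inter> Xat x A) = (\<integral>\<^sup>+\<omega>. d (R m \<omega>) * indicator (Xat x A) \<omega> \<partial>M)"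
      using eL[OF A] eL'[OF A] by simp
  qed
  then show ?thesis by blast
qed

text \<open>\<open>has_density\<close> treats one value of \<open>X\<close> at a time; summing over
  the countably many values extends it to every event that has the form \<open>Xat\<close> at each
  of them.\<close>

lemma emeasure_density_countable:
  assumes d: "has_density E m d" and m: "m \<in> QH" and E: "E \<in> sets M" and G: "G \<in> sets M" "G \<subseteq> Ev m"
    and loc: "\<And>x. x \<in> QB \<Longrightarrow> m \<sqsubseteq>\<^sub>H Some x \<Longrightarrow> \<exists>A\<in>sets (PiM (inner_faces x) (\<lambda>_. borel)). G \<inter> {\<omega> \<in> space M. X \<omega> = x} = Xat x A"
  shows "emeasure M (E \<inter> G) = (\<integral>\<^sup>+\<omega>. d (R m \<omega>) * indicator G \<omega> \<partial>M)"
proof -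
  let ?Q = "{x \<in> QB. m \<sqsubseteq>\<^sub>H Some x}" and ?G = "\<lambda>x. G \<inter> {\<omega> \<in> space M. X \<omega> = x}"
  have Q: "countable ?Q" by (rule countable_subset[OF _ countable_QB]) auto
  have G': "G = (\<Union>x\<in>?Q. ?G x)"
    using G X_QB sets.sets_into_space[OF G(1)] by (auto simp: Ev_def)
  have dR: "(\<lambda>\<omega>. d (R m \<omega>)) \<in> borel_measurable M"
    using d by (intro measurable_compose[OF R_meas[OF m]]) (simp add: has_density_def)
  have disj: "disjoint_family_on ?G ?Q" by (auto simp: disjoint_family_on_def)
  have sG: "?G x \<in> sets M" for x using G(1) by (intro sets.Int sets_X)
  have "emeasure M (E \<inter> G) = emeasure M (\<Union>x\<in>?Q. E \<inter> ?G x)"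
    by (subst G') (rule arg_cong[where f="emeasure M"], blast)
  also have "\<dots> = (\<integral>\<^sup>+x. emeasure M (E \<inter> ?G x) \<partial>count_space ?Q)"
    using E sG disj Q by (intro emeasure_UN_countable) (auto simp: disjoint_family_on_def)
  also have "\<dots> = (\<integral>\<^sup>+x. emeasure (density M (\<lambda>\<omega>. d (R m \<omega>))) (?G x) \<partial>count_space ?Q)"
  proof (rule nn_integral_cong)
    fix x assume "x \<in> space (count_space ?Q)"
    then have x: "x \<in> QB" "m \<sqsubseteq>\<^sub>H Some x" by auto
    then obtain A where A: "A \<in> sets (PiM (inner_faces x) (\<lambda>_. borel))" "?G x = Xat x A" using loc by blast
    show "emeasure M (E \<inter> ?G x) = emeasure (density M (\<lambda>\<omega>. d (R m \<omega>))) (?G x)"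
      using d x A sG[of x] dR by (simp add: has_density_def emeasure_density)
  qed
  also have "\<dots> = emeasure (density M (\<lambda>\<omega>. d (R m \<omega>))) (\<Union>x\<in>?Q. ?G x)"
    using sG disj Q by (intro emeasure_UN_countable[symmetric]) simp_all
  also have "\<dots> = (\<integral>\<^sup>+\<omega>. d (R m \<omega>) * indicator G \<omega> \<partial>M)"
    unfolding G'[symmetric] using dR G(1) by (rule emeasure_density)
  finally show ?thesis .
qed

text \<open>The mass on \<open>E\<close> of an event about the decoration of \<open>m\<close> and
  the contents is an integral of \<open>d\<close>. As \<open>d\<close> depends on the decoration of
  \<open>m\<close> only, it can enter the Markov property of the Boltzmann law as a test function,
  after which it is converted back into \<open>E\<close>.\<close>

lemma hole_markov_of_density:
  assumes m: "Some m \<in> QH" and E: "E \<in> sets M" and d: "has_density E (Some m) d"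
  shows "hole_markov E (Some m)"
proof -
  let ?m = "Some m"
  have dm: "d \<in> borel_measurable (N ?m)" using d by (simp add: has_density_def)
  \<comment> \<open>The restriction and the contents read \<open>\<phi>\<close> at faces of
    \<open>x\<close> only, so on \<open>X = x\<close> the event has the form
    \<open>Xat\<close>.\<close>
  have loc: "\<exists>A'\<in>sets (PiM (inner_faces x) (\<lambda>_. borel)).
      {\<omega> \<in> space M. R ?m \<omega> \<in> A} \<inter> Cev ?m B \<inter> {\<omega> \<in> space M. X \<omega> = x} = Xat x A'"
    if A: "A \<in> sets (N ?m)" and B: "\<And>h. h \<in> marks m \<Longrightarrow> B h \<in> sets deco_maps" and x: "x \<in> QB" "?m \<sqsubseteq>\<^sub>H Some x" for A B x
  proof -
    let ?r = "\<lambda>\<sigma> :: 'v deco. restrict \<sigma> (inner_faces x)"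
    let ?P = "\<lambda>\<sigma>. restr ?m x \<sigma> \<in> A \<and> (\<forall>h\<in>marks m. (content ?m x h, content_deco ?m x \<sigma> h) \<in> B h)"
    have px: "planar_map x" using x(1) by (auto simp: QB_iff QH0D(1))
    have "{\<sigma> \<in> space deco_alg. (content ?m x h, content_deco ?m x \<sigma> h) \<in> B h} \<in> sets (deco_alg :: 'v deco measure)"
      if h: "h \<in> marks m" for h
    proof -
      have "(\<lambda>\<sigma>. (content ?m x h, content_deco ?m x \<sigma> h)) \<in> measurable deco_alg (deco_maps :: (_ \<times> 'v deco) measure)"
        unfolding deco_maps_def
        using content_QB[OF m x] measurable_content_deco[OF m x] h
        by (intro measurable_Pair measurable_const) auto
      from measurable_sets[OF this B[OF h]] show ?thesis by (simp add: vimage_def Int_def conj_commute)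
    qed
    moreover have "{\<sigma> \<in> space deco_alg. restr ?m x \<sigma> \<in> A} \<in> sets (deco_alg :: 'v deco measure)"
      using measurable_sets[OF measurable_restr_deco_alg[OF m x(1)] A] by (simp add: vimage_def Int_def conj_commute)
    ultimately have "{\<sigma> \<in> space deco_alg. ?P \<sigma>} \<in> sets (deco_alg :: 'v deco measure)"
      using finite_holes[OF m]
      by (intro sets.sets_Collect_conj sets.sets_Collect_finite_All) simp_all
    then have A': "(\<lambda>\<sigma>. \<sigma>) -` {\<sigma> \<in> space deco_alg. ?P \<sigma>} \<inter> space (PiM (inner_faces x) (\<lambda>_. borel)) \<in> sets (PiM (inner_faces x) (\<lambda>_. borel :: 'v measure))"
      by (rule measurable_sets[OF measurable_into_deco_alg[OF inner_faces_subset_finite[OF px]]])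
    have "?P (?r \<sigma>) \<longleftrightarrow> ?P \<sigma>" for \<sigma>
      by (simp only: restr_restrict[OF m x(2)] content_deco_restrict[OF m x] cong: ball_cong)
    moreover have "?r (\<phi> \<omega>) \<in> space deco_alg" "?r (\<phi> \<omega>) \<in> space (PiM (inner_faces x) (\<lambda>_. borel))"
      if "\<omega> \<in> space M" for \<omega>
      using measurable_space[OF restrict_\<phi>_meas[OF x(1)] that]
        measurable_space[OF measurable_into_deco_alg[OF inner_faces_subset_finite[OF px]]] by auto
    ultimately have "{\<omega> \<in> space M. R ?m \<omega> \<in> A} \<inter> Cev ?m B \<inter> {\<omega> \<in> space M. X \<omega> = x} =
        Xat x ((\<lambda>\<sigma>. \<sigma>) -` {\<sigma> \<in> space deco_alg. ?P \<sigma>} \<inter> space (PiM (inner_faces x) (\<lambda>_. borel)))"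
      using x(2) by (auto simp: Xat_def Cev_def Ev_def R_def simp del: restr.simps content.simps content_deco.simps submap.simps)
    then show ?thesis using A' by blast
  qed
  have EE: "E \<inter> Ev ?m \<in> sets M" using E sets_Ev by blast
  \<comment> \<open>With no constraint on the contents, the hypothesis says that \<open>d\<close> is
    the density of the law of the decoration on \<open>E\<close>. This is what converts
    \<open>d\<close> back into \<open>E\<close> below.\<close>
  have "R_law (E \<inter> Ev ?m) ?m = density (R_law (Ev ?m) ?m) d"
  proof (rule measure_eqI)
    fix A assume "A \<in> sets (R_law (E \<inter> Ev ?m) ?m)"
    then have A: "A \<in> sets (N ?m)" by simp
    let ?G = "{\<omega> \<in> space M. R ?m \<omega> \<in> A} \<inter> Cev ?m (\<lambda>_. space deco_maps)"
    have G: "?G = {\<omega> \<in> space M. R ?m \<omega> \<in> A} \<inter> Ev ?m"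
    proof -
      have "(content ?m (X \<omega>) h, content_deco ?m (X \<omega>) (\<phi> \<omega>) h) \<in> space (deco_maps :: (_ \<times> 'v deco) measure)"
        if "\<omega> \<in> space M" "?m \<sqsubseteq>\<^sub>H Some (X \<omega>)" "h \<in> holes ?m" for \<omega> h
        using content_QB[OF m X_QB[OF that(1)] that(2,3)]
          measurable_space[OF measurable_content_deco[OF m X_QB[OF that(1)] that(2,3)] measurable_space[OF \<phi>_meas that(1)]]
        by (simp add: deco_maps_def space_pair_measure del: content.simps content_deco.simps)
      then show ?thesis unfolding Cev_def Ev_def by blast
    qed
    have "emeasure (R_law (E \<inter> Ev ?m) ?m) A = emeasure M (E \<inter> ?G)"
      unfolding emeasure_R_law[OF m EE A] G by (rule arg_cong[where f="emeasure M"]) blast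
    also have "\<dots> = (\<integral>\<^sup>+\<omega>. d (R ?m \<omega>) * indicator ?G \<omega> \<partial>M)"
      using sets_R[OF m A] sets_Ev
      by (intro emeasure_density_countable[OF d m E] loc A) (auto simp: G)
    also have "\<dots> = (\<integral>\<^sup>+\<omega>. d (R ?m \<omega>) * indicator A (R ?m \<omega>) * indicator (Ev ?m) \<omega> \<partial>M)"
      unfolding G by (rule nn_integral_cong) (auto simp: indicator_def)
    also have "\<dots> = (\<integral>\<^sup>+\<tau>. d \<tau> * indicator A \<tau> \<partial>R_law (Ev ?m) ?m)"
      using dm A by (intro nn_integral_R_law[symmetric] m sets_Ev) simp
    also have "\<dots> = emeasure (density (R_law (Ev ?m) ?m) d) A"
      using dm A by (intro emeasure_density[symmetric]) (simp_all add: measurable_cong_sets[OF sets_R_law refl])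
    finally show "emeasure (R_law (E \<inter> Ev ?m) ?m) A = emeasure (density (R_law (Ev ?m) ?m) d) A" .
  qed simp
  note dens = this
  show ?thesis
    unfolding hole_markov_def
  proof (intro ballI allI impI)
    fix A B assume A: "A \<in> sets (N ?m)" and B: "\<forall>h\<in>holes ?m. B h \<in> sets (deco_maps :: (_ \<times> 'v deco) measure)"
    let ?G = "{\<omega> \<in> space M. R ?m \<omega> \<in> A} \<inter> Cev ?m B"
    have Bh: "\<And>h. h \<in> holes ?m \<Longrightarrow> B h \<in> sets (deco_maps :: (_ \<times> 'v deco) measure)" using B by blast
    have C: "Cev ?m B \<in> sets M" by (rule sets_Cev[OF m Bh])
    have KB: "(\<lambda>\<tau>. indicator A \<tau> * K ?m B \<tau>) \<in> borel_measurable (N ?m)"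
      using A K_meas[OF m Bh] by simp
    have "emeasure M (E \<inter> {\<omega> \<in> space M. R ?m \<omega> \<in> A} \<inter> Cev ?m B) = emeasure M (E \<inter> ?G)"
      by (simp add: Int_assoc)
    also have "\<dots> = (\<integral>\<^sup>+\<omega>. d (R ?m \<omega>) * indicator ?G \<omega> \<partial>M)"
      using C sets_R[OF m A] B by (intro emeasure_density_countable[OF d m E] loc A) (auto simp: Cev_def)
    also have "\<dots> = (\<integral>\<^sup>+\<omega>. d (R ?m \<omega>) * indicator A (R ?m \<omega>) * indicator (Cev ?m B) \<omega> \<partial>M)"
      by (rule nn_integral_cong) (auto simp: indicator_def)
    also have "\<dots> = (\<integral>\<^sup>+\<omega>. d (R ?m \<omega>) * indicator A (R ?m \<omega>) * K ?m B (R ?m \<omega>) * indicator (Ev ?m) \<omega> \<partial>M)"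
      using dm A Bh by (intro markov m) simp_all
    also have "\<dots> = (\<integral>\<^sup>+\<tau>. d \<tau> * (indicator A \<tau> * K ?m B \<tau>) \<partial>R_law (Ev ?m) ?m)"
      using dm KB by (subst nn_integral_R_law[OF m sets_Ev]) (simp_all add: mult.assoc)
    also have "\<dots> = (\<integral>\<^sup>+\<tau>. indicator A \<tau> * K ?m B \<tau> \<partial>R_law (E \<inter> Ev ?m) ?m)"
      unfolding dens using dm KB
      by (intro nn_integral_density[symmetric]) (simp_all add: measurable_cong_sets[OF sets_R_law refl])
    also have "\<dots> = (\<integral>\<^sup>+\<omega>. indicator A (R ?m \<omega>) * K ?m B (R ?m \<omega>) * indicator (E \<inter> Ev ?m) \<omega> \<partial>M)"
      by (rule nn_integral_R_law[OF m EE KB])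
    also have "\<dots> = (\<integral>\<^sup>+\<omega>. K ?m B (R ?m \<omega>) * indicator (E \<inter> {\<omega> \<in> space M. R ?m \<omega> \<in> A} \<inter> Ev ?m) \<omega> \<partial>M)"
      by (rule nn_integral_cong) (auto simp: indicator_def)
    finally show "emeasure M (E \<inter> {\<omega> \<in> space M. R ?m \<omega> \<in> A} \<inter> Cev ?m B) =
      (\<integral>\<^sup>+\<omega>. K ?m B (R ?m \<omega>) * indicator (E \<inter> {\<omega> \<in> space M. R ?m \<omega> \<in> A} \<inter> Ev ?m) \<omega> \<partial>M)" .
  qed
qed

text \<open>The density is composed with the map that reads the decoration of \<open>r\<close> off
  that of \<open>m\<close>. The events \<open>Xat\<close> refer to no submap and stay as they
  are.\<close>

lemma has_density_chain:
  assumes rm: "(r, m) \<in> submap_chain" and m: "m \<in> QH" and d: "has_density E r d"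
  shows "\<exists>d'. has_density E m d'"
proof -
  obtain \<theta> where \<theta>: "\<And>F. F \<in> inner_faces_H r \<Longrightarrow> \<theta> F \<in> inner_faces_H m"
    "\<And>x. x \<in> QB \<Longrightarrow> m \<sqsubseteq>\<^sub>H Some x \<Longrightarrow> r \<sqsubseteq>\<^sub>H Some x"
    "\<And>x (\<sigma> :: 'v deco). x \<in> QB \<Longrightarrow> m \<sqsubseteq>\<^sub>H Some x \<Longrightarrow> restr r x \<sigma> = (\<lambda>F\<in>inner_faces_H r. restr m x \<sigma> (\<theta> F))"
    using submap_chain_restr[where ?'v='v, OF rm m] by blast
  have \<psi>: "(\<lambda>\<tau>. \<lambda>F\<in>inner_faces_H r. \<tau> (\<theta> F)) \<in> measurable (N m) (N r)"
    by (intro measurable_restrict measurable_component_singleton \<theta>(1))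
  let ?d = "\<lambda>\<tau>. d (\<lambda>F\<in>inner_faces_H r. \<tau> (\<theta> F))"
  have "has_density E m ?d"
    unfolding has_density_def
  proof (intro conjI ballI impI)
    show "?d \<in> borel_measurable (N m)"
      using d by (intro measurable_compose[OF \<psi>]) (simp add: has_density_def)
    fix x A assume x: "x \<in> QB" "m \<sqsubseteq>\<^sub>H Some x" and A: "A \<in> sets (PiM (inner_faces x) (\<lambda>_. borel :: 'v measure))"
    have "emeasure M (E \<inter> Xat x A) = (\<integral>\<^sup>+\<omega>. d (R r \<omega>) * indicator (Xat x A) \<omega> \<partial>M)"
      using d x(1) \<theta>(2)[OF x] A by (simp add: has_density_def)
    also have "\<dots> = (\<integral>\<^sup>+\<omega>. ?d (R m \<omega>) * indicator (Xat x A) \<omega> \<partial>M)"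
      by (rule nn_integral_cong) (auto simp: indicator_def Xat_def R_def \<theta>(3)[OF x])
    finally show "emeasure M (E \<inter> Xat x A) = (\<integral>\<^sup>+\<omega>. ?d (R m \<omega>) * indicator (Xat x A) \<omega> \<partial>M)" .
  qed
  then show ?thesis by blast
qed

text \<open>Below the empty map there is only the empty map, so \<open>r = m\<close>. In all other
  cases the property is turned into a density at \<open>r\<close>, transferred to \<open>m\<close>
  and turned back.\<close>

lemma hole_markov_S_chain:
  assumes rm: "(r, m) \<in> submap_chain" and m: "m \<in> QH"
  shows "hole_markov {\<omega> \<in> space M. S \<omega> = r} m"
proof (cases m)
  case None
  then have "r = m" using submap_chain_None rm by blast
  then show ?thesis using hole_markov_S[OF m] by simp
next
  case (Some m0)
  have r: "r \<in> QH" by (rule submap_chain_QH[OF rm m])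
  obtain d where "has_density {\<omega> \<in> space M. S \<omega> = r} m d"
    using density_of_hole_markov[OF r sets_S hole_markov_S[OF r]] has_density_chain[OF rm m] by blast
  then show ?thesis using hole_markov_of_density m sets_S Some by blast
qed

end

section \<open>The partition by the value of the local map below a given map\<close>

context local_map_space
begin

text \<open>The sets \<open>A i\<close> may vary with \<open>i\<close>, because an event of the
  filtration is a condition on the decoration of \<open>m\<close> that changes with the value of
  \<open>S\<close>.\<close>

lemma hole_markov_UN:
  assumes m: "m \<in> QH" and I: "countable I" "disjoint_family_on E I"
    and E: "\<And>i. i \<in> I \<Longrightarrow> E i \<in> sets M" "\<And>i. i \<in> I \<Longrightarrow> hole_markov (E i) m"
    and A: "\<And>i. i \<in> I \<Longrightarrow> A i \<in> sets (N m)" and B: "\<And>h. h \<in> holes m \<Longrightarrow> B h \<in> sets deco_maps"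
  shows "emeasure M (\<Union>i\<in>I. E i \<inter> {\<omega> \<in> space M. R m \<omega> \<in> A i} \<inter> Cev m B) =
    emeasure (density M (\<lambda>\<omega>. K m B (R m \<omega>))) (\<Union>i\<in>I. E i \<inter> {\<omega> \<in> space M. R m \<omega> \<in> A i} \<inter> Ev m)"
proof -
  have KR: "(\<lambda>\<omega>. K m B (R m \<omega>)) \<in> borel_measurable M"
    by (rule measurable_compose[OF R_meas[OF m] K_meas[OF m B]])
  have disj: "disjoint_family_on (\<lambda>i. E i \<inter> V i \<inter> W) I" for V W
    by (rule disjoint_family_on_bisimulation[OF I(2)]) blast
  have s: "E i \<inter> {\<omega> \<in> space M. R m \<omega> \<in> A i} \<inter> C \<in> sets M" if "i \<in> I" "C \<in> sets M" for i C
    by (intro sets.Int E(1) sets_R m A that)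
  have "emeasure M (\<Union>i\<in>I. E i \<inter> {\<omega> \<in> space M. R m \<omega> \<in> A i} \<inter> Cev m B) =
    (\<integral>\<^sup>+i. emeasure M (E i \<inter> {\<omega> \<in> space M. R m \<omega> \<in> A i} \<inter> Cev m B) \<partial>count_space I)"
    by (rule emeasure_UN_countable[OF s[OF _ sets_Cev[OF m B]] I(1) disj])
  also have "\<dots> = (\<integral>\<^sup>+i. emeasure (density M (\<lambda>\<omega>. K m B (R m \<omega>))) (E i \<inter> {\<omega> \<in> space M. R m \<omega> \<in> A i} \<inter> Ev m) \<partial>count_space I)"
  proof (rule nn_integral_cong)
    fix i assume "i \<in> space (count_space I)"
    then have i: "i \<in> I" by simp
    have "emeasure M (E i \<inter> {\<omega> \<in> space M. R m \<omega> \<in> A i} \<inter> Cev m B) =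
      (\<integral>\<^sup>+\<omega>. K m B (R m \<omega>) * indicator (E i \<inter> {\<omega> \<in> space M. R m \<omega> \<in> A i} \<inter> Ev m) \<omega> \<partial>M)"
      using E(2)[OF i, unfolded hole_markov_def, rule_format, OF A[OF i] B] .
    then show "emeasure M (E i \<inter> {\<omega> \<in> space M. R m \<omega> \<in> A i} \<inter> Cev m B) =
      emeasure (density M (\<lambda>\<omega>. K m B (R m \<omega>))) (E i \<inter> {\<omega> \<in> space M. R m \<omega> \<in> A i} \<inter> Ev m)"
      using KR s[OF i sets_Ev] by (simp add: emeasure_density)
  qed
  also have "\<dots> = emeasure (density M (\<lambda>\<omega>. K m B (R m \<omega>))) (\<Union>i\<in>I. E i \<inter> {\<omega> \<in> space M. R m \<omega> \<in> A i} \<inter> Ev m)"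
    by (rule emeasure_UN_countable[symmetric, OF _ I(1) disj]) (simp add: s sets_Ev)
  finally show ?thesis .
qed

text \<open>The outer \<open>None\<close> says that no chain leads from \<open>S\<close> to
  \<open>m\<close>, while \<open>Some None\<close> is the empty map as a value of
  \<open>S\<close>.\<close>

definition T :: "nat hmap option \<Rightarrow> 'w \<Rightarrow> nat hmap option option" where
  "T m \<omega> = (if (S \<omega>, m) \<in> submap_chain then Some (S \<omega>) else None)"

definition T_range :: "nat hmap option \<Rightarrow> nat hmap option option set" where
  "T_range m = insert None (Some ` {r. (r, m) \<in> submap_chain})"

lemma T_in_range: "T m \<omega> \<in> T_range m"
  by (simp add: T_def T_range_def)

lemma countable_chain: "m \<in> QH \<Longrightarrow> countable {r. (r, m) \<in> submap_chain}"
  by (rule countable_subset[OF _ countable_QH]) (auto dest: submap_chain_QH)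

lemma countable_T_range: "m \<in> QH \<Longrightarrow> countable (T_range m)"
  by (simp add: T_range_def countable_chain)

lemma T_eq_Some: "(r, m) \<in> submap_chain \<Longrightarrow> {\<omega> \<in> space M. T m \<omega> = Some r} = {\<omega> \<in> space M. S \<omega> = r}"
  by (auto simp: T_def)

lemma T_eq_None: "{\<omega> \<in> space M. T m \<omega> = None} = space M - (\<Union>r\<in>{r. (r, m) \<in> submap_chain}. {\<omega> \<in> space M. S \<omega> = r})"
  by (auto simp: T_def)

lemma sets_T:
  assumes "m \<in> QH" "t \<in> T_range m"
  shows "{\<omega> \<in> space M. T m \<omega> = t} \<in> sets M"
proof (cases t)
  case None
  show ?thesis
    unfolding None T_eq_None
    by (intro sets.Diff sets.top sets.countable_UN'' countable_chain assms(1) sets_S)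
next
  case (Some r)
  then have "(r, m) \<in> submap_chain" using assms(2) by (auto simp: T_range_def)
  then show ?thesis unfolding Some by (simp only: T_eq_Some sets_S)
qed

lemma hole_markov_T_None:
  assumes m: "m \<in> QH"
  shows "hole_markov {\<omega> \<in> space M. T m \<omega> = None} m"
  unfolding hole_markov_def
proof (intro ballI allI impI)
  fix A B assume A: "A \<in> sets (N m)" and "\<forall>h\<in>holes m. B h \<in> sets (deco_maps :: (_ \<times> 'v deco) measure)"
  then have B: "\<And>h. h \<in> holes m \<Longrightarrow> B h \<in> sets (deco_maps :: (_ \<times> 'v deco) measure)" by blast
  let ?E0 = "{\<omega> \<in> space M. T m \<omega> = None}" and ?C = "{r. (r, m) \<in> submap_chain}"
  let ?D = "density M (\<lambda>\<omega>. K m B (R m \<omega>))"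
  let ?A = "{\<omega> \<in> space M. R m \<omega> \<in> A}"
  let ?U = "\<lambda>W. \<Union>r\<in>?C. {\<omega> \<in> space M. S \<omega> = r} \<inter> ?A \<inter> W"
  have KR: "(\<lambda>\<omega>. K m B (R m \<omega>)) \<in> borel_measurable M"
    by (rule measurable_compose[OF R_meas[OF m] K_meas[OF m B]])
  have Am: "?A \<in> sets M" by (rule sets_R[OF m A])
  have Um: "?U W \<in> sets M" if "W \<in> sets M" for W
    by (intro sets.countable_UN'' countable_chain m sets.Int sets_S Am that)
  have E0: "?E0 \<in> sets M" using sets_T[OF m] by (simp add: T_range_def)
  have split: "?A \<inter> W = ?U W \<union> ?E0 \<inter> ?A \<inter> W" "?U W \<inter> (?E0 \<inter> ?A \<inter> W) = {}" for W
    unfolding T_eq_None by blast+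
  have sE: "?E0 \<inter> ?A \<inter> W \<in> sets M" if "W \<in> sets M" for W
    by (intro sets.Int E0 Am that)
  have C: "Cev m B \<in> sets M" by (rule sets_Cev[OF m B])
  have M: "emeasure M (?A \<inter> Cev m B) = emeasure M (?U (Cev m B)) + emeasure M (?E0 \<inter> ?A \<inter> Cev m B)"
    using plus_emeasure[OF Um[OF C] sE[OF C] split(2)] unfolding split(1)[symmetric] by (rule sym)
  have D: "emeasure ?D (?A \<inter> Ev m) = emeasure ?D (?U (Ev m)) + emeasure ?D (?E0 \<inter> ?A \<inter> Ev m)"
    using plus_emeasure[of "?U (Ev m)" ?D "?E0 \<inter> ?A \<inter> Ev m", OF _ _ split(2)] Um[OF sets_Ev] sE[OF sets_Ev]
    unfolding split(1)[symmetric] by (simp only: sets_density)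
  have U: "emeasure M (?U (Cev m B)) = emeasure ?D (?U (Ev m))"
  proof (rule hole_markov_UN[OF m countable_chain[OF m]])
    show "disjoint_family_on (\<lambda>r. {\<omega> \<in> space M. S \<omega> = r}) ?C" by (auto simp: disjoint_family_on_def)
  qed (use sets_S hole_markov_S_chain[OF _ m] A B in simp_all)
  have "emeasure M (space M \<inter> ?A \<inter> Cev m B) = (\<integral>\<^sup>+\<omega>. K m B (R m \<omega>) * indicator (space M \<inter> ?A \<inter> Ev m) \<omega> \<partial>M)"
    by (rule hole_markov_space[OF m, unfolded hole_markov_def, rule_format, OF A B])
  also have "\<dots> = emeasure ?D (space M \<inter> ?A \<inter> Ev m)"
    using KR Am sets_Ev by (intro emeasure_density[symmetric]) auto
  finally have "emeasure M (?A \<inter> Cev m B) = emeasure ?D (?A \<inter> Ev m)"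
    by (simp only: Int_absorb1[OF sets.sets_into_space[OF Am]])
  then have "emeasure ?D (?U (Ev m)) + emeasure M (?E0 \<inter> ?A \<inter> Cev m B) = emeasure ?D (?U (Ev m)) + emeasure ?D (?E0 \<inter> ?A \<inter> Ev m)"
    by (simp only: M D U)
  \<comment> \<open>Cancellation in \<open>ennreal\<close> needs a finite term; the integral of the
    kernel over the union is finite because it equals a probability.\<close>
  moreover have "emeasure ?D (?U (Ev m)) \<noteq> \<top>" unfolding U[symmetric] by (rule emeasure_finite[unfolded infinity_ennreal_def])
  ultimately have "emeasure M (?E0 \<inter> ?A \<inter> Cev m B) = emeasure ?D (?E0 \<inter> ?A \<inter> Ev m)"
    by (simp add: ennreal_add_left_cancel)
  also have "\<dots> = (\<integral>\<^sup>+\<omega>. K m B (R m \<omega>) * indicator (?E0 \<inter> ?A \<inter> Ev m) \<omega> \<partial>M)"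
    using KR E0 Am sets_Ev by (intro emeasure_density) auto
  finally show "emeasure M (?E0 \<inter> ?A \<inter> Cev m B) = (\<integral>\<^sup>+\<omega>. K m B (R m \<omega>) * indicator (?E0 \<inter> ?A \<inter> Ev m) \<omega> \<partial>M)" .
qed

lemma hole_markov_T:
  assumes "m \<in> QH" "t \<in> T_range m"
  shows "hole_markov {\<omega> \<in> space M. T m \<omega> = t} m"
proof (cases t)
  case (Some r)
  then have "(r, m) \<in> submap_chain" using assms(2) by (auto simp: T_range_def)
  then show ?thesis unfolding Some by (simp only: T_eq_Some hole_markov_S_chain[OF _ assms(1)])
qed (simp add: hole_markov_T_None[OF assms(1)])

text \<open>Every \<open>r\<close> with a chain to \<open>m\<close> contributes, so a further link
  can only enlarge the family, and the monotonicity of the filtration is immediate. Taking null sets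
  of the completion includes all subsets of null sets.\<close>

inductive_set gens :: "nat hmap option \<Rightarrow> 'w set set" for m where
  null: "G \<in> null_sets (completion M) \<Longrightarrow> G \<in> gens m"
| stop: "(r, m) \<in> submap_chain \<Longrightarrow> {\<omega> \<in> space M. S \<omega> = r} \<in> gens m"
| sub: "(r, m) \<in> submap_chain \<Longrightarrow> Ev r \<in> gens m"
| deco: "(r, m) \<in> submap_chain \<Longrightarrow> A \<in> sets (N r) \<Longrightarrow> {\<omega> \<in> space M. R r \<omega> \<in> A} \<in> gens m"

definition Filt :: "nat hmap option \<Rightarrow> 'w measure" where
  "Filt m = sigma (space M) (gens m)"

lemma gens_completion:
  assumes m: "m \<in> QH"
  shows "gens m \<subseteq> sets (completion M)"
proof
  fix G assume "G \<in> gens m"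
  then show "G \<in> sets (completion M)"
  proof cases
    case null
    then show ?thesis by (rule null_setsD2)
  next
    case (deco r A)
    then show ?thesis using sets_R[OF submap_chain_QH[OF _ m]] by simp
  qed (simp_all add: sets_S sets_Ev)
qed

lemma space_Filt [simp]: "space (Filt m) = space M"
  by (simp add: Filt_def space_measure_of_conv)

lemma sets_Filt: "m \<in> QH \<Longrightarrow> sets (Filt m) = sigma_sets (space M) (gens m)"
  unfolding Filt_def
  by (rule sets_measure_of)
    (metis gens_completion sets.space_closed space_completion subset_trans)

lemma gens_Filt: "m \<in> QH \<Longrightarrow> G \<in> gens m \<Longrightarrow> G \<in> sets (Filt m)"
  by (simp add: sets_Filt sigma_sets.Basic)

lemma subalgebra_Filt:
  assumes "m \<in> QH"
  shows "subalgebra (completion M) (Filt m)"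
  using sets.sigma_sets_subset[OF gens_completion[OF assms]]
  by (simp add: subalgebra_def sets_Filt[OF assms])

lemma map_filtration_Filt: "map_filtration (completion M) Filt"
  unfolding map_filtration_def
proof (intro conjI ballI allI impI)
  fix m A and N' assume m: "m \<in> QH" "N' \<in> null_sets (completion M)" "A \<subseteq> N'"
  have "A \<in> null_sets (completion M)" by (rule null_sets_completion_subset[OF m(3,2)])
  then show "A \<in> sets (Filt m)" by (intro gens_Filt m(1) gens.null)
next
  fix m m' assume m: "m \<in> QH" "m' \<in> QH" "m \<sqsubseteq>\<^sub>H m'"
  have "gens m \<subseteq> gens m'"
  proof
    fix G assume "G \<in> gens m"
    then show "G \<in> gens m'"
      by cases (simp_all add: gens.intros submap_chain_step[OF _ m])
  qed
  then show "sets (Filt m) \<subseteq> sets (Filt m')"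
    using m by (simp add: sets_Filt sigma_sets_mono')
qed (rule subalgebra_Filt)

text \<open>
  Reduces conditioning on the filtration at \<open>m\<close> to conditioning on the decoration of \<open>m\<close>,
  separately on each of the countably many events \<open>T m = t\<close>.
\<close>

lemma Filt_local:
  assumes m: "m \<in> QH" and G: "G \<in> sets (Filt m)"
  shows "\<exists>A\<in>sets (N m). AE \<omega> in M. \<omega> \<in> Ev m \<and> T m \<omega> = t \<longrightarrow> (\<omega> \<in> G \<longleftrightarrow> R m \<omega> \<in> A)"
proof -
  have Rsp: "R m \<omega> \<in> space (N m)" if "\<omega> \<in> space M" for \<omega>
    using measurable_space[OF R_meas[OF m] that] .
  show ?thesis
    using G unfolding sets_Filt[OF m]
  proof (induction rule: sigma_sets.induct)
    case (Basic G)
    then show ?case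
    proof cases
      case null
      then have "AE \<omega> in M. \<omega> \<notin> G" by (rule iffD1[OF AE_completion_iff AE_not_in])
      then show ?thesis by (intro bexI[of _ "{}"]) auto
    next
      \<comment> \<open>Where \<open>T m\<close> has the fixed value \<open>t\<close>, the event
        \<open>S = r\<close> either holds throughout or fails throughout, since \<open>r\<close> has
        a chain to \<open>m\<close>.\<close>
      case (stop r)
      have "\<omega> \<in> G \<longleftrightarrow> R m \<omega> \<in> (if t = Some r then space (N m) else {})"
        if "\<omega> \<in> space M" "T m \<omega> = t" for \<omega>
        using that stop Rsp by (auto simp: T_def split: if_splits)
      then show ?thesis by (intro bexI[of _ "if t = Some r then space (N m) else {}"] AE_I2) auto
    next
      \<comment> \<open>Where \<open>m\<close> is a submap of \<open>X\<close>, so is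
        \<open>r\<close>; the generator is trivial there.\<close>
      case (sub r)
      have "\<omega> \<in> G \<longleftrightarrow> R m \<omega> \<in> space (N m)" if "\<omega> \<in> space M" "\<omega> \<in> Ev m" for \<omega>
        using that sub Rsp submap_chain_restr[where ?'v='v, OF sub(2) m] X_QB[OF that(1)] by (auto simp: Ev_def)
      then show ?thesis by (intro bexI[of _ "space (N m)"] AE_I2) auto
    next
      case (deco r A)
      obtain \<theta> where \<theta>: "\<And>F. F \<in> inner_faces_H r \<Longrightarrow> \<theta> F \<in> inner_faces_H m"
        "\<And>x (\<sigma> :: 'v deco). x \<in> QB \<Longrightarrow> m \<sqsubseteq>\<^sub>H Some x \<Longrightarrow> restr r x \<sigma> = (\<lambda>F\<in>inner_faces_H r. restr m x \<sigma> (\<theta> F))"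
        using submap_chain_restr[where ?'v='v, OF deco(2) m] by blast
      let ?\<psi> = "\<lambda>\<tau>. \<lambda>F\<in>inner_faces_H r. \<tau> (\<theta> F)"
      have \<psi>: "?\<psi> \<in> measurable (N m) (N r)"
        by (intro measurable_restrict measurable_component_singleton \<theta>(1))
      have "\<omega> \<in> G \<longleftrightarrow> R m \<omega> \<in> ?\<psi> -` A \<inter> space (N m)" if "\<omega> \<in> space M" "\<omega> \<in> Ev m" for \<omega>
      proof -
        have "R r \<omega> = ?\<psi> (R m \<omega>)"
          unfolding R_def using that X_QB[OF that(1)] by (intro \<theta>(2)) (simp_all add: Ev_def)
        then show ?thesis using that(1) deco(1) Rsp[OF that(1)] by simp
      qed
      then show ?thesis
        by (intro bexI[of _ "?\<psi> -` A \<inter> space (N m)"] AE_I2 measurable_sets[OF \<psi> deco(3)]) auto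
    qed
  next
    case Empty
    show ?case by (intro bexI[of _ "{}"]) auto
  next
    case (Compl G)
    then obtain A where A: "A \<in> sets (N m)" "AE \<omega> in M. \<omega> \<in> Ev m \<and> T m \<omega> = t \<longrightarrow> (\<omega> \<in> G \<longleftrightarrow> R m \<omega> \<in> A)" by blast
    have "AE \<omega> in M. \<omega> \<in> Ev m \<and> T m \<omega> = t \<longrightarrow> (\<omega> \<in> space M - G \<longleftrightarrow> R m \<omega> \<in> space (N m) - A)"
      using A(2) AE_space by eventually_elim (use Rsp in auto)
    then show ?case using A(1) by (intro bexI[of _ "space (N m) - A"]) auto
  next
    case (Union G)
    then have "\<forall>i. \<exists>A. A \<in> sets (N m) \<and> (AE \<omega> in M. \<omega> \<in> Ev m \<and> T m \<omega> = t \<longrightarrow> (\<omega> \<in> G i \<longleftrightarrow> R m \<omega> \<in> A))"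
      by (simp only: Bex_def) blast
    from choice[OF this] obtain A where A0: "\<forall>i. A i \<in> sets (N m) \<and>
      (AE \<omega> in M. \<omega> \<in> Ev m \<and> T m \<omega> = t \<longrightarrow> (\<omega> \<in> G i \<longleftrightarrow> R m \<omega> \<in> A i))" by (rule exE)
    note A = conjunct1[OF spec[OF A0]] conjunct2[OF spec[OF A0]]
    have "AE \<omega> in M. \<forall>i. \<omega> \<in> Ev m \<and> T m \<omega> = t \<longrightarrow> (\<omega> \<in> G i \<longleftrightarrow> R m \<omega> \<in> A i)"
      by (rule iffD2[OF AE_all_countable]) (intro allI A(2))
    then have "AE \<omega> in M. \<omega> \<in> Ev m \<and> T m \<omega> = t \<longrightarrow> (\<omega> \<in> (\<Union>i. G i) \<longleftrightarrow> R m \<omega> \<in> (\<Union>i. A i))"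
      by eventually_elim auto
    then show ?case using A(1) by (intro bexI[of _ "\<Union>i. A i"]) auto
  qed
qed

lemma measurable_R_Filt:
  assumes m: "m \<in> QH"
  shows "R m \<in> measurable (Filt m) (N m)"
proof (rule measurableI)
  show "R m \<omega> \<in> space (N m)" if "\<omega> \<in> space (Filt m)" for \<omega>
    using measurable_space[OF R_meas[OF m]] that by simp
  fix A assume "A \<in> sets (N m)"
  then have "{\<omega> \<in> space M. R m \<omega> \<in> A} \<in> gens m" by (rule gens.deco[OF submap_chain_refl])
  then have "{\<omega> \<in> space M. R m \<omega> \<in> A} \<in> sets (Filt m)" by (rule gens_Filt[OF m])
  then show "R m -` A \<inter> space (Filt m) \<in> sets (Filt m)" by (simp add: vimage_def Int_def conj_commute)
qed

text \<open>A conditional expectation is determined by its integrals over events \<open>G\<close> of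
  the filtration. On \<open>Ev m\<close> and up to null sets, \<open>G\<close> is the condition
  \<open>R m \<omega> \<in> A (T m \<omega>)\<close>, a countable disjoint union to which
  \<open>hole_markov_UN\<close> applies.\<close>

lemma holes_indep_Filt:
  assumes m: "m \<in> QH"
  shows "holes_indep_boltzmann \<beta> q \<mu> l b (completion M) X \<phi> (Filt m) (Ev m) m"
  unfolding holes_indep_boltzmann_def
proof (intro allI impI)
  fix B assume "\<forall>h\<in>holes m. B h \<in> sets (deco_maps :: (_ \<times> 'v deco) measure)"
  then have B: "\<And>h. h \<in> holes m \<Longrightarrow> B h \<in> sets (deco_maps :: (_ \<times> 'v deco) measure)" by blast
  interpret C: prob_space "completion M" by (rule prob_space_completion)
  interpret F: finite_measure_subalgebra "completion M" "Filt m"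
    by unfold_locales (rule subalgebra_Filt[OF m])
  have C: "Cev m B \<in> sets M" by (rule sets_Cev[OF m B])
  have KR: "(\<lambda>\<omega>. K m B (R m \<omega>)) \<in> borel_measurable M"
    by (rule measurable_compose[OF R_meas[OF m] K_meas[OF m B]])
  note RF = measurable_R_Filt[OF m]
  have EF: "Ev m \<in> sets (Filt m)"
    by (rule gens_Filt[OF m gens.sub[OF submap_chain_refl]])
  let ?g = "\<lambda>\<omega>. K m B (R m \<omega>) * indicator (Ev m) \<omega>"
  have "AE \<omega> in completion M. ?g \<omega> = nn_cond_exp (completion M) (Filt m) (indicator (Cev m B)) \<omega>"
  proof (rule F.nn_cond_exp_charact)
    show "indicator (Cev m B) \<in> borel_measurable (completion M)"
      using C by (intro borel_measurable_indicator) simp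
    show "?g \<in> borel_measurable (Filt m)"
      using measurable_compose[OF RF K_meas[OF m B]] EF by simp
    fix G assume G: "G \<in> sets (Filt m)"
    have "\<forall>t. \<exists>A. A \<in> sets (N m) \<and> (AE \<omega> in M. \<omega> \<in> Ev m \<and> T m \<omega> = t \<longrightarrow> (\<omega> \<in> G \<longleftrightarrow> R m \<omega> \<in> A))"
      using Filt_local[OF m G] by (simp only: Bex_def) blast
    from choice[OF this] obtain A where A0: "\<forall>t. A t \<in> sets (N m) \<and>
      (AE \<omega> in M. \<omega> \<in> Ev m \<and> T m \<omega> = t \<longrightarrow> (\<omega> \<in> G \<longleftrightarrow> R m \<omega> \<in> A t))" by (rule exE)
    note A = conjunct1[OF spec[OF A0]] conjunct2[OF spec[OF A0]]
    have "AE \<omega> in M. \<forall>t\<in>T_range m. \<omega> \<in> Ev m \<and> T m \<omega> = t \<longrightarrow> (\<omega> \<in> G \<longleftrightarrow> R m \<omega> \<in> A t)"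
      by (rule iffD2[OF AE_ball_countable[OF countable_T_range[OF m]]]) (intro ballI A(2))
    then have loc: "AE \<omega> in M. \<omega> \<in> Ev m \<longrightarrow> (\<omega> \<in> G \<longleftrightarrow> R m \<omega> \<in> A (T m \<omega>))"
      by eventually_elim (use T_in_range in blast)
    \<comment> \<open>The union over the values of \<open>T m\<close> is an event of
      \<open>M\<close>, whereas \<open>G\<close> is only known to be an event of the
      completion.\<close>
    let ?W = "\<lambda>W. \<Union>t\<in>T_range m. {\<omega> \<in> space M. T m \<omega> = t} \<inter> {\<omega> \<in> space M. R m \<omega> \<in> A t} \<inter> W"
    have W: "\<omega> \<in> ?W W \<longleftrightarrow> \<omega> \<in> space M \<and> R m \<omega> \<in> A (T m \<omega>) \<and> \<omega> \<in> W" for \<omega> W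
      using T_in_range[of m \<omega>] by auto
    have sW: "?W W \<in> sets M" if "W \<in> sets M" for W
      by (intro sets.countable_UN'' countable_T_range m sets.Int sets_T sets_R A(1) that)
    have "(\<integral>\<^sup>+\<omega>\<in>G. indicator (Cev m B) \<omega> \<partial>completion M) = (\<integral>\<^sup>+\<omega>. indicator (?W (Cev m B)) \<omega> \<partial>M)"
      unfolding nn_integral_completion
      using loc AE_space by (intro nn_integral_cong_AE, eventually_elim) (auto simp: indicator_def W Cev_def T_in_range)
    also have "\<dots> = emeasure M (?W (Cev m B))"
      by (rule nn_integral_indicator[OF sW[OF C]])
    also have "\<dots> = emeasure (density M (\<lambda>\<omega>. K m B (R m \<omega>))) (?W (Ev m))"
    proof (rule hole_markov_UN[OF m countable_T_range[OF m]])
      show "disjoint_family_on (\<lambda>t. {\<omega> \<in> space M. T m \<omega> = t}) (T_range m)" by (auto simp: disjoint_family_on_def)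
    qed (use sets_T[OF m] hole_markov_T[OF m] A(1) B in simp_all)
    also have "\<dots> = (\<integral>\<^sup>+\<omega>. K m B (R m \<omega>) * indicator (?W (Ev m)) \<omega> \<partial>M)"
      by (rule emeasure_density[OF KR sW[OF sets_Ev]])
    also have "\<dots> = (\<integral>\<^sup>+\<omega>\<in>G. ?g \<omega> \<partial>completion M)"
      unfolding nn_integral_completion
      using loc AE_space by (intro nn_integral_cong_AE, eventually_elim) (auto simp: indicator_def W T_in_range)
    finally show "(\<integral>\<^sup>+\<omega>\<in>G. indicator (Cev m B) \<omega> \<partial>completion M) = (\<integral>\<^sup>+\<omega>\<in>G. ?g \<omega> \<partial>completion M)" .
  qed
  moreover have "{\<omega>' \<in> Ev m. m \<sqsubseteq>\<^sub>H Some (X \<omega>') \<and>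
      (\<forall>h\<in>holes m. (content m (X \<omega>') h, content_deco m (X \<omega>') (\<phi> \<omega>') h) \<in> B h)} = Cev m B"
    by (auto simp: Cev_def Ev_def)
  ultimately show "AE \<omega> in completion M. \<omega> \<in> Ev m \<longrightarrow>
      nn_cond_exp (completion M) (Filt m) (indicator {\<omega>' \<in> Ev m. m \<sqsubseteq>\<^sub>H Some (X \<omega>') \<and>
        (\<forall>h\<in>holes m. (content m (X \<omega>') h, content_deco m (X \<omega>') (\<phi> \<omega>') h) \<in> B h)}) \<omega> =
      (\<Prod>h\<in>holes m. emeasure (law (hole_per (2 * l) m h) (hole_bc b m (restr m (X \<omega>) (\<phi> \<omega>)) h)) (B h))"
    unfolding K_def R_def by (auto elim!: eventually_mono)
qed

lemma boltzmann_map_completion: "boltzmann_map \<beta> q \<mu> l b (completion M) X \<phi>"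
proof -
  have "distr (completion M) deco_maps (\<lambda>\<omega>. (X \<omega>, \<phi> \<omega>)) = distr M deco_maps (\<lambda>\<omega>. (X \<omega>, \<phi> \<omega>))"
  proof (rule measure_eqI)
    fix A assume "A \<in> sets (distr (completion M) deco_maps (\<lambda>\<omega>. (X \<omega>, \<phi> \<omega>)))"
    then have A: "A \<in> sets deco_maps" by simp
    show "emeasure (distr (completion M) deco_maps (\<lambda>\<omega>. (X \<omega>, \<phi> \<omega>))) A = emeasure (distr M deco_maps (\<lambda>\<omega>. (X \<omega>, \<phi> \<omega>))) A"
      using measurable_sets[OF X\<phi>_meas A]
      by (simp add: emeasure_distr[OF X\<phi>_meas A] emeasure_distr[OF measurable_completion[OF X\<phi>_meas] A])
  qed simp
  then have "distr (completion M) deco_maps (\<lambda>\<omega>. (X \<omega>, \<phi> \<omega>)) = law (2 * l) b"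
    by (simp only: distr_X)
  then show ?thesis
    using local_map measurable_completion[OF X_meas] measurable_completion[OF \<phi>_meas]
    unfolding local_map_def boltzmann_map_def by (elim conjE) (intro conjI; assumption)
qed

lemma filtered_boltzmann_map_Filt:
  "filtered_boltzmann_map \<beta> q \<mu> l b (completion M) Filt X \<phi>"
  unfolding filtered_boltzmann_map_def
proof (intro conjI ballI boltzmann_map_completion)
  fix m assume m: "m \<in> QH"
  have E: "{\<omega> \<in> space (completion M). m \<sqsubseteq>\<^sub>H Some (X \<omega>)} = Ev m" by (simp add: Ev_def)
  show "{\<omega> \<in> space (completion M). m \<sqsubseteq>\<^sub>H Some (X \<omega>)} \<in> sets (Filt m)"
    unfolding E by (rule gens_Filt[OF m gens.sub[OF submap_chain_refl]])
  show "(\<lambda>\<omega>. restr m (X \<omega>) (\<phi> \<omega>)) \<in> measurable (Filt m) (N m)"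
    using measurable_R_Filt[OF m] by (simp add: R_def[abs_def])
  show "holes_indep_boltzmann \<beta> q \<mu> l b (completion M) X \<phi> (Filt m) {\<omega> \<in> space (completion M). m \<sqsubseteq>\<^sub>H Some (X \<omega>)} m"
    unfolding E by (rule holes_indep_Filt[OF m])
qed

lemma stopping_map_Filt: "stopping_map (completion M) Filt X S"
  unfolding stopping_map_def
proof (intro conjI ballI)
  show "S \<in> measurable (completion M) (count_space QH)" by (rule measurable_completion[OF S_meas])
  show "AE \<omega> in completion M. S \<omega> \<sqsubseteq>\<^sub>H Some (X \<omega>)" by (rule AE_completion[OF S_sub])
  fix m assume m: "m \<in> QH"
  \<comment> \<open>A submap of \<open>m\<close> is a chain with one link, and \<open>S\<close> has
    countably many values, so the event is a countable union of generators.\<close>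
  have "{\<omega> \<in> space (completion M). S \<omega> \<sqsubseteq>\<^sub>H m} = (\<Union>r\<in>{r \<in> QH. r \<sqsubseteq>\<^sub>H m}. {\<omega> \<in> space M. S \<omega> = r})"
    using S_QH by auto
  also have "\<dots> \<in> sets (Filt m)"
  proof (rule sets.countable_UN'')
    show "countable {r \<in> QH. r \<sqsubseteq>\<^sub>H m}" by (rule countable_subset[OF _ countable_QH]) auto
    fix r assume "r \<in> {r \<in> QH. r \<sqsubseteq>\<^sub>H m}"
    then have "(r, m) \<in> submap_chain" using submap_chain_step[OF submap_chain_refl _ m] by blast
    then show "{\<omega> \<in> space M. S \<omega> = r} \<in> sets (Filt m)"
      by (intro gens_Filt m gens.stop)
  qed
  finally show "{\<omega> \<in> space (completion M). S \<omega> \<sqsubseteq>\<^sub>H m} \<in> sets (Filt m)" .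
qed

end

text \<open>The members of a filtration contain all subsets of null sets, and these need not be
  events of \<open>M\<close>. The conclusion is therefore formulated on the completion, where the
  random variables keep their laws.\<close>

theorem theorem6p2:
  fixes M :: "'w measure" and \<mu> :: "(real ^ 'n) measure" and \<beta> q :: real
    and l :: nat and b :: "nat \<Rightarrow> real ^ 'n"
    and X :: "'w \<Rightarrow> nat hmap" and \<phi> :: "'w \<Rightarrow> (real ^ 'n) deco"
    and S :: "'w \<Rightarrow> nat hmap option"
  assumes "prob_space M"
    and "\<beta> > 0" and "q \<ge> 0"
    and "sets \<mu> = sets borel" and "sigma_finite_measure \<mu>"
    and "local_map \<beta> q \<mu> l b M X \<phi> S"
  shows "\<exists>F. map_filtration (completion M) F \<and>
             filtered_boltzmann_map \<beta> q \<mu> l b (completion M) F X \<phi> \<and>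
             stopping_map (completion M) F X S"
proof -
  interpret local_map_space \<beta> q \<mu> M l b X \<phi> S
    using assms by (intro local_map_space.intro boltzmann.intro local_map_space_axioms.intro)
  show ?thesis
    by (intro exI[of _ Filt] conjI map_filtration_Filt filtered_boltzmann_map_Filt stopping_map_Filt)
qed

end
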